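(* Suppose that for all sufficiently large positive integers $r$ there exists a positive integer $M_r$ such that $\overline{\nu}_m=0$ in $\overline{\mathcal M}(r,4)_m$ for all $m$ with $M_r+1\le m\le 2M_r$. Then the Jacobian Conjecture is true; that is, for every integer $n\ge 1$ and all polynomials $F_1,\ldots,F_n\in\mathbb C[X_1,\ldots,X_n]$, the polynomial map $F=(F_1,\ldots,F_n):\mathbb C^n\to\mathbb C^n$ is an automorphism (has a polynomial inverse) if the determinant of the Jacobian matrix $(\partial F_j/\partial X_i)$ is a nonzero constant.
   Context: All trees are finite. $\mathbb T_{\rm rt}$ is the set of isomorphism classes of rooted trees, $\mathbb T$ the set of isomorphism classes of free (unrooted) trees, $\mathbb T_m\subset\mathbb T$ those with $m$ vertices. Grossman–Larson algebra: $\mathcal H$ is the $\mathbb Q$-vector space with basis $\mathbb T_{\rm rt}$. For a tree $T$ (rooted or not), rooted trees $S_1,\ldots,S_k$ and $v_1,\ldots,v_k\in V(T)$, let $(S_1,\ldots,S_k)\multimap_{(v_1,\ldots,v_k)}T$ be the tree obtained by joining, for each $i$, the root of $S_i$ to $v_i$ by a new edge (if $T$ is rooted, the root is that of $T$; otherwise the result is unrooted). For a rooted tree $S$, let $S_1,\ldots,S_k$ (with multiplicity) be the rooted trees obtained by deleting the root of $S$ and its adjacent edges, rooted at the children of the root of $S$. Define $$S\cdot T=\sum_{(v_1,\ldots,v_k)\in V(T)^k}(S_1,\ldots,S_k)\multimap_{(v_1,\ldots,v_k)}T .$$ Extended linearly, for rooted $T$ this makes $\mathcal H$ an associative unital $\mathbb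 Q$-algebra, and for unrooted $T$ it makes the $\mathbb Q$-vector space $\mathcal M$ with basis $\mathbb T$ into an $\mathcal H$-module. $\mathcal H$ is graded by the number of non-root vertices and $\mathcal M=\bigoplus_{m\ge1}\mathcal M_m$ is a graded module with $\mathcal M_m$ spanned by $\mathbb T_m$. A naked $r$-chain in a tree is a geodesic with vertices $v_1,\ldots,v_r$ (consecutive ones joined by edges) such that $v_2,\ldots,v_{r-1}$ have degree $2$ in the tree and $v_1,v_r$ have degree $1$ or $2$. $\mathcal C(r)$ is the $\mathcal H$-submodule of $\mathcal M$ generated by all trees containing a naked $r$-chain. $\mathcal V(e)$ is the $\mathbb Q$-subspace (in fact $\mathcal H$-submodule) spanned by all trees having at least one vertex of degree $\ge e+1$. Put $\overline{\mathcal M}(r,e)=\mathcal M/(\mathcal C(r)+\mathcal V(e))$, a graded $\mathcal H$-module with degree $m$ component $\overline{\mathcal M}(r,e)_m$. Finally $\nu_m=\sum_{T\in\mathbb T_m}\frac{1}{|\mathrm{Aut}\,T|}T\in\mathcal M_m$, and $\overline\nu_m$ is its image in $\overline{\mathcal M}(r,4)_m$. *)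

theory Defs
  imports
    "HOL-Library.Poly_Mapping"
    "HOL-Library.Set_Algebras"
    "HOL-Library.Nat_Bijection"
    "HOL-Combinatorics.Permutations"
    "Jordan_Normal_Form.Determinant"
begin

text \<open>Vertices are natural numbers, edges are two-element sets of vertices; every finite graph is
  isomorphic to one of this form.\<close>

type_synonym graph = "nat set \<times> nat set set"

abbreviation verts :: "graph \<Rightarrow> nat set" where "verts \<equiv> fst"
abbreviation edges :: "graph \<Rightarrow> nat set set" where "edges \<equiv> snd"

definition is_graph :: "graph \<Rightarrow> bool" where
  "is_graph G \<longleftrightarrow> finite (verts G) \<and> (\<forall>e\<in>edges G. e \<subseteq> verts G \<and> card e = 2)"

definition vdegree :: "graph \<Rightarrow> nat \<Rightarrow> nat" where
  "vdegree G v = card {e \<in> edges G. v \<in> e}"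

definition is_walk :: "graph \<Rightarrow> nat list \<Rightarrow> bool" where
  "is_walk G vs \<longleftrightarrow>
     vs \<noteq> [] \<and> set vs \<subseteq> verts G \<and> successively (\<lambda>u v. {u, v} \<in> edges G) vs"

definition reachable :: "graph \<Rightarrow> nat \<Rightarrow> nat \<Rightarrow> bool" where
  "reachable G u v \<longleftrightarrow> (\<exists>vs. is_walk G vs \<and> hd vs = u \<and> last vs = v)"

definition is_cycle :: "graph \<Rightarrow> nat list \<Rightarrow> bool" where
  "is_cycle G vs \<longleftrightarrow>
     is_walk G vs \<and> distinct vs \<and> 3 \<le> length vs \<and> {last vs, hd vs} \<in> edges G"

definition is_tree :: "graph \<Rightarrow> bool" where
  "is_tree G \<longleftrightarrow> is_graph G \<and> verts G \<noteq> {} \<and>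
     (\<forall>u\<in>verts G. \<forall>v\<in>verts G. reachable G u v) \<and> (\<nexists>vs. is_cycle G vs)"

definition is_geodesic :: "graph \<Rightarrow> nat list \<Rightarrow> bool" where
  "is_geodesic G vs \<longleftrightarrow> is_walk G vs \<and>
     (\<forall>ws. is_walk G ws \<and> hd ws = hd vs \<and> last ws = last vs \<longrightarrow> length vs \<le> length ws)"

definition is_naked_chain :: "graph \<Rightarrow> nat \<Rightarrow> nat list \<Rightarrow> bool" where
  "is_naked_chain G r vs \<longleftrightarrow> is_geodesic G vs \<and> length vs = r \<and>
     (\<forall>i. 0 < i \<and> i < r - 1 \<longrightarrow> vdegree G (vs ! i) = 2) \<and>
     vdegree G (hd vs) \<in> {1, 2} \<and> vdegree G (last vs) \<in> {1, 2}"

definition is_iso :: "(nat \<Rightarrow> nat) \<Rightarrow> graph \<Rightarrow> graph \<Rightarrow> bool" where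
  "is_iso f G H \<longleftrightarrow> bij_betw f (verts G) (verts H) \<and> (\<lambda>e. f ` e) ` edges G = edges H"

text \<open>Requiring \<^term>\<open>f permutes verts G\<close> fixes the values of \<^term>\<open>f\<close> outside the
  vertex set, so that distinct elements are distinct maps on vertices.\<close>

definition automorphisms :: "graph \<Rightarrow> (nat \<Rightarrow> nat) set" where
  "automorphisms G = {f. f permutes verts G \<and> is_iso f G G}"

lemma is_iso_id: "is_iso id G G"
  by (simp add: is_iso_def)

lemma is_iso_inv:
  assumes G: "is_graph G" and f: "is_iso f G H"
  shows "is_iso (the_inv_into (verts G) f) H G"
proof -
  let ?g = "the_inv_into (verts G) f"
  have b: "bij_betw f (verts G) (verts H)" and e: "(\<lambda>e. f ` e) ` edges G = edges H"
    using f by (auto simp: is_iso_def)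
  have inj: "inj_on f (verts G)" using b by (simp add: bij_betw_def)
  have "?g ` f ` d = d" if "d \<in> edges G" for d
  proof -
    have "d \<subseteq> verts G" using that G by (auto simp: is_graph_def)
    then have "?g (f x) = x" if "x \<in> d" for x
      using the_inv_into_f_f[OF inj] that by blast
    then show ?thesis by (force simp: image_image)
  qed
  then have "(\<lambda>e. ?g ` e) ` edges H = edges G"
    unfolding e[symmetric] by (force simp: image_image)
  with bij_betw_the_inv_into[OF b] show ?thesis by (simp add: is_iso_def)
qed

lemma is_iso_comp:
  assumes "is_iso f G H" "is_iso g H K"
  shows "is_iso (g \<circ> f) G K"
proof -
  have "(\<lambda>e. (g \<circ> f) ` e) ` edges G = (\<lambda>e. g ` e) ` (\<lambda>e. f ` e) ` edges G"
    by (simp add: image_image image_comp)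
  then show ?thesis
    using assms by (auto simp: is_iso_def intro: bij_betw_trans)
qed

lemma is_tree_singleton: "is_tree ({0}, {})"
proof -
  have "is_walk ({0}, {}) [0]" by (simp add: is_walk_def)
  then have "reachable ({0}, {}) 0 0" by (fastforce simp: reachable_def)
  then show ?thesis by (simp add: is_tree_def is_graph_def is_cycle_def)
qed

definition tree_iso :: "graph \<Rightarrow> graph \<Rightarrow> bool" where
  "tree_iso G H \<longleftrightarrow> is_tree G \<and> is_tree H \<and> (\<exists>f. is_iso f G H)"

quotient_type utree = graph / partial: tree_iso
proof (rule part_equivpI)
  show "\<exists>G. tree_iso G G"
    using is_tree_singleton is_iso_id unfolding tree_iso_def by blast
  show "symp tree_iso"
    by (rule sympI) (meson is_iso_inv is_tree_def tree_iso_def)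
  show "transp tree_iso"
    by (rule transpI) (meson is_iso_comp tree_iso_def)
qed

definition is_rtree :: "graph \<times> nat \<Rightarrow> bool" where
  "is_rtree S \<longleftrightarrow> is_tree (fst S) \<and> snd S \<in> verts (fst S)"

definition rtree_iso :: "graph \<times> nat \<Rightarrow> graph \<times> nat \<Rightarrow> bool" where
  "rtree_iso S T \<longleftrightarrow> is_rtree S \<and> is_rtree T \<and>
     (\<exists>f. is_iso f (fst S) (fst T) \<and> f (snd S) = snd T)"

quotient_type rtree = "graph \<times> nat" / partial: rtree_iso
proof (rule part_equivpI)
  have "is_rtree (({0}, {}), 0)" using is_tree_singleton by (simp add: is_rtree_def)
  then show "\<exists>S. rtree_iso S S"
    using is_iso_id unfolding rtree_iso_def by (metis id_apply)
  show "symp rtree_iso"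
  proof (rule sympI)
    fix S T assume "rtree_iso S T"
    then obtain f where *: "is_rtree S" "is_rtree T" "is_iso f (fst S) (fst T)" "f (snd S) = snd T"
      by (auto simp: rtree_iso_def)
    then have "is_iso (the_inv_into (verts (fst S)) f) (fst T) (fst S)"
      by (simp add: is_iso_inv is_rtree_def is_tree_def)
    moreover have "the_inv_into (verts (fst S)) f (snd T) = snd S"
      using * by (metis bij_betw_def is_iso_def is_rtree_def the_inv_into_f_f)
    ultimately show "rtree_iso T S" using * by (auto simp: rtree_iso_def)
  qed
  show "transp rtree_iso"
  proof (rule transpI)
    fix S T U assume "rtree_iso S T" "rtree_iso T U"
    then show "rtree_iso S U"
      unfolding rtree_iso_def using is_iso_comp by (metis comp_apply)
  qed
qed

text \<open>\<^term>\<open>rep_utree\<close> and \<^term>\<open>rep_rtree\<close> choose a representative of an isomorphism class.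
  They are only applied below inside constructions that are invariant under isomorphism.\<close>

definition order_tree :: "utree \<Rightarrow> nat" where
  "order_tree T = card (verts (rep_utree T))"

definition aut_count :: "utree \<Rightarrow> nat" where
  "aut_count T = card (automorphisms (rep_utree T))"

definition delete_vertex :: "graph \<Rightarrow> nat \<Rightarrow> graph" where
  "delete_vertex G v = (verts G - {v}, {e \<in> edges G. v \<notin> e})"

definition component :: "graph \<Rightarrow> nat \<Rightarrow> graph" where
  "component G v = ({u \<in> verts G. reachable G v u}, {e \<in> edges G. \<forall>u\<in>e. reachable G v u})"

definition children :: "graph \<times> nat \<Rightarrow> nat set" where
  "children S = {c. {snd S, c} \<in> edges (fst S)}"

definition branches :: "graph \<times> nat \<Rightarrow> (graph \<times> nat) list" where
  "branches S =
     map (\<lambda>c. (component (delete_vertex (fst S) (snd S)) c, c)) (sorted_list_of_set (children S))"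

text \<open>The tree obtained from the disjoint union of \<^term>\<open>T\<close> and the \<^term>\<open>Ss ! i\<close> by joining the
  root of \<^term>\<open>Ss ! i\<close> to \<^term>\<open>vs ! i\<close>. In the disjoint union, \<^term>\<open>T\<close> carries the tag
  \<^term>\<open>0::nat\<close> and \<^term>\<open>Ss ! i\<close> the tag \<^term>\<open>Suc i\<close>.\<close>

definition relabel :: "nat \<Rightarrow> nat \<Rightarrow> nat" where
  "relabel i v = prod_encode (i, v)"

definition graft :: "(graph \<times> nat) list \<Rightarrow> nat list \<Rightarrow> graph \<Rightarrow> graph" where
  "graft Ss vs T =
     (relabel 0 ` verts T \<union> (\<Union>i<length Ss. relabel (Suc i) ` verts (fst (Ss ! i))),
      (\<lambda>e. relabel 0 ` e) ` edges T
        \<union> (\<Union>i<length Ss. (\<lambda>e. relabel (Suc i) ` e) ` edges (fst (Ss ! i)))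
        \<union> (\<lambda>i. {relabel 0 (vs ! i), relabel (Suc i) (snd (Ss ! i))}) ` {..<length Ss})"

type_synonym tree_module = "utree \<Rightarrow>\<^sub>0 rat"
type_synonym gl_algebra = "rtree \<Rightarrow>\<^sub>0 rat"

abbreviation tree_basis :: "utree \<Rightarrow> tree_module" where
  "tree_basis T \<equiv> Poly_Mapping.single T 1"

definition tscale :: "rat \<Rightarrow> tree_module \<Rightarrow> tree_module" where
  "tscale c x = Poly_Mapping.map ((*) c) x"

lemma lookup_tscale: "Poly_Mapping.lookup (tscale c x) T = c * Poly_Mapping.lookup x T"
  by (simp add: tscale_def Poly_Mapping.map.rep_eq when_def)

interpretation TM: vector_space tscale
  by unfold_locales (auto intro!: poly_mapping_eqI simp: lookup_tscale lookup_add algebra_simps)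

definition act_basis :: "rtree \<Rightarrow> utree \<Rightarrow> tree_module" where
  "act_basis S T =
     (let Ss = branches (rep_rtree S); G = rep_utree T in
      \<Sum>vs | set vs \<subseteq> verts G \<and> length vs = length Ss. tree_basis (abs_utree (graft Ss vs G)))"

definition act :: "gl_algebra \<Rightarrow> tree_module \<Rightarrow> tree_module" where
  "act h x = (\<Sum>S\<in>Poly_Mapping.keys h. \<Sum>T\<in>Poly_Mapping.keys x.
     tscale (Poly_Mapping.lookup h S * Poly_Mapping.lookup x T) (act_basis S T))"

definition gl_submodule :: "tree_module set \<Rightarrow> bool" where
  "gl_submodule N \<longleftrightarrow> TM.subspace N \<and> (\<forall>h. \<forall>x\<in>N. act h x \<in> N)"

definition chain_submodule :: "nat \<Rightarrow> tree_module set" where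
  "chain_submodule r =
     gl_submodule hull {tree_basis (abs_utree G) | G. is_tree G \<and> (\<exists>vs. is_naked_chain G r vs)}"

definition degree_submodule :: "nat \<Rightarrow> tree_module set" where
  "degree_submodule e =
     TM.span {tree_basis (abs_utree G) | G. is_tree G \<and> (\<exists>v\<in>verts G. e + 1 \<le> vdegree G v)}"

text \<open>The canonical projection onto the quotient by
  \<^term>\<open>chain_submodule r + degree_submodule e\<close>, whose elements are cosets.\<close>

definition mbar :: "nat \<Rightarrow> nat \<Rightarrow> tree_module \<Rightarrow> tree_module set" where
  "mbar r e x = x +o (chain_submodule r + degree_submodule e)"

definition nu :: "nat \<Rightarrow> tree_module" where
  "nu m = (\<Sum>T | order_tree T = m. tscale (1 / of_nat (aut_count T)) (tree_basis T))"

text \<open>Complex polynomials in variables indexed by natural numbers: finitely supported maps from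
  exponent vectors to coefficients. The ring of polynomials in \<^term>\<open>n\<close> variables uses the
  variables with index below \<^term>\<open>n\<close>.\<close>

type_synonym cpoly = "(nat \<Rightarrow>\<^sub>0 nat) \<Rightarrow>\<^sub>0 complex"

definition polys :: "nat \<Rightarrow> cpoly set" where
  "polys n = {p. \<forall>a\<in>Poly_Mapping.keys p. Poly_Mapping.keys a \<subseteq> {..<n}}"

definition const_poly :: "complex \<Rightarrow> cpoly" where
  "const_poly c = Poly_Mapping.single 0 c"

definition peval :: "cpoly \<Rightarrow> (nat \<Rightarrow> complex) \<Rightarrow> complex" where
  "peval p x = (\<Sum>a\<in>Poly_Mapping.keys p.
     Poly_Mapping.lookup p a * (\<Prod>i\<in>Poly_Mapping.keys a. x i ^ Poly_Mapping.lookup a i))"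

definition partial_deriv :: "nat \<Rightarrow> cpoly \<Rightarrow> cpoly" where
  "partial_deriv i p = (\<Sum>a\<in>Poly_Mapping.keys p.
     Poly_Mapping.single (a - Poly_Mapping.single i 1)
       (of_nat (Poly_Mapping.lookup a i) * Poly_Mapping.lookup p a))"

definition jacobian :: "nat \<Rightarrow> (nat \<Rightarrow> cpoly) \<Rightarrow> cpoly mat" where
  "jacobian n F = mat n n (\<lambda>(i, j). partial_deriv i (F j))"

definition poly_map :: "nat \<Rightarrow> (nat \<Rightarrow> cpoly) \<Rightarrow> complex vec \<Rightarrow> complex vec" where
  "poly_map n F x = vec n (\<lambda>j. peval (F j) (vec_index x))"

definition poly_automorphism :: "nat \<Rightarrow> (nat \<Rightarrow> cpoly) \<Rightarrow> bool" where
  "poly_automorphism n F \<longleftrightarrow> (\<exists>G. (\<forall>j<n. G j \<in> polys n) \<and>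
     (\<forall>x\<in>carrier_vec n. poly_map n G (poly_map n F x) = x \<and> poly_map n F (poly_map n G x) = x))"

end

theory Submission
  imports Defs "HOL-Computational_Algebra.Fundamental_Theorem_Algebra"
begin

text \<open>Let \<open>P\<close> be a polynomial of degree at most 4 with nilpotent Hessian. Summing, over all labellings
  of the edges of a tree by variables, the products over the vertices of the derivatives of \<open>P\<close>
  along the labels of the incident edges gives a linear map from the tree module to polynomials.
  Grafting a rooted tree corresponds to applying a linear differential operator, so the kernel is a
  submodule; it contains the trees with a vertex of degree at least 5 and, by nilpotency, the
  trees with a long naked chain. The images \<open>q\<^sub>m\<close> of \<open>\<nu>\<^sub>m\<close> therefore vanish for \<open>M < m \<le> 2M\<close>. Cutting
  labelled trees at an edge yields
  \<open>2(m - 1) q\<^sub>m = \<Sum>\<^sub>k \<Sum>\<^sub>i \<partial>\<^sub>i q\<^sub>k \<partial>\<^sub>i q\<^bsub>m-k\<^esub>\<close>, so all later \<open>q\<^sub>m\<close> vanish too, and \<open>Q = \<Sum>\<^sub>m t^(m-1) q\<^sub>m\<close> is a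
  polynomial solution of a Hamilton--Jacobi equation, which makes \<open>X + t \<nabla>Q\<close> inverse to
  \<open>X - t \<nabla>P\<close>. A polynomial map with invertible derivative everywhere is reduced to this case by
  lowering its degree to 3, then adding variables to make the nonlinear part nilpotent, and finally
  doubling the variables to obtain a gradient.\<close>

text \<open>The hypothesis holds for all large r, so r may be chosen after the dimension. Each
  interior vertex of a naked chain contributes a Hessian matrix, r - 2 of them in all, and a
  nilpotent Hessian of size N has vanishing N-th power. The obstacle is to obtain nilpotency: the
  Keller condition for X - H says that 1 - JH(x) is invertible, whereas nilpotency needs 1 - s JH(x)
  invertible for every s. Doubling the variables so that the quadratic and the cubic part sit in
  different components lets a rescaling of x play the role of s. Doubling once more gives a gradient
  whose Hessian is block triangular with blocks JH and its transpose; the potential, linear times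
  cubic, has degree at most 4, which is the 4 of the hypothesis. The inverse comes from
  characteristics: u = grad Q solves the Burgers equation, so it is constant along the lines x - t
  grad P(x). Uniqueness is argued in powers of t, so no convergence is involved, and t = 1 can be
  substituted because Q is a polynomial.\<close>

abbreviation "lookup \<equiv> Poly_Mapping.lookup"
abbreviation "keys \<equiv> Poly_Mapping.keys"
abbreviation "single \<equiv> Poly_Mapping.single"

subsection \<open>Calculus of multivariate polynomials\<close>

definition pvar :: "nat \<Rightarrow> cpoly" where
  "pvar i = single (single i 1) 1"

lemma sum_rotate:
  "(\<Sum>a\<in>A. \<Sum>b\<in>B. \<Sum>c\<in>C. f a b c) = (\<Sum>c\<in>C. \<Sum>a\<in>A. \<Sum>b\<in>B. f a b c)"
proof -
  have "(\<Sum>a\<in>A. \<Sum>b\<in>B. \<Sum>c\<in>C. f a b c) = (\<Sum>a\<in>A. \<Sum>c\<in>C. \<Sum>b\<in>B. f a b c)"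
    by (intro sum.cong refl sum.swap)
  also have "\<dots> = (\<Sum>c\<in>C. \<Sum>a\<in>A. \<Sum>b\<in>B. f a b c)" by (rule sum.swap)
  finally show ?thesis .
qed

lemma poly_mapping_sum_singles:
  fixes p :: "'a \<Rightarrow>\<^sub>0 'b::comm_monoid_add"
  shows "p = (\<Sum>a\<in>keys p. single a (lookup p a))"
  by (rule poly_mapping_eqI) (auto simp: lookup_sum lookup_single when_def in_keys_iff)

lemma poly_mapping_single_induct [case_names single add zero]:
  fixes p :: "'a \<Rightarrow>\<^sub>0 'b::comm_monoid_add"
  assumes single: "\<And>a c. a \<in> keys p \<Longrightarrow> Q (single a c)"
    and add: "\<And>p q. Q p \<Longrightarrow> Q q \<Longrightarrow> Q (p + q)" and zero: "Q 0"
  shows "Q p"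
proof -
  have "Q (\<Sum>a\<in>A. single a (lookup p a))" if "A \<subseteq> keys p" for A
    using finite_subset[OF that finite_keys] that
    by (induction A) (auto intro: assms)
  from this[OF subset_refl] show ?thesis using poly_mapping_sum_singles[of p] by simp
qed

text \<open>The exponent subtraction in \<open>partial_deriv\<close> truncates at 0, but only where
  the factor \<open>lookup a i\<close> vanishes. Read coefficientwise, the shift has no truncation
  left, which makes the rules below comparisons of coefficients.\<close>

lemma lookup_partial_deriv:
  "lookup (partial_deriv i p) b = of_nat (lookup b i + 1) * lookup p (b + single i 1)"
proof -
  have *: "(if a - single i 1 = b then of_nat (lookup a i) * lookup p a else 0) =
      (if a = b + single i 1 then of_nat (lookup b i + 1) * lookup p a else 0)" for a
  proof (cases "lookup a i = 0")
    case True
    then have "a \<noteq> b + single i 1" by (auto simp: lookup_add)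
    with True show ?thesis by simp
  next
    case False
    then have "a - single i 1 + single i 1 = a"
      by (intro poly_mapping_eqI) (auto simp: lookup_add lookup_minus lookup_single when_def)
    then show ?thesis by (auto simp: lookup_add lookup_minus)
  qed
  have "lookup (partial_deriv i p) b =
      (\<Sum>a\<in>keys p. if a - single i 1 = b then of_nat (lookup a i) * lookup p a else 0)"
    by (simp add: partial_deriv_def lookup_sum lookup_single when_def)
  also have "\<dots> = of_nat (lookup b i + 1) * lookup p (b + single i 1)"
    unfolding * by (auto simp: sum.delta in_keys_iff)
  finally show ?thesis .
qed

lemma partial_deriv_zero [simp]: "partial_deriv i 0 = 0"
  by (simp add: partial_deriv_def)

lemma partial_deriv_add: "partial_deriv i (p + q) = partial_deriv i p + partial_deriv i q"
  by (rule poly_mapping_eqI) (simp add: lookup_partial_deriv lookup_add algebra_simps)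

lemma partial_deriv_minus: "partial_deriv i (- p) = - partial_deriv i p"
  by (rule poly_mapping_eqI) (simp add: lookup_partial_deriv algebra_simps)

lemma partial_deriv_diff: "partial_deriv i (p - q) = partial_deriv i p - partial_deriv i q"
  using partial_deriv_add[of i p "- q"] by (simp add: partial_deriv_minus)

lemma partial_deriv_sum: "partial_deriv i (\<Sum>x\<in>A. f x) = (\<Sum>x\<in>A. partial_deriv i (f x))"
  by (induction A rule: infinite_finite_induct) (auto simp: partial_deriv_add)

lemma partial_deriv_commute:
  "partial_deriv i (partial_deriv j p) = partial_deriv j (partial_deriv i p)"
  by (cases "i = j")
    (auto intro!: poly_mapping_eqI simp: lookup_partial_deriv lookup_add lookup_single algebra_simps)

lemma partial_deriv_single:
  "partial_deriv i (single a c) = single (a - single i 1) (of_nat (lookup a i) * c)"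
  by (cases "c = 0") (simp_all add: partial_deriv_def)

lemma single_shift:
  assumes "lookup a i \<noteq> 0"
  shows "a - single i 1 + b = a + b - single i (1::nat)"
  using assms
  by (intro poly_mapping_eqI) (auto simp: lookup_add lookup_minus lookup_single when_def)

lemma partial_deriv_mult_single:
  "partial_deriv i (single a c * single b d) =
     partial_deriv i (single a c) * single b d + single a c * partial_deriv i (single b d)"
proof -
  have 1: "single (a - single i 1 + b) (of_nat (lookup a i) * c * d) =
      single (a + b - single i 1) (of_nat (lookup a i) * c * d)"
    using single_shift[of a i b] by (cases "lookup a i = 0") auto
  have 2: "single (a + (b - single i 1)) (c * (of_nat (lookup b i) * d)) =
      single (a + b - single i 1) (c * (of_nat (lookup b i) * d))"
    using single_shift[of b i a] by (cases "lookup b i = 0") (auto simp: add.commute)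
  show ?thesis
    unfolding partial_deriv_single mult_single 1 2
    by (simp add: lookup_add single_add[symmetric] algebra_simps)
qed

lemma partial_deriv_mult:
  "partial_deriv i (p * q) = partial_deriv i p * q + p * partial_deriv i q"
proof (induction p rule: poly_mapping_single_induct)
  case (single a c)
  show ?case
    by (induction q rule: poly_mapping_single_induct)
      (auto simp: partial_deriv_mult_single partial_deriv_add algebra_simps)
qed (auto simp: partial_deriv_add algebra_simps)

lemma const_poly_0 [simp]: "const_poly 0 = 0" and const_poly_1 [simp]: "const_poly 1 = 1"
  by (simp_all add: const_poly_def)

lemma const_poly_add: "const_poly (a + b) = const_poly a + const_poly b"
  by (simp add: const_poly_def single_add)

lemma const_poly_mult: "const_poly (a * b) = const_poly a * const_poly b"
  by (simp add: const_poly_def mult_single)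

lemma const_poly_uminus: "const_poly (- a) = - const_poly a"
  using const_poly_add[of a "- a"] by (simp add: eq_neg_iff_add_eq_0 add.commute)

lemma const_poly_of_nat: "const_poly (of_nat n) = of_nat n"
  by (induction n) (auto simp: const_poly_add)

lemma partial_deriv_const [simp]: "partial_deriv i (const_poly c) = 0"
  by (simp add: const_poly_def partial_deriv_single)

lemma partial_deriv_1 [simp]: "partial_deriv i 1 = 0"
  using partial_deriv_const[of i 1] by simp

lemma partial_deriv_of_nat [simp]: "partial_deriv i (of_nat n) = 0"
  using partial_deriv_const[of i "of_nat n"] by (simp only: const_poly_of_nat)

lemma partial_deriv_pvar: "partial_deriv i (pvar j) = (if i = j then 1 else 0)"
  by (auto simp: pvar_def partial_deriv_single lookup_single when_def)

lemma partial_deriv_const_mult: "partial_deriv i (const_poly c * p) = const_poly c * partial_deriv i p"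
  by (simp add: partial_deriv_mult)

text \<open>Each summand keeps the full product with one factor replaced, so that it is again a
  product over all vertices when applied to a tree; \<open>partial_deriv_Psi\<close> depends on this
  shape.\<close>

lemma partial_deriv_prod:
  assumes "finite A"
  shows "partial_deriv i (\<Prod>x\<in>A. f x) = (\<Sum>x\<in>A. \<Prod>y\<in>A. if y = x then partial_deriv i (f y) else f y)"
  using assms
proof (induction A)
  case (insert a A)
  let ?g = "\<lambda>x y. if y = x then partial_deriv i (f y) else f y"
  have "(\<Prod>y\<in>insert a A. ?g x y) = f a * (\<Prod>y\<in>A. ?g x y)" if "x \<in> A" for x
    using that insert by auto
  then have "(\<Sum>x\<in>A. \<Prod>y\<in>insert a A. ?g x y) = f a * (\<Sum>x\<in>A. \<Prod>y\<in>A. ?g x y)"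
    by (simp add: sum_distrib_left)
  moreover have "(\<Prod>y\<in>A. ?g a y) = (\<Prod>y\<in>A. f y)"
    using insert by (intro prod.cong) auto
  then have "(\<Prod>y\<in>insert a A. ?g a y) = partial_deriv i (f a) * (\<Prod>y\<in>A. f y)"
    using insert by simp
  ultimately show ?case
    by (simp only: sum.insert[OF insert.hyps] prod.insert[OF insert.hyps, of f] partial_deriv_mult
        insert.IH)
qed simp

text \<open>Evaluation \<open>peval\<close> and substitution of polynomials are both instances of \<open>insertion\<close>.\<close>

definition insertion :: "(complex \<Rightarrow> 'a::comm_ring_1) \<Rightarrow> (nat \<Rightarrow> 'a) \<Rightarrow> cpoly \<Rightarrow> 'a" where
  "insertion h g p = (\<Sum>a\<in>keys p. h (lookup p a) * (\<Prod>i\<in>keys a. g i ^ lookup a i))"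

locale scalar_hom =
  fixes h :: "complex \<Rightarrow> 'a::comm_ring_1"
  assumes h_0: "h 0 = 0" and h_1: "h 1 = 1"
    and h_add: "h (a + b) = h a + h b" and h_mult: "h (a * b) = h a * h b"
begin

lemma insertion_superset:
  assumes "finite A" "keys p \<subseteq> A"
  shows "insertion h g p = (\<Sum>a\<in>A. h (lookup p a) * (\<Prod>i\<in>keys a. g i ^ lookup a i))"
  unfolding insertion_def using assms
  by (intro sum.mono_neutral_left) (auto simp: in_keys_iff h_0)

lemma insertion_add: "insertion h g (p + q) = insertion h g p + insertion h g q"
  using keys_add[of p q]
  by (simp add: insertion_superset[of "keys p \<union> keys q"] lookup_add h_add sum.distrib algebra_simps)

lemma insertion_0 [simp]: "insertion h g 0 = 0"
  by (simp add: insertion_def)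

lemma insertion_single:
  "insertion h g (single a c) = h c * (\<Prod>i\<in>keys a. g i ^ lookup a i)"
  by (cases "c = 0") (auto simp: insertion_def h_0)

lemma insertion_mult: "insertion h g (p * q) = insertion h g p * insertion h g q"
proof (induction p rule: poly_mapping_single_induct)
  case (single a c)
  have mono: "(\<Prod>i\<in>keys (a + b). g i ^ lookup (a + b) i) =
      (\<Prod>i\<in>keys a. g i ^ lookup a i) * (\<Prod>i\<in>keys b. g i ^ lookup b i)" for b :: "nat \<Rightarrow>\<^sub>0 nat"
  proof -
    have sup: "(\<Prod>i\<in>keys d. g i ^ lookup d i) = (\<Prod>i\<in>keys a \<union> keys b. g i ^ lookup d i)"
      if "keys d \<subseteq> keys a \<union> keys b" for d :: "nat \<Rightarrow>\<^sub>0 nat"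
      using that by (intro prod.mono_neutral_left) (auto simp: in_keys_iff)
    show ?thesis
      unfolding sup[OF keys_add] sup[of a, OF Un_upper1] sup[of b, OF Un_upper2]
      by (simp add: lookup_add power_add prod.distrib)
  qed
  show ?case
    by (induction q rule: poly_mapping_single_induct)
      (simp_all add: insertion_single mult_single h_mult mono insertion_add distrib_left mult.assoc
        mult.left_commute)
qed (auto simp: insertion_add algebra_simps)

lemma insertion_const [simp]: "insertion h g (const_poly c) = h c"
  by (simp add: const_poly_def insertion_single)

lemma insertion_1 [simp]: "insertion h g 1 = 1"
  using insertion_const[of g 1] by (simp add: h_1)

lemma insertion_pvar [simp]: "insertion h g (pvar i) = g i"
  by (simp add: pvar_def insertion_single h_1)

lemma insertion_uminus: "insertion h g (- p) = - insertion h g p"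
  using insertion_add[of g p "- p"] by (simp add: eq_neg_iff_add_eq_0 add.commute)

lemma insertion_diff: "insertion h g (p - q) = insertion h g p - insertion h g q"
  using insertion_add[of g p "- q"] by (simp add: insertion_uminus)

lemma insertion_sum: "insertion h g (\<Sum>x\<in>A. f x) = (\<Sum>x\<in>A. insertion h g (f x))"
  by (induction A rule: infinite_finite_induct) (auto simp: insertion_add)

lemma insertion_prod: "insertion h g (\<Prod>x\<in>A. f x) = (\<Prod>x\<in>A. insertion h g (f x))"
  by (induction A rule: infinite_finite_induct) (auto simp: insertion_mult)

lemma insertion_power: "insertion h g (p ^ k) = insertion h g p ^ k"
  by (induction k) (auto simp: insertion_mult)

end

interpretation peval: scalar_hom "\<lambda>c. c"
  by unfold_locales auto

interpretation subst: scalar_hom const_poly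
  by unfold_locales (auto simp: const_poly_add const_poly_mult)

lemma peval_eq_insertion: "peval p x = insertion (\<lambda>c. c) x p"
  by (simp add: peval_def insertion_def)

lemma peval_simps [simp]:
  "peval 0 x = 0" "peval 1 x = 1" "peval (const_poly c) x = c" "peval (pvar i) x = x i"
  "peval (p + q) x = peval p x + peval q x" "peval (p * q) x = peval p x * peval q x"
  "peval (- p) x = - peval p x" "peval (p - q) x = peval p x - peval q x"
  "peval (p ^ k) x = peval p x ^ k"
  "peval (\<Sum>x\<in>A. f x) z = (\<Sum>x\<in>A. peval (f x) z)"
  "peval (\<Prod>x\<in>A. f x) z = (\<Prod>x\<in>A. peval (f x) z)"
  by (simp_all add: peval_eq_insertion peval.insertion_add peval.insertion_mult
      peval.insertion_uminus peval.insertion_diff peval.insertion_power peval.insertion_sum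
      peval.insertion_prod)

abbreviation psubst :: "(nat \<Rightarrow> cpoly) \<Rightarrow> cpoly \<Rightarrow> cpoly" where
  "psubst \<equiv> insertion const_poly"

lemmas psubst_simps = subst.insertion_add subst.insertion_mult subst.insertion_uminus
  subst.insertion_diff subst.insertion_power subst.insertion_sum subst.insertion_prod

section \<open>Polynomials in the first n variables\<close>

lemma polys_0 [simp]: "0 \<in> polys n"
  and polys_const [simp]: "const_poly c \<in> polys n"
  and polys_pvar: "i < n \<Longrightarrow> pvar i \<in> polys n"
  by (auto simp: polys_def const_poly_def pvar_def)

lemma polys_1 [simp]: "1 \<in> polys n"
  using polys_const[of 1] by simp

lemma polys_add [intro]: "p \<in> polys n \<Longrightarrow> q \<in> polys n \<Longrightarrow> p + q \<in> polys n"
  using keys_add[of p q] by (auto simp: polys_def)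

lemma polys_mult [intro]: "p \<in> polys n \<Longrightarrow> q \<in> polys n \<Longrightarrow> p * q \<in> polys n"
proof -
  assume p: "p \<in> polys n" and q: "q \<in> polys n"
  have "keys c \<subseteq> {..<n}" if c: "c \<in> keys (p * q)" for c
  proof -
    obtain a b where "c = a + b" "a \<in> keys p" "b \<in> keys q"
      using keys_mult[of p q] c by blast
    then show ?thesis using p q keys_add[of a b] by (fastforce simp: polys_def)
  qed
  then show ?thesis by (auto simp: polys_def)
qed

lemma polys_uminus [intro]: "p \<in> polys n \<Longrightarrow> - p \<in> polys n"
  by (auto simp: polys_def)

lemma polys_diff [intro]: "p \<in> polys n \<Longrightarrow> q \<in> polys n \<Longrightarrow> p - q \<in> polys n"
  using polys_add[of p n "- q"] polys_uminus[of q n] by simp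

lemma polys_sum: "(\<And>x. x \<in> A \<Longrightarrow> f x \<in> polys n) \<Longrightarrow> (\<Sum>x\<in>A. f x) \<in> polys n"
  by (induction A rule: infinite_finite_induct) auto

lemma polys_prod: "(\<And>x. x \<in> A \<Longrightarrow> f x \<in> polys n) \<Longrightarrow> (\<Prod>x\<in>A. f x) \<in> polys n"
  by (induction A rule: infinite_finite_induct) auto

lemma polys_power: "p \<in> polys n \<Longrightarrow> p ^ k \<in> polys n"
  by (induction k) auto

lemma polys_mono: "p \<in> polys m \<Longrightarrow> m \<le> n \<Longrightarrow> p \<in> polys n"
  by (force simp: polys_def)

lemma polys_exists: "\<exists>n. p \<in> polys n"
proof -
  have "finite (\<Union>a\<in>keys p. keys a)" by auto
  then obtain n where "\<forall>i\<in>(\<Union>a\<in>keys p. keys a). i < n"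
    using finite_nat_set_iff_bounded by blast
  then show ?thesis by (auto simp: polys_def)
qed

text \<open>The polynomials in n variables are the subring generated by constants and variables.
  With this rule, facts about evaluation, substitution and the chain rule need no computation with
  exponent vectors.\<close>

lemma polys_induct [consumes 1, case_names const var add mult]:
  assumes p: "p \<in> polys n" and const: "\<And>c. Q (const_poly c)" and var: "\<And>i. i < n \<Longrightarrow> Q (pvar i)"
    and add: "\<And>p q. p \<in> polys n \<Longrightarrow> q \<in> polys n \<Longrightarrow> Q p \<Longrightarrow> Q q \<Longrightarrow> Q (p + q)"
    and mult: "\<And>p q. p \<in> polys n \<Longrightarrow> q \<in> polys n \<Longrightarrow> Q p \<Longrightarrow> Q q \<Longrightarrow> Q (p * q)"
  shows "Q p"
proof -
  let ?Q = "\<lambda>p. p \<in> polys n \<and> Q p"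
  have Q0: "?Q 0" and Q1: "?Q 1" using const[of 0] const[of 1] by auto
  have pow: "?Q (pvar i ^ k)" if "i < n" for i k
    using that by (induction k) (auto intro: mult Q1[THEN conjunct2] var polys_pvar)
  have mono: "?Q (\<Prod>i\<in>A. pvar i ^ k i)" if "finite A" "A \<subseteq> {..<n}" for A and k :: "nat \<Rightarrow> nat"
    using that by (induction A) (use Q1 in \<open>auto intro!: mult pow[THEN conjunct2] pow[THEN conjunct1]\<close>)
  have pvar_power: "pvar i ^ k = single (single i k) 1" for i k
    by (induction k) (auto simp: pvar_def mult_single single_add[symmetric] add.commute)
  have single_eq: "single a c = const_poly c * (\<Prod>i\<in>keys a. pvar i ^ lookup a i)" for a c
  proof -
    have "(\<Prod>i\<in>A. single (single i (lookup a i)) (1::complex)) = single (\<Sum>i\<in>A. single i (lookup a i)) 1"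
      if "finite A" for A
      using that by induction (auto simp: mult_single)
    then show ?thesis
      using poly_mapping_sum_singles[of a] by (simp add: pvar_power const_poly_def mult_single)
  qed
  have "?Q p"
  proof (induction p rule: poly_mapping_single_induct)
    case (single a c)
    then have "keys a \<subseteq> {..<n}" using p by (auto simp: polys_def)
    then show ?case using mono[of "keys a" "lookup a"] const single_eq
      by (auto intro: mult)
  qed (use Q0 add in auto)
  then show ?thesis by simp
qed

lemma cpoly_induct [case_names const var add mult]:
  assumes "\<And>c. Q (const_poly c)" "\<And>i. Q (pvar i)"
    "\<And>p q. Q p \<Longrightarrow> Q q \<Longrightarrow> Q (p + q)" "\<And>p q. Q p \<Longrightarrow> Q q \<Longrightarrow> Q (p * q)"
  shows "Q p"
proof -
  obtain n where "p \<in> polys n" using polys_exists by blast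
  then show ?thesis by (induction rule: polys_induct) (auto intro: assms)
qed

lemma polys_partial_deriv: "p \<in> polys n \<Longrightarrow> partial_deriv i p \<in> polys n"
  by (induction rule: polys_induct) (auto simp: partial_deriv_pvar partial_deriv_add partial_deriv_mult)

lemma partial_deriv_outside: "p \<in> polys n \<Longrightarrow> n \<le> i \<Longrightarrow> partial_deriv i p = 0"
  by (induction rule: polys_induct) (auto simp: partial_deriv_pvar partial_deriv_add partial_deriv_mult)

lemma peval_cong: "p \<in> polys n \<Longrightarrow> (\<And>i. i < n \<Longrightarrow> x i = y i) \<Longrightarrow> peval p x = peval p y"
  by (induction rule: polys_induct) auto

lemma polys_psubst: "p \<in> polys n \<Longrightarrow> (\<And>i. i < n \<Longrightarrow> g i \<in> polys m) \<Longrightarrow> psubst g p \<in> polys m"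
  by (induction rule: polys_induct) (auto simp: psubst_simps)

lemma peval_psubst: "peval (psubst g p) x = peval p (\<lambda>i. peval (g i) x)"
  by (induction p rule: cpoly_induct) (auto simp: psubst_simps)

lemma partial_deriv_psubst:
  "p \<in> polys n \<Longrightarrow> partial_deriv i (psubst g p) =
     (\<Sum>k<n. psubst g (partial_deriv k p) * partial_deriv i (g k))"
proof (induction rule: polys_induct)
  case (var j)
  have *: "psubst g (partial_deriv k (pvar j)) * partial_deriv i (g k) =
      (if k = j then partial_deriv i (g k) else 0)" for k
    by (simp add: partial_deriv_pvar)
  show ?case using var by (simp add: *)
next
  case (mult p q)
  then show ?case
    by (simp add: psubst_simps partial_deriv_mult sum.distrib sum_distrib_left sum_distrib_right
        algebra_simps)
qed (auto simp: psubst_simps partial_deriv_add sum.distrib algebra_simps)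

text \<open>Identifies formal with analytic derivatives, so that a polynomial vanishing at all
  points has partial derivatives vanishing at all points.\<close>

lemma has_field_derivative_peval:
  "((\<lambda>h. peval p (x(i := h))) has_field_derivative peval (partial_deriv i p) (x(i := h))) (at h)"
proof (induction p rule: cpoly_induct)
  case (var j)
  then show ?case by (cases "i = j") (auto simp: partial_deriv_pvar)
next
  case (mult p q)
  show ?case using DERIV_mult[OF mult.IH] by (simp add: partial_deriv_mult algebra_simps)
next
  case (add p q)
  show ?case using DERIV_add[OF add.IH] by (simp add: partial_deriv_add)
qed auto

text \<open>\<open>degree_le d p\<close> expresses that \<open>p\<close> has total degree at most \<open>d\<close>.\<close>

fun degree_le :: "nat \<Rightarrow> cpoly \<Rightarrow> bool" where
  "degree_le 0 p \<longleftrightarrow> (\<forall>i. partial_deriv i p = 0)"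
| "degree_le (Suc d) p \<longleftrightarrow> (\<forall>i. degree_le d (partial_deriv i p))"

lemma degree_le_0 [simp]: "degree_le d 0"
  by (induction d) auto

lemma degree_le_const [simp]: "degree_le d (const_poly c)"
  by (cases d) auto

lemma degree_le_Suc: "degree_le d p \<Longrightarrow> degree_le (Suc d) p"
  by (induction d arbitrary: p) auto

lemma degree_le_mono: "degree_le d p \<Longrightarrow> d \<le> e \<Longrightarrow> degree_le e p"
  by (rule dec_induct[of d e "\<lambda>e. degree_le e p"]) (use degree_le_Suc in blast)+

lemma degree_le_add: "degree_le d p \<Longrightarrow> degree_le d q \<Longrightarrow> degree_le d (p + q)"
  by (induction d arbitrary: p q) (auto simp: partial_deriv_add)

lemma degree_le_sum: "(\<And>x. x \<in> A \<Longrightarrow> degree_le d (f x)) \<Longrightarrow> degree_le d (\<Sum>x\<in>A. f x)"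
  by (induction A rule: infinite_finite_induct) (auto simp: degree_le_add)

text \<open>Induction on the sum of the bounds: by Leibniz a derivative lowers the bound of one
  factor, and a factor with bound 0 has derivative zero.\<close>

lemma degree_le_mult: "degree_le d p \<Longrightarrow> degree_le e q \<Longrightarrow> degree_le (d + e) (p * q)"
proof (induction "d + e" arbitrary: d e p q)
  case 0
  then show ?case by (auto simp: partial_deriv_mult)
next
  case (Suc k)
  have "degree_le k (partial_deriv i p * q)" for i
  proof (cases d)
    case 0
    with Suc.prems show ?thesis by simp
  next
    case (Suc d')
    with Suc.hyps(1)[of d' e "partial_deriv i p" q] Suc.hyps(2) Suc.prems show ?thesis by simp
  qed
  moreover have "degree_le k (p * partial_deriv i q)" for i
  proof (cases e)
    case 0
    with Suc.prems show ?thesis by simp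
  next
    case (Suc e')
    with Suc.hyps(1)[of d e' p "partial_deriv i q"] Suc.hyps(2) Suc.prems show ?thesis by simp
  qed
  ultimately show ?case
    unfolding Suc.hyps(2)[symmetric] by (auto simp: partial_deriv_mult intro: degree_le_add)
qed

lemma degree_le_const_mult: "degree_le d p \<Longrightarrow> degree_le d (const_poly c * p)"
  using degree_le_mult[of 0 "const_poly c" d p] by simp

lemma degree_le_pvar: "degree_le 1 (pvar i)"
  by (auto simp: partial_deriv_pvar)

lemma degree_le_exists: "\<exists>d. degree_le d p"
proof (induction p rule: cpoly_induct)
  case (add p q)
  then obtain d e where "degree_le d p" "degree_le e q" by auto
  then have "degree_le (max d e) (p + q)"
    by (meson degree_le_add degree_le_mono max.cobounded1 max.cobounded2)
  then show ?case by blast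
qed (use degree_le_const degree_le_pvar degree_le_mult in blast)+

lemma partial_derivs_zero_imp_const:
  assumes "\<And>i. partial_deriv i p = 0"
  shows "p = const_poly (lookup p 0)"
proof (rule poly_mapping_eqI)
  fix a
  show "lookup p a = lookup (const_poly (lookup p 0)) a"
  proof (cases "a = 0")
    case False
    then obtain i where "i \<in> keys a" using keys_eq_empty by blast
    then have i: "lookup a i \<noteq> 0" by (simp add: in_keys_iff)
    then have a: "a - single i 1 + single i 1 = a"
      by (intro poly_mapping_eqI) (auto simp: lookup_add lookup_minus lookup_single when_def)
    have "lookup (partial_deriv i p) (a - single i 1) = 0" by (simp add: assms)
    then have "lookup p a = 0"
      unfolding lookup_partial_deriv a using of_nat_neq_0 by (metis Suc_eq_plus1 mult_eq_0_iff)
    with False show ?thesis by (simp add: const_poly_def lookup_single)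
  qed (simp add: const_poly_def)
qed

text \<open>Induction on a degree bound: the partial derivatives vanish as functions, hence as
  polynomials, which leaves a constant whose value is 0.\<close>

lemma peval_zero_imp_zero:
  assumes "\<And>x. peval p x = 0"
  shows "p = 0"
proof -
  have *: "p = 0" if "degree_le d p" "\<And>x. peval p x = 0" for d p
    using that
  proof (induction d arbitrary: p)
    case 0
    then have "p = const_poly (lookup p 0)" by (intro partial_derivs_zero_imp_const) auto
    with 0(2) show ?case by (metis const_poly_0 peval_simps(3))
  next
    case (Suc d)
    have "peval (partial_deriv i p) x = 0" for i x
    proof -
      have "((\<lambda>h. peval p (x(i := h))) has_field_derivative peval (partial_deriv i p) x) (at (x i))"
        using has_field_derivative_peval[of p x i "x i"] by simp
      moreover have "((\<lambda>h. peval p (x(i := h))) has_field_derivative 0) (at (x i))"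
        by (simp add: Suc.prems(2))
      ultimately show ?thesis by (rule DERIV_unique)
    qed
    then have "partial_deriv i p = 0" for i
      by (intro Suc.IH) (use Suc.prems in auto)
    then have "p = const_poly (lookup p 0)" by (rule partial_derivs_zero_imp_const)
    with Suc.prems(2) show ?case by (metis const_poly_0 peval_simps(3))
  qed
  show ?thesis using degree_le_exists[of p] *[of _ p] assms by blast
qed

subsection \<open>Trees\<close>

abbreviation adj :: "nat set set \<Rightarrow> nat \<Rightarrow> nat \<Rightarrow> bool" where
  "adj E u v \<equiv> {u, v} \<in> E"

abbreviation reach :: "nat set set \<Rightarrow> nat \<Rightarrow> nat \<Rightarrow> bool" where
  "reach E \<equiv> (adj E)\<^sup>*\<^sup>*"

section \<open>Walks, reachability and acyclicity\<close>

lemma rtranclp_map: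
  assumes "R\<^sup>*\<^sup>* x y" "\<And>x y. R x y \<Longrightarrow> S\<^sup>*\<^sup>* (h x) (h y)"
  shows "S\<^sup>*\<^sup>* (h x) (h y)"
  using assms(1) by induction (auto dest: assms(2))

lemma rtranclp_adj_mono: "reach E x y \<Longrightarrow> E \<subseteq> E' \<Longrightarrow> reach E' x y"
  by (erule rtranclp_map[where h = "\<lambda>x. x"]) blast

lemma rtranclp_adj_sym: "reach E x y \<Longrightarrow> reach E y x"
proof (induction rule: rtranclp_induct)
  case (step y z)
  then show ?case
    by (intro converse_rtranclp_into_rtranclp[of "adj E" z y]) (auto simp: insert_commute)
qed simp

lemma rtranclp_adj_closed:
  assumes "reach E x y" "x \<in> A" "\<And>u v. {u, v} \<in> E \<Longrightarrow> u \<in> A \<Longrightarrow> v \<in> A"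
  shows "y \<in> A"
  using assms(1,2) by induction (auto intro: assms(3))

lemma successively_imp_rtranclp: "successively R vs \<Longrightarrow> vs \<noteq> [] \<Longrightarrow> R\<^sup>*\<^sup>* (hd vs) (last vs)"
proof (induction vs rule: induct_list012)
  case (3 x y zs)
  then show ?case by (auto intro: converse_rtranclp_into_rtranclp)
qed auto

lemma rtranclp_imp_distinct_successively:
  assumes "R\<^sup>*\<^sup>* u v"
  shows "\<exists>vs. vs \<noteq> [] \<and> hd vs = u \<and> last vs = v \<and> successively R vs \<and> distinct vs"
  using assms
proof induction
  case base
  show ?case by (rule exI[of _ "[u]"]) simp
next
  case (step y z)
  then obtain vs where vs: "vs \<noteq> []" "hd vs = u" "last vs = y" "successively R vs" "distinct vs"
    by blast
  show ?case
  proof (cases "z \<in> set vs")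
    \<comment> \<open>The path would return to \<open>z\<close>, so it is cut at that occurrence
      instead of being extended.\<close>
    case True
    then obtain as bs where "vs = as @ z # bs" by (auto dest: split_list)
    with vs have "hd (as @ [z]) = u" "successively R (as @ [z])" "distinct (as @ [z])"
      by (auto simp: successively_append_iff hd_append split: if_splits)
    then show ?thesis by (intro exI[of _ "as @ [z]"]) auto
  next
    case False
    with vs step show ?thesis
      by (intro exI[of _ "vs @ [z]"]) (auto simp: successively_append_iff)
  qed
qed

lemma is_graph_finite_edges: "is_graph G \<Longrightarrow> finite (edges G)"
  by (rule finite_subset[of _ "Pow (verts G)"]) (auto simp: is_graph_def)

lemma is_graph_edge:
  assumes "is_graph G" "{u, v} \<in> edges G"
  shows "u \<in> verts G" "v \<in> verts G" "u \<noteq> v"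
  using assms by (auto simp: is_graph_def)

lemma is_graph_edgeE:
  assumes "is_graph G" "e \<in> edges G"
  obtains u v where "e = {u, v}" "u \<noteq> v" "u \<in> verts G" "v \<in> verts G"
proof -
  have "card e = 2" "e \<subseteq> verts G" using assms by (auto simp: is_graph_def)
  then show ?thesis using that by (auto simp: card_2_iff)
qed

lemma reachable_iff:
  assumes "is_graph G"
  shows "reachable G u v \<longleftrightarrow> u \<in> verts G \<and> v \<in> verts G \<and> reach (edges G) u v"
proof
  assume "reachable G u v"
  then obtain vs where "is_walk G vs" "hd vs = u" "last vs = v" by (auto simp: reachable_def)
  then show "u \<in> verts G \<and> v \<in> verts G \<and> reach (edges G) u v"
    using successively_imp_rtranclp[of _ vs] hd_in_set[of vs] last_in_set[of vs]
    by (auto simp: is_walk_def)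
next
  assume *: "u \<in> verts G \<and> v \<in> verts G \<and> reach (edges G) u v"
  then have "reach (edges G) u v" by blast
  then show "reachable G u v"
  proof induction
    case base
    then show ?case using * unfolding reachable_def
      by (intro exI[of _ "[u]"]) (auto simp: is_walk_def)
  next
    case (step y z)
    then obtain vs where "is_walk G vs" "hd vs = u" "last vs = y" by (auto simp: reachable_def)
    then show ?case using is_graph_edge[OF assms step(2)] step(2) unfolding reachable_def
      by (intro exI[of _ "vs @ [z]"]) (auto simp: is_walk_def successively_append_iff)
  qed
qed

text \<open>Acyclicity in the form "every edge is a bridge". It passes to subsets of edges at once
  and speaks only of reachability, so that joining and cutting trees never requires splicing
  cycles.\<close>

definition bridges :: "nat set set \<Rightarrow> bool" where
  "bridges E \<longleftrightarrow> (\<forall>u v. {u, v} \<in> E \<longrightarrow> \<not> reach (E - {{u, v}}) u v)"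

lemma bridges_subset: "bridges E \<Longrightarrow> E' \<subseteq> E \<Longrightarrow> bridges E'"
  unfolding bridges_def
proof (intro allI impI notI)
  fix u v
  assume E: "\<forall>u v. {u, v} \<in> E \<longrightarrow> \<not> reach (E - {{u, v}}) u v" "E' \<subseteq> E" "{u, v} \<in> E'"
    and r: "reach (E' - {{u, v}}) u v"
  have "reach (E - {{u, v}}) u v" by (rule rtranclp_adj_mono[OF r]) (use E in blast)
  with E show False by blast
qed

text \<open>A repetition-free path between the ends of an edge that avoids this edge is closed by it
  to a cycle, and a cycle minus its closing edge is such a path.\<close>

lemma no_cycle_iff_bridges:
  assumes G: "is_graph G"
  shows "(\<nexists>vs. is_cycle G vs) \<longleftrightarrow> bridges (edges G)"
proof (intro iffI notI)
  assume no: "\<nexists>vs. is_cycle G vs"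
  show "bridges (edges G)"
    unfolding bridges_def
  proof (intro allI impI notI)
    fix u v
    assume uv: "{u, v} \<in> edges G" and r: "reach (edges G - {{u, v}}) u v"
    obtain vs where vs: "vs \<noteq> []" "hd vs = u" "last vs = v" "distinct vs"
      "successively (adj (edges G - {{u, v}})) vs"
      using rtranclp_imp_distinct_successively[OF r] by blast
    have "u \<noteq> v" using is_graph_edge[OF G uv] by blast
    have len: "3 \<le> length vs"
    proof -
      have "length vs \<noteq> 0" using vs(1) by simp
      then consider "length vs = 1" | "length vs = 2" | "3 \<le> length vs" by linarith
      then show ?thesis
      proof cases
        case 1
        with vs \<open>u \<noteq> v\<close> show ?thesis by (auto simp: length_Suc_conv)
      next
        case 2
        with vs show ?thesis by (auto simp: length_Suc_conv numeral_2_eq_2)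
      qed
    qed
    have succ: "successively (adj (edges G)) vs"
      using vs(5) by (rule successively_mono) auto
    have "set vs \<subseteq> verts G"
    proof
      fix x assume "x \<in> set vs"
      then obtain i where i: "i < length vs" "x = vs ! i" by (auto simp: in_set_conv_nth)
      show "x \<in> verts G"
      proof (cases "Suc i < length vs")
        case True
        with succ have "{vs ! i, vs ! Suc i} \<in> edges G" by (auto simp: successively_conv_nth)
        then show ?thesis using is_graph_edge[OF G] i by blast
      next
        case False
        with i have "x = v" using vs by (metis Suc_lessI diff_Suc_1 last_conv_nth)
        then show ?thesis using is_graph_edge[OF G uv] by simp
      qed
    qed
    then have "is_cycle G vs" using vs succ len uv by (simp add: is_cycle_def is_walk_def insert_commute)
    with no show False by blast
  qed
next
  assume br: "bridges (edges G)" and "\<exists>vs. is_cycle G vs"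
  then obtain vs where vs: "vs \<noteq> []" "successively (adj (edges G)) vs" "distinct vs" "3 \<le> length vs"
      "{last vs, hd vs} \<in> edges G"
    by (auto simp: is_cycle_def is_walk_def)
  \<comment> \<open>Distinctness and length at least 3 keep the closing edge different from every
    edge along the list.\<close>
  have "successively (adj (edges G - {{hd vs, last vs}})) vs"
    unfolding successively_conv_nth
  proof (intro allI impI)
    fix i assume i: "Suc i < length vs"
    have "{vs ! i, vs ! Suc i} \<noteq> {vs ! 0, vs ! (length vs - 1)}"
    proof
      assume "{vs ! i, vs ! Suc i} = {vs ! 0, vs ! (length vs - 1)}"
      then have "vs ! i = vs ! 0 \<and> vs ! Suc i = vs ! (length vs - 1) \<or>
          vs ! i = vs ! (length vs - 1) \<and> vs ! Suc i = vs ! 0"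
        by (auto simp: doubleton_eq_iff)
      then have "i = 0 \<and> Suc i = length vs - 1 \<or> i = length vs - 1 \<and> Suc i = 0"
        using vs(3) i by (subst (asm) (1 2 3 4) nth_eq_iff_index_eq) auto
      with vs(4) show False by auto
    qed
    then show "{vs ! i, vs ! Suc i} \<in> edges G - {{hd vs, last vs}}"
      using vs(1,2) i by (auto simp: successively_conv_nth hd_conv_nth last_conv_nth)
  qed
  note r = successively_imp_rtranclp[OF this vs(1)]
  have "{hd vs, last vs} \<in> edges G" using vs(5) by (simp add: insert_commute)
  with r br show False unfolding bridges_def by blast
qed

lemma is_tree_iff:
  "is_tree G \<longleftrightarrow> is_graph G \<and> verts G \<noteq> {} \<and>
     (\<forall>u\<in>verts G. \<forall>v\<in>verts G. reach (edges G) u v) \<and> bridges (edges G)"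
  unfolding is_tree_def using reachable_iff no_cycle_iff_bridges by blast

lemma is_treeI:
  assumes "is_graph G" "r \<in> verts G" "\<And>v. v \<in> verts G \<Longrightarrow> reach (edges G) r v" "bridges (edges G)"
  shows "is_tree G"
  unfolding is_tree_iff using assms by (auto intro: rtranclp_trans[OF rtranclp_adj_sym])

lemma is_iso_adj:
  assumes G: "is_graph G" and f: "is_iso f G H" and x: "x \<in> verts G" and y: "y \<in> verts G"
  shows "{f x, f y} \<in> edges H \<longleftrightarrow> {x, y} \<in> edges G"
proof
  assume "{f x, f y} \<in> edges H"
  then have "f ` {x, y} \<in> (\<lambda>e. f ` e) ` edges G" using f by (simp add: is_iso_def)
  then obtain e where e: "e \<in> edges G" "f ` {x, y} = f ` e" by blast
  then have "e \<subseteq> verts G" using G by (auto simp: is_graph_def)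
  then show "{x, y} \<in> edges G"
    using e x y f inj_on_image_eq_iff[of f "verts G" "{x, y}" e]
    by (auto simp: is_iso_def bij_betw_def)
next
  assume "{x, y} \<in> edges G"
  then have "f ` {x, y} \<in> (\<lambda>e. f ` e) ` edges G" by (rule imageI)
  then show "{f x, f y} \<in> edges H" using f by (simp add: is_iso_def)
qed

lemma is_graph_iso:
  assumes G: "is_graph G" and f: "is_iso f G H"
  shows "is_graph H"
proof -
  have b: "bij_betw f (verts G) (verts H)" and E: "(\<lambda>e. f ` e) ` edges G = edges H"
    using f by (auto simp: is_iso_def)
  have "e \<subseteq> verts H \<and> card e = 2" if e: "e \<in> edges H" for e
  proof -
    obtain d where d: "d \<in> edges G" "e = f ` d" using e E by blast
    then have d2: "d \<subseteq> verts G" "card d = 2" using G by (auto simp: is_graph_def)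
    then have "inj_on f d" using b by (auto simp: bij_betw_def intro: inj_on_subset)
    then show ?thesis using b d d2 by (auto simp: card_image bij_betw_def)
  qed
  moreover have "finite (verts H)" using G bij_betw_finite[OF b] by (auto simp: is_graph_def)
  ultimately show ?thesis by (simp add: is_graph_def)
qed

lemma is_tree_iso:
  assumes G: "is_tree G" and f: "is_iso f G H"
  shows "is_tree H"
proof -
  let ?g = "the_inv_into (verts G) f"
  have gG: "is_graph G" using G by (simp add: is_tree_def)
  have gH: "is_graph H" using is_graph_iso[OF gG f] .
  have b: "bij_betw f (verts G) (verts H)" using f by (simp add: is_iso_def)
  have gf: "?g (f x) = x" if "x \<in> verts G" for x
    using the_inv_into_f_f[of f] b that by (auto simp: bij_betw_def)
  have V: "verts H = f ` verts G" using b by (auto simp: bij_betw_def)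
  have E: "edges H = (\<lambda>e. f ` e) ` edges G" using f by (simp add: is_iso_def)
  have "reach (edges H) (f x) (f y)" if "x \<in> verts G" "y \<in> verts G" for x y
  proof (rule rtranclp_map[of "adj (edges G)" x y "adj (edges H)" f])
    show "reach (edges G) x y" using G that by (simp add: is_tree_iff)
  next
    fix u v assume "{u, v} \<in> edges G"
    then have "f ` {u, v} \<in> edges H" unfolding E by (rule imageI)
    then show "reach (edges H) (f u) (f v)" by auto
  qed
  moreover have "bridges (edges H)"
    unfolding bridges_def
  proof (intro allI impI notI)
    fix u v assume uv: "{u, v} \<in> edges H" and *: "reach (edges H - {{u, v}}) u v"
    from is_graph_edge[OF gH uv] V obtain x y where xy: "u = f x" "v = f y" "x \<in> verts G" "y \<in> verts G"
      by auto
    then have xyE: "{x, y} \<in> edges G" using uv is_iso_adj[OF gG f] by simp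
    have "reach (edges G - {{x, y}}) (?g u) (?g v)"
    proof (rule rtranclp_map[OF *])
      fix p q assume pq: "{p, q} \<in> edges H - {{u, v}}"
      then have "{p, q} \<in> edges H" by simp
      from is_graph_edge[OF gH this] V obtain p' q' where
        p': "p = f p'" "q = f q'" "p' \<in> verts G" "q' \<in> verts G" by auto
      have "{p', q'} \<in> edges G - {{x, y}}"
        using pq p' is_iso_adj[OF gG f] xy by (auto simp: doubleton_eq_iff)
      then show "reach (edges G - {{x, y}}) (?g p) (?g q)" using p' gf by auto
    qed
    then show False using xy gf G xyE by (auto simp: is_tree_iff bridges_def)
  qed
  ultimately show ?thesis
    using gH G V by (auto simp: is_tree_iff)
qed

section \<open>Joining trees by an edge and cutting them at an edge\<close>

definition join_graph :: "graph \<Rightarrow> graph \<Rightarrow> nat \<Rightarrow> nat \<Rightarrow> graph" where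
  "join_graph G H a b = (verts G \<union> verts H, insert {a, b} (edges G \<union> edges H))"

lemma is_graph_join:
  assumes "is_graph G" "is_graph H" "verts G \<inter> verts H = {}" "a \<in> verts G" "b \<in> verts H"
  shows "is_graph (join_graph G H a b)"
proof -
  have "a \<noteq> b" using assms by auto
  then show ?thesis using assms by (auto simp: is_graph_def join_graph_def)
qed

lemma join_new_edge:
  assumes "is_graph G" "is_graph H" "verts G \<inter> verts H = {}" "a \<in> verts G" "b \<in> verts H"
  shows "{a, b} \<notin> edges G" "{a, b} \<notin> edges H"
  using assms is_graph_edge by blast+

lemma join_reach:
  assumes "is_graph G" "is_graph H" "verts G \<inter> verts H = {}" "a \<in> verts G"
    and "reach (edges G \<union> edges H) a x"
  shows "x \<in> verts G"
  using assms(5,4)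
  by (rule rtranclp_adj_closed) (use assms is_graph_edge in blast)

lemma join_bridges_aux:
  assumes G: "is_graph G" and H: "is_graph H" and d: "verts G \<inter> verts H = {}"
    and ab: "a \<in> verts G" "b \<in> verts H" and uv: "{u, v} \<in> edges G"
    and r: "reach (insert {a, b} (edges G \<union> edges H) - {{u, v}}) u v"
  shows "reach (edges G - {{u, v}}) u v"
proof -
  \<comment> \<open>Contract the second graph to the vertex \<open>a\<close>.\<close>
  define h where "h = (\<lambda>x. if x \<in> verts H then a else x)"
  have "reach (edges G - {{u, v}}) (h u) (h v)"
    using r
  proof (rule rtranclp_map)
    fix x y assume "{x, y} \<in> insert {a, b} (edges G \<union> edges H) - {{u, v}}"
    then consider "{x, y} = {a, b}" | "{x, y} \<in> edges G - {{u, v}}" | "{x, y} \<in> edges H"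
      by blast
    then show "reach (edges G - {{u, v}}) (h x) (h y)"
    proof cases
      case 1
      then have "h x = a" "h y = a" using ab d by (auto simp: h_def doubleton_eq_iff)
      then show ?thesis by simp
    next
      case 2
      then have "x \<in> verts G" "y \<in> verts G" using is_graph_edge[OF G] by blast+
      then have "h x = x" "h y = y" using d by (auto simp: h_def)
      then show ?thesis using 2 by auto
    next
      case 3
      then have "h x = a" "h y = a" using is_graph_edge[OF H] by (auto simp: h_def)
      then show ?thesis by simp
    qed
  qed
  moreover have "h u = u" "h v = v" using is_graph_edge[OF G uv] d by (auto simp: h_def)
  ultimately show ?thesis by simp
qed

lemma join_commute: "join_graph G H a b = join_graph H G b a"
  by (auto simp: join_graph_def)

lemma is_tree_join:
  assumes tG: "is_tree G" and tH: "is_tree H" and d: "verts G \<inter> verts H = {}"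
    and ab: "a \<in> verts G" "b \<in> verts H"
  shows "is_tree (join_graph G H a b)"
proof (rule is_treeI[of _ a])
  have G: "is_graph G" and H: "is_graph H" using tG tH by (auto simp: is_tree_def)
  let ?E = "insert {a, b} (edges G \<union> edges H)"
  show "is_graph (join_graph G H a b)" by (rule is_graph_join[OF G H d ab])
  show "a \<in> verts (join_graph G H a b)" using ab by (simp add: join_graph_def)
  fix v assume "v \<in> verts (join_graph G H a b)"
  then consider "v \<in> verts G" | "v \<in> verts H" by (auto simp: join_graph_def)
  then have "reach ?E a v"
  proof cases
    case 1
    then have "reach (edges G) a v" using tG ab by (simp add: is_tree_iff)
    then show ?thesis by (rule rtranclp_adj_mono) auto
  next
    case 2
    then have "reach (edges H) b v" using tH ab by (simp add: is_tree_iff)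
    then have "reach ?E b v" by (rule rtranclp_adj_mono) auto
    then show ?thesis by (rule converse_rtranclp_into_rtranclp[rotated]) simp
  qed
  then show "reach (edges (join_graph G H a b)) a v" by (simp add: join_graph_def)
next
  have G: "is_graph G" and H: "is_graph H" using tG tH by (auto simp: is_tree_def)
  have d': "verts H \<inter> verts G = {}" using d by blast
  show "bridges (edges (join_graph G H a b))"
    unfolding bridges_def
  proof (intro allI impI notI)
    fix u v
    assume uv: "{u, v} \<in> edges (join_graph G H a b)"
      and r: "reach (edges (join_graph G H a b) - {{u, v}}) u v"
    from uv consider "{u, v} = {a, b}" | "{u, v} \<in> edges G" | "{u, v} \<in> edges H"
      by (auto simp: join_graph_def)
    then show False
    proof cases
      case 1
      then have "edges (join_graph G H a b) - {{u, v}} \<subseteq> edges G \<union> edges H"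
        by (auto simp: join_graph_def)
      with r have "reach (edges G \<union> edges H) u v" by (rule rtranclp_adj_mono)
      moreover have "u = a \<and> v = b \<or> u = b \<and> v = a" using 1 by (auto simp: doubleton_eq_iff)
      ultimately have "reach (edges G \<union> edges H) a b"
        using rtranclp_adj_sym by metis
      from join_reach[OF G H d ab(1) this] ab d show False by blast
    next
      case 2
      from join_bridges_aux[OF G H d ab 2] r have "reach (edges G - {{u, v}}) u v"
        by (simp add: join_graph_def)
      with 2 tG show False by (auto simp: is_tree_iff bridges_def)
    next
      case 3
      from join_bridges_aux[OF H G d' ab(2,1) 3] r have "reach (edges H - {{u, v}}) u v"
        by (simp add: join_graph_def insert_commute Un_commute)
      with 3 tH show False by (auto simp: is_tree_iff bridges_def)
    qed
  qed
qed

text \<open>The component of \<open>a\<close> once the edge between \<open>a\<close> and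
  \<open>b\<close> is cut; the pair \<open>side G a b\<close>, \<open>side G b a\<close> inverts
  \<open>join_graph\<close>.\<close>

definition side :: "graph \<Rightarrow> nat \<Rightarrow> nat \<Rightarrow> graph" where
  "side G a b = (let W = {x. reach (edges G - {{a, b}}) a x} in (W, {e \<in> edges G. e \<subseteq> W}))"

lemma is_graph_subgraph:
  assumes "is_graph G" "verts H \<subseteq> verts G" "edges H \<subseteq> edges G" "\<And>e. e \<in> edges H \<Longrightarrow> e \<subseteq> verts H"
  shows "is_graph H"
  using assms by (auto simp: is_graph_def intro: finite_subset)

lemma is_tree_side:
  assumes tG: "is_tree G" and ab: "{a, b} \<in> edges G"
  shows "is_tree (side G a b)" "a \<in> verts (side G a b)"
    "verts (side G a b) \<subseteq> verts G" "b \<notin> verts (side G a b)"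
proof -
  have G: "is_graph G" using tG by (simp add: is_tree_def)
  let ?W = "{x. reach (edges G - {{a, b}}) a x}"
  have V: "verts (side G a b) = ?W" and E: "edges (side G a b) = {e \<in> edges G. e \<subseteq> ?W}"
    by (auto simp: side_def Let_def)
  show a: "a \<in> verts (side G a b)" by (simp add: V)
  show sub: "verts (side G a b) \<subseteq> verts G"
  proof
    fix x assume "x \<in> verts (side G a b)"
    then have "reach (edges G - {{a, b}}) a x" by (simp add: V)
    then show "x \<in> verts G"
      by (rule rtranclp_adj_closed) (use is_graph_edge[OF G] ab in blast)+
  qed
  show b: "b \<notin> verts (side G a b)" using tG ab by (auto simp: V is_tree_iff bridges_def)
  show "is_tree (side G a b)"
  proof (rule is_treeI[OF _ a])
    show "is_graph (side G a b)" by (rule is_graph_subgraph[OF G sub]) (auto simp: V E)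
    show "bridges (edges (side G a b))"
      by (rule bridges_subset[of "edges G"]) (use tG E in \<open>auto simp: is_tree_iff\<close>)
    fix v assume "v \<in> verts (side G a b)"
    then have "reach (edges G - {{a, b}}) a v" by (simp add: V)
    then show "reach (edges (side G a b)) a v"
    proof induction
      case (step y z)
      then have "{y, z} \<subseteq> ?W" by (auto intro: rtranclp.rtrancl_into_rtrancl)
      then have "{y, z} \<in> edges (side G a b)" using step unfolding E by blast
      then show ?case using step.IH by (rule rtranclp.rtrancl_into_rtrancl[rotated])
    qed simp
  qed
qed

text \<open>The sides are disjoint because the edge is a bridge, and they exhaust the tree because
  their union is closed under adjacency.\<close>

lemma tree_split:
  assumes tG: "is_tree G" and ab: "{a, b} \<in> edges G"
  shows "G = join_graph (side G a b) (side G b a) a b"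
    and "verts (side G a b) \<inter> verts (side G b a) = {}"
    and "verts (side G b a) = verts G - verts (side G a b)"
proof -
  have G: "is_graph G" using tG by (simp add: is_tree_def)
  have ba: "{b, a} \<in> edges G" using ab by (simp add: insert_commute)
  let ?E = "edges G - {{a, b}}"
  let ?A = "{x. reach ?E a x}" and ?B = "{x. reach ?E b x}"
  have A: "side G a b = (?A, {e \<in> edges G. e \<subseteq> ?A})" and B: "side G b a = (?B, {e \<in> edges G. e \<subseteq> ?B})"
    by (auto simp: side_def Let_def insert_commute)
  show disj: "verts (side G a b) \<inter> verts (side G b a) = {}"
  proof (rule ccontr)
    assume "verts (side G a b) \<inter> verts (side G b a) \<noteq> {}"
    then obtain x where "reach ?E a x" "reach ?E b x" by (auto simp: A B)
    then have "reach ?E a b" using rtranclp_adj_sym rtranclp_trans by fast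
    then show False using tG ab by (auto simp: is_tree_iff bridges_def)
  qed
  have stepA: "v \<in> ?A" if "u \<in> ?A" "{u, v} \<in> edges G" "{u, v} \<noteq> {a, b}" for u v
    using that by (auto intro: rtranclp.rtrancl_into_rtrancl)
  have stepB: "v \<in> ?B" if "u \<in> ?B" "{u, v} \<in> edges G" "{u, v} \<noteq> {a, b}" for u v
    using that by (auto intro: rtranclp.rtrancl_into_rtrancl)
  have cover: "x \<in> ?A \<union> ?B" if "x \<in> verts G" for x
  proof (rule rtranclp_adj_closed[of "edges G" a x])
    show "reach (edges G) a x" using tG that is_graph_edge[OF G ab] by (simp add: is_tree_iff)
    show "a \<in> ?A \<union> ?B" by simp
    fix u v assume uv: "{u, v} \<in> edges G" "u \<in> ?A \<union> ?B"
    show "v \<in> ?A \<union> ?B"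
    proof (cases "{u, v} = {a, b}")
      case True
      then have "v = a \<or> v = b" by (auto simp: doubleton_eq_iff)
      then show ?thesis by auto
    next
      case False
      then show ?thesis using uv stepA stepB by blast
    qed
  qed
  have V: "verts G = ?A \<union> ?B"
    using cover is_tree_side(3)[OF tG ab] is_tree_side(3)[OF tG ba] A B by auto
  show "verts (side G b a) = verts G - verts (side G a b)" using V disj A B by auto
  have "e \<in> insert {a, b} ({e \<in> edges G. e \<subseteq> ?A} \<union> {e \<in> edges G. e \<subseteq> ?B})" if e: "e \<in> edges G" for e
  proof (cases "e = {a, b}")
    case False
    obtain u v where uv: "e = {u, v}" "u \<in> verts G" using is_graph_edgeE[OF G e] by metis
    then show ?thesis
    proof (cases "u \<in> ?A")
      case True
      then have "v \<in> ?A" using stepA[of u v] uv e False by blast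
      with True uv e show ?thesis by blast
    next
      case F: False
      then have "u \<in> ?B" using V uv by blast
      moreover from this have "v \<in> ?B" using stepB[of u v] uv e False by blast
      ultimately show ?thesis using uv e by blast
    qed
  qed simp
  then show "G = join_graph (side G a b) (side G b a) a b"
    using ab V by (intro prod_eqI) (auto simp: join_graph_def A B)
qed

text \<open>The converse of \<open>tree_split\<close>. Together they make cutting and joining
  mutually inverse, which is the bijection behind \<open>lsum_recursion\<close>.\<close>

lemma side_join:
  assumes tG: "is_tree G" and tH: "is_tree H" and d: "verts G \<inter> verts H = {}"
    and ab: "a \<in> verts G" "b \<in> verts H"
  shows "side (join_graph G H a b) a b = G"
proof -
  have G: "is_graph G" and H: "is_graph H" using tG tH by (auto simp: is_tree_def)
  have "edges (join_graph G H a b) - {{a, b}} = edges G \<union> edges H"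
    using join_new_edge[OF G H d ab] by (auto simp: join_graph_def)
  moreover have "{x. reach (edges G \<union> edges H) a x} = verts G"
  proof (intro subset_antisym subsetI)
    fix x assume "x \<in> verts G"
    then have "reach (edges G) a x" using tG ab by (simp add: is_tree_iff)
    then show "x \<in> {x. reach (edges G \<union> edges H) a x}" by (intro CollectI) (erule rtranclp_adj_mono, blast)
  qed (use join_reach[OF G H d ab(1)] in auto)
  moreover have "{e \<in> edges (join_graph G H a b). e \<subseteq> verts G} = edges G"
  proof -
    have "e \<subseteq> verts G" if "e \<in> edges G" for e using G that by (auto simp: is_graph_def)
    moreover have "\<not> e \<subseteq> verts G" if "e \<in> edges H" for e
      using is_graph_edgeE[OF H that] d by (metis disjoint_iff insert_subset)
    ultimately show ?thesis using ab d by (auto simp: join_graph_def)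
  qed
  ultimately show ?thesis by (simp add: side_def prod_eqI)
qed

lemma tree_edge_exists:
  assumes tG: "is_tree G" and "card (verts G) \<noteq> 1"
  shows "\<exists>a b. {a, b} \<in> edges G"
proof (rule ccontr)
  assume "\<not> ?thesis"
  then have no: "\<not> adj (edges G) x y" for x y by blast
  obtain r where r: "r \<in> verts G" using tG by (auto simp: is_tree_iff)
  have "x = r" if "x \<in> verts G" for x
  proof -
    have "reach (edges G) r x" using tG r that by (simp add: is_tree_iff)
    then show ?thesis by (cases rule: rtranclp.cases) (use no in auto)
  qed
  then have "verts G = {r}" using r by blast
  with assms(2) show False by simp
qed

text \<open>Cutting at an arbitrary edge splits the vertices into two parts and the remaining edges
  likewise, so strong induction works without choosing a leaf.\<close>

lemma card_edges_tree: "is_tree G \<Longrightarrow> card (verts G) = card (edges G) + 1"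
proof (induction "card (verts G)" arbitrary: G rule: less_induct)
  case less
  have G: "is_graph G" using less.prems by (simp add: is_tree_def)
  have fin: "finite (verts G)" using G by (simp add: is_graph_def)
  show ?case
  proof (cases "card (verts G) = 1")
    case True
    then obtain r where "verts G = {r}" by (auto simp: card_1_singleton_iff)
    then have "edges G = {}" using is_graph_edgeE[OF G] by (metis (no_types, opaque_lifting) equals0I singletonD)
    with True show ?thesis by simp
  next
    case False
    then obtain a b where ab: "{a, b} \<in> edges G" using tree_edge_exists less.prems by blast
    let ?A = "side G a b" and ?B = "side G b a"
    have ba: "{b, a} \<in> edges G" using ab by (simp add: insert_commute)
    note A = is_tree_side[OF less.prems ab] and B = is_tree_side[OF less.prems ba]
    note split = tree_split[OF less.prems ab]
    have gA: "is_graph ?A" "is_graph ?B" using A B by (auto simp: is_tree_def)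
    have "card (verts ?A) < card (verts G)"
      by (rule psubset_card_mono[OF fin]) (use A B is_graph_edge[OF G ab] in blast)
    moreover have "card (verts ?B) < card (verts G)"
      by (rule psubset_card_mono[OF fin]) (use A B is_graph_edge[OF G ab] in blast)
    ultimately have IH: "card (verts ?A) = card (edges ?A) + 1" "card (verts ?B) = card (edges ?B) + 1"
      using less.hyps A(1) B(1) by blast+
    have "edges ?A \<inter> edges ?B = {}"
    proof -
      have False if e: "e \<in> edges ?A" "e \<in> edges ?B" for e
      proof -
        obtain u v where "e = {u, v}" using is_graph_edgeE[OF gA(1) e(1)] by metis
        then have "u \<in> verts ?A" "u \<in> verts ?B"
          using is_graph_edge[OF gA(1)] is_graph_edge[OF gA(2)] e by blast+
        with split(2) show False by blast
      qed
      then show ?thesis by blast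
    qed
    moreover have "card (verts G) = card (verts ?A) + card (verts ?B)"
      using arg_cong[OF split(1), of "\<lambda>G. card (verts G)"] gA split(2)
      by (simp add: join_graph_def is_graph_def card_Un_disjoint)
    moreover have "card (edges G) = card (insert {a, b} (edges ?A \<union> edges ?B))"
      using arg_cong[OF split(1), of "\<lambda>G. card (edges G)"] by (simp add: join_graph_def)
    moreover have "{a, b} \<notin> edges ?A \<union> edges ?B"
      using join_new_edge[OF gA split(2) A(2) B(2)] by simp
    ultimately show ?thesis
      using IH is_graph_finite_edges[OF gA(1)] is_graph_finite_edges[OF gA(2)]
      by (simp add: card_Un_disjoint)
  qed
qed

lemma is_tree_component:
  assumes G: "is_graph G" and br: "bridges (edges G)" and c: "c \<in> verts G"
  shows "is_tree (component G c)" "c \<in> verts (component G c)"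
proof -
  have V: "verts (component G c) = {u \<in> verts G. reach (edges G) c u}"
    using c by (auto simp: component_def reachable_iff[OF G])
  have E: "edges (component G c) = {e \<in> edges G. e \<subseteq> verts (component G c)}"
    using c G by (auto simp: component_def reachable_iff[OF G])
  show 1: "c \<in> verts (component G c)" by (simp add: V c)
  show "is_tree (component G c)"
  proof (rule is_treeI[OF _ 1])
    show "is_graph (component G c)"
      by (rule is_graph_subgraph[OF G]) (auto simp: V E)
    show "bridges (edges (component G c))" by (rule bridges_subset[OF br]) (auto simp: E)
    fix v assume "v \<in> verts (component G c)"
    then have "reach (edges G) c v" by (simp add: V)
    then show "reach (edges (component G c)) c v"
    proof induction
      case (step y z)
      then have "{y, z} \<subseteq> verts (component G c)"
        using is_graph_edge[OF G step(2)] by (auto simp: V intro: rtranclp.rtrancl_into_rtrancl)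
      then have "{y, z} \<in> edges (component G c)" using step unfolding E by blast
      then show ?case using step.IH by (rule rtranclp.rtrancl_into_rtrancl[rotated])
    qed simp
  qed
qed

lemma branches_rtree:
  assumes S: "is_rtree S" and T: "T \<in> set (branches S)"
  shows "is_rtree T"
proof -
  have tS: "is_tree (fst S)" and G: "is_graph (fst S)" using S by (auto simp: is_rtree_def is_tree_def)
  let ?D = "delete_vertex (fst S) (snd S)"
  have "children S \<subseteq> verts (fst S)" using is_graph_edge[OF G] by (auto simp: children_def)
  then have "finite (children S)" using G by (auto simp: is_graph_def intro: finite_subset)
  then obtain c where c: "{snd S, c} \<in> edges (fst S)" "T = (component ?D c, c)"
    using T by (auto simp: branches_def children_def)
  have D: "is_graph ?D" by (rule is_graph_subgraph[OF G]) (use G in \<open>auto simp: delete_vertex_def is_graph_def\<close>)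
  have "c \<in> verts ?D" using is_graph_edge[OF G c(1)] by (auto simp: delete_vertex_def)
  moreover have "bridges (edges ?D)"
    by (rule bridges_subset[of "edges (fst S)"]) (use tS in \<open>auto simp: is_tree_iff delete_vertex_def\<close>)
  ultimately show ?thesis using is_tree_component[OF D] c by (simp add: is_rtree_def)
qed

text \<open>Between two occurrences of a vertex the walk could be short-circuited, contradicting
  minimal length.\<close>

lemma geodesic_distinct:
  assumes "is_geodesic G vs"
  shows "distinct vs"
proof (rule ccontr)
  assume "\<not> distinct vs"
  then obtain as x bs cs where vs: "vs = as @ [x] @ bs @ [x] @ cs" using not_distinct_decomp by blast
  let ?ws = "as @ [x] @ cs"
  have "is_walk G ?ws" using assms unfolding vs is_geodesic_def is_walk_def
    by (auto simp: successively_append_iff successively_Cons split: if_splits)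
  moreover have "hd ?ws = hd vs" "last ?ws = last vs" by (auto simp: vs hd_append)
  ultimately have "length vs \<le> length ?ws" using assms by (auto simp: is_geodesic_def)
  then show False by (simp add: vs)
qed

subsection \<open>Tree polynomials\<close>

text \<open>The labels at a vertex form a multiset because the incident edges carry no order;
  commutation of partial derivatives makes the fold well defined.\<close>

definition multi_deriv :: "nat multiset \<Rightarrow> cpoly \<Rightarrow> cpoly" where
  "multi_deriv \<alpha> p = fold_mset partial_deriv p \<alpha>"

interpretation pderivs: comp_fun_commute partial_deriv
  by unfold_locales (auto simp: fun_eq_iff partial_deriv_commute)

lemma multi_deriv_empty [simp]: "multi_deriv {#} p = p"
  and multi_deriv_add_mset [simp]: "multi_deriv (add_mset i \<alpha>) p = partial_deriv i (multi_deriv \<alpha> p)"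
  by (simp_all add: multi_deriv_def)

lemma multi_deriv_shift: "multi_deriv \<alpha> (partial_deriv i p) = partial_deriv i (multi_deriv \<alpha> p)"
  by (induction \<alpha>) (auto simp: partial_deriv_commute)

lemma multi_deriv_0 [simp]: "multi_deriv \<alpha> 0 = 0"
  by (induction \<alpha>) auto

lemma multi_deriv_degree_le: "degree_le d p \<Longrightarrow> d < size \<alpha> \<Longrightarrow> multi_deriv \<alpha> p = 0"
proof (induction d arbitrary: p \<alpha>)
  case 0
  then obtain i \<beta> where "\<alpha> = add_mset i \<beta>" by (cases \<alpha>) auto
  with 0 show ?case by (simp flip: multi_deriv_shift)
next
  case (Suc d)
  then obtain i \<beta> where "\<alpha> = add_mset i \<beta>" by (cases \<alpha>) auto
  with Suc show ?case by (simp flip: multi_deriv_shift)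
qed

lemma polys_multi_deriv: "p \<in> polys n \<Longrightarrow> multi_deriv \<alpha> p \<in> polys n"
  by (induction \<alpha>) (auto intro: polys_partial_deriv)

abbreviation inc :: "nat set set \<Rightarrow> nat \<Rightarrow> nat set set" where
  "inc E v \<equiv> {e \<in> E. v \<in> e}"

lemma card_2_doubleton:
  assumes "card A = 2" "p \<in> A" "q \<in> A" "p \<noteq> q"
  shows "A = {p, q}"
proof -
  have "finite A" using assms(1) by (metis card.infinite zero_neq_numeral)
  then have "{p, q} = A" by (rule card_subset_eq) (use assms in auto)
  then show ?thesis by simp
qed

lemma is_graph_remove_leaf:
  assumes G: "is_graph G" and v: "inc (edges G) v = {{v, w}}"
  shows "is_graph (verts G - {v}, edges G - {{v, w}})"
proof (rule is_graph_subgraph[OF G])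
  fix d assume d: "d \<in> edges (verts G - {v}, edges G - {{v, w}})"
  then have "d \<subseteq> verts G" using G by (auto simp: is_graph_def)
  moreover have "v \<notin> d"
  proof
    assume "v \<in> d"
    then have "d \<in> inc (edges G) v" using d by simp
    then show False using d unfolding v by simp
  qed
  ultimately show "d \<subseteq> verts (verts G - {v}, edges G - {{v, w}})" by auto
qed auto

locale potential =
  fixes N :: nat and P :: cpoly
begin

abbreviation labellings :: "nat set set \<Rightarrow> (nat set \<Rightarrow> nat) set" where
  "labellings E \<equiv> E \<rightarrow>\<^sub>E {..<N}"

text \<open>Both ends of an edge \<open>e\<close> are differentiated along the same variable \<open>l e\<close>; the multiset
  \<^term>\<open>x v\<close> holds the labels of additional half-edges at the vertex \<^term>\<open>v\<close>.\<close>

definition Psi :: "graph \<Rightarrow> (nat \<Rightarrow> nat multiset) \<Rightarrow> cpoly" where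
  "Psi G x = (\<Sum>l\<in>labellings (edges G). \<Prod>v\<in>verts G.
     multi_deriv (x v + image_mset l (mset_set (inc (edges G) v))) P)"

lemma Psi_cong: "(\<And>v. v \<in> verts G \<Longrightarrow> x v = y v) \<Longrightarrow> Psi G x = Psi G y"
  by (simp add: Psi_def)

text \<open>A derivative hits one vertex factor at a time and acts there as one more half-edge. This
  is the link between differentiating and attaching something at an arbitrary vertex.\<close>

lemma partial_deriv_Psi:
  assumes "finite (verts G)"
  shows "partial_deriv i (Psi G x) = (\<Sum>v\<in>verts G. Psi G (x(v := add_mset i (x v))))"
proof -
  let ?m = "\<lambda>x l v. multi_deriv (x v + image_mset l (mset_set (inc (edges G) v))) P"
  have "partial_deriv i (Psi G x) = (\<Sum>l\<in>labellings (edges G). \<Sum>v\<in>verts G. \<Prod>y\<in>verts G.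
      if y = v then partial_deriv i (?m x l y) else ?m x l y)"
    by (simp add: Psi_def partial_deriv_sum partial_deriv_prod[OF assms])
  also have "\<dots> = (\<Sum>l\<in>labellings (edges G). \<Sum>v\<in>verts G. \<Prod>y\<in>verts G. ?m (x(v := add_mset i (x v))) l y)"
    by (intro sum.cong prod.cong) auto
  also have "\<dots> = (\<Sum>v\<in>verts G. Psi G (x(v := add_mset i (x v))))"
    unfolding Psi_def by (rule sum.swap)
  finally show ?thesis .
qed

text \<open>Labellings are transported along the induced bijection of edges. This makes the
  polynomial of an isomorphism class independent of the representative.\<close>

lemma Psi_iso:
  assumes G: "is_graph G" and f: "is_iso f G H"
  shows "Psi H x = Psi G (x \<circ> f)"
proof -
  have b: "bij_betw f (verts G) (verts H)" and E: "(\<lambda>e. f ` e) ` edges G = edges H"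
    using f by (auto simp: is_iso_def)
  have inj: "inj_on f (verts G)" using b by (simp add: bij_betw_def)
  have injE: "inj_on (\<lambda>e. f ` e) (edges G)"
  proof (rule inj_onI)
    fix d e assume de: "d \<in> edges G" "e \<in> edges G" "f ` d = f ` e"
    then have "d \<subseteq> verts G" "e \<subseteq> verts G" using G by (auto simp: is_graph_def)
    then show "d = e" using de inj_on_image_eq_iff[OF inj] by blast
  qed
  let ?h = "the_inv_into (edges G) (\<lambda>e. f ` e)"
  have h1: "?h (f ` e) = e" if "e \<in> edges G" for e
    using the_inv_into_f_f[OF injE that] .
  have h2: "f ` ?h e = e" "?h e \<in> edges G" if "e \<in> edges H" for e
    using that h1 unfolding E[symmetric] by auto
  let ?t = "\<lambda>E x l v. multi_deriv (x v + image_mset l (mset_set (inc E v))) P"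
  have "Psi G (x \<circ> f) = (\<Sum>l\<in>labellings (edges G). \<Prod>v\<in>verts G. ?t (edges G) (x \<circ> f) l v)"
    by (simp add: Psi_def)
  also have "\<dots> = (\<Sum>l\<in>labellings (edges H). \<Prod>v\<in>verts H. ?t (edges H) x l v)"
  \<comment> \<open>\<open>restrict\<close> restores the default value outside the edge set that
    extensional functions require.\<close>
  proof (rule sum.reindex_bij_witness[of _ "\<lambda>l. restrict (\<lambda>e. l (f ` e)) (edges G)"
        "\<lambda>l. restrict (\<lambda>e. l (?h e)) (edges H)"])
    fix l assume l: "l \<in> labellings (edges G)"
    show "restrict (\<lambda>e. restrict (\<lambda>e. l (?h e)) (edges H) (f ` e)) (edges G) = l"
      using l E h1 by (auto simp: fun_eq_iff restrict_def PiE_def extensional_def)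
    show "restrict (\<lambda>e. l (?h e)) (edges H) \<in> labellings (edges H)"
      using l h2 by (auto simp: PiE_def Pi_def)
    have "?t (edges H) x (restrict (\<lambda>e. l (?h e)) (edges H)) (f v) = ?t (edges G) (x \<circ> f) l v"
      if v: "v \<in> verts G" for v
    proof -
      have "f v \<in> f ` e \<longleftrightarrow> v \<in> e" if "e \<in> edges G" for e
        using G that v inj_on_image_mem_iff[OF inj, of v e] by (auto simp: is_graph_def)
      then have inc: "inc (edges H) (f v) = (\<lambda>e. f ` e) ` inc (edges G) v"
        unfolding E[symmetric] by auto
      have "image_mset (restrict (\<lambda>e. l (?h e)) (edges H)) (mset_set (inc (edges H) (f v)))
          = image_mset (\<lambda>e. restrict (\<lambda>e. l (?h e)) (edges H) (f ` e)) (mset_set (inc (edges G) v))"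
        unfolding inc using inj_on_subset[OF injE, of "inc (edges G) v"]
        by (subst image_mset_mset_set[symmetric]) (auto simp: multiset.map_comp comp_def)
      also have "\<dots> = image_mset l (mset_set (inc (edges G) v))"
        using is_graph_finite_edges[OF G] E h1 by (intro image_mset_cong) auto
      finally show ?thesis by simp
    qed
    then show "(\<Prod>v\<in>verts H. ?t (edges H) x (restrict (\<lambda>e. l (?h e)) (edges H)) v) =
        (\<Prod>v\<in>verts G. ?t (edges G) (x \<circ> f) l v)"
      by (subst prod.reindex_bij_betw[OF b, symmetric]) (auto intro: prod.cong)
  next
    fix l assume l: "l \<in> labellings (edges H)"
    show "restrict (\<lambda>e. restrict (\<lambda>e. l (f ` e)) (edges G) (?h e)) (edges H) = l"
      using l h2 by (auto simp: fun_eq_iff restrict_def PiE_def extensional_def)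
    show "restrict (\<lambda>e. l (f ` e)) (edges G) \<in> labellings (edges G)"
      using l E by (auto simp: PiE_def Pi_def)
  qed
  finally show ?thesis by (simp add: Psi_def)
qed

text \<open>A labelling of the join is a label \<open>i\<close> of the new edge together with
  labellings of both parts. Once \<open>i\<close> is fixed, the new edge is a half-edge labelled
  \<open>i\<close> at each of its ends, and the product over the vertices factors.\<close>

lemma Psi_join:
  assumes G: "is_graph G" and H: "is_graph H" and d: "verts G \<inter> verts H = {}"
    and ab: "a \<in> verts G" "b \<in> verts H"
  shows "Psi (join_graph G H a b) x =
     (\<Sum>i<N. Psi G (x(a := add_mset i (x a))) * Psi H (x(b := add_mset i (x b))))"
proof -
  let ?J = "join_graph G H a b" and ?e = "{a, b}"
  let ?t = "\<lambda>E x l v. multi_deriv (x v + image_mset l (mset_set (inc E v))) P"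
  note new = join_new_edge[OF G H d ab]
  have EJ: "edges ?J = insert ?e (edges G \<union> edges H)" by (simp add: join_graph_def)
  have EGH: "edges G \<inter> edges H = {}"
  proof -
    have False if e: "e \<in> edges G" "e \<in> edges H" for e
    proof -
      obtain u v where "e = {u, v}" using is_graph_edgeE[OF G e(1)] by metis
      with is_graph_edge[OF G] is_graph_edge[OF H] e d show False by blast
    qed
    then show ?thesis by blast
  qed
  have fin: "finite (edges G)" "finite (edges H)"
    using is_graph_finite_edges G H by blast+
  have notin: "v \<notin> e" if "v \<in> verts G" "e \<in> edges H" for v e
    using that d H by (auto simp: is_graph_def)
  have notin': "v \<notin> e" if "v \<in> verts H" "e \<in> edges G" for v e
    using that d G by (auto simp: is_graph_def)
  have tG: "?t (edges ?J) x l v = ?t (edges G) (x(a := add_mset (l ?e) (x a))) (restrict l (edges G)) v"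
    if v: "v \<in> verts G" for v l
  proof -
    have "image_mset (restrict l (edges G)) (mset_set (inc (edges G) v)) =
        image_mset l (mset_set (inc (edges G) v))"
      using fin by (intro image_mset_cong) auto
    moreover have "inc (edges ?J) v = (if v = a then insert ?e (inc (edges G) v) else inc (edges G) v)"
      using v ab d notin by (auto simp: EJ)
    ultimately show ?thesis using fin new by auto
  qed
  have tH: "?t (edges ?J) x l v = ?t (edges H) (x(b := add_mset (l ?e) (x b))) (restrict l (edges H)) v"
    if v: "v \<in> verts H" for v l
  proof -
    have "image_mset (restrict l (edges H)) (mset_set (inc (edges H) v)) =
        image_mset l (mset_set (inc (edges H) v))"
      using fin by (intro image_mset_cong) auto
    moreover have "inc (edges ?J) v = (if v = b then insert ?e (inc (edges H) v) else inc (edges H) v)"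
      using v ab d notin' by (auto simp: EJ)
    ultimately show ?thesis using fin new by auto
  qed
  let ?g = "\<lambda>i l. \<Prod>v\<in>verts G. ?t (edges G) (x(a := add_mset i (x a))) l v"
  let ?h = "\<lambda>i l. \<Prod>v\<in>verts H. ?t (edges H) (x(b := add_mset i (x b))) l v"
  have prod: "(\<Prod>v\<in>verts ?J. ?t (edges ?J) x l v) =
      ?g (l ?e) (restrict l (edges G)) * ?h (l ?e) (restrict l (edges H))" for l
  proof -
    have "(\<Prod>v\<in>verts ?J. ?t (edges ?J) x l v) =
        (\<Prod>v\<in>verts G. ?t (edges ?J) x l v) * (\<Prod>v\<in>verts H. ?t (edges ?J) x l v)"
      using G H d by (simp add: join_graph_def prod.union_disjoint is_graph_def)
    moreover have "(\<Prod>v\<in>verts G. ?t (edges ?J) x l v) = ?g (l ?e) (restrict l (edges G))"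
      by (rule prod.cong[OF refl tG])
    moreover have "(\<Prod>v\<in>verts H. ?t (edges ?J) x l v) = ?h (l ?e) (restrict l (edges H))"
      by (rule prod.cong[OF refl tH])
    ultimately show ?thesis by (simp only:)
  qed
  have "Psi ?J x = (\<Sum>l\<in>labellings (edges ?J).
      ?g (l ?e) (restrict l (edges G)) * ?h (l ?e) (restrict l (edges H)))"
    unfolding Psi_def by (rule sum.cong[OF refl prod])
  also have "\<dots> = (\<Sum>(i, l, m)\<in>{..<N} \<times> labellings (edges G) \<times> labellings (edges H). ?g i l * ?h i m)"
  proof -
    define merge :: "nat \<times> (nat set \<Rightarrow> nat) \<times> (nat set \<Rightarrow> nat) \<Rightarrow> nat set \<Rightarrow> nat"
      where "merge = (\<lambda>(i, l, m) e. if e = ?e then i else if e \<in> edges G then l e else m e)"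
    define split where "split l = (l ?e, restrict l (edges G), restrict l (edges H))"
      for l :: "nat set \<Rightarrow> nat"
    show ?thesis
    proof (rule sum.reindex_bij_witness[of _ merge split])
      fix l assume l: "l \<in> labellings (edges ?J)"
      show "merge (split l) = l"
        using l by (auto simp: fun_eq_iff EJ PiE_def extensional_def merge_def split_def)
      show "split l \<in> {..<N} \<times> labellings (edges G) \<times> labellings (edges H)"
        using l by (auto simp: EJ PiE_def Pi_def split_def)
      show "(case split l of (i, l, m) \<Rightarrow> ?g i l * ?h i m) =
          ?g (l ?e) (restrict l (edges G)) * ?h (l ?e) (restrict l (edges H))"
        by (simp only: split_def prod.case)
    next
      fix ilm assume "ilm \<in> {..<N} \<times> labellings (edges G) \<times> labellings (edges H)"
      then obtain i l m where ilm: "ilm = (i, l, m)" "i < N" "l \<in> labellings (edges G)"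
        "m \<in> labellings (edges H)" by auto
      have "restrict (merge ilm) (edges G) = l" "restrict (merge ilm) (edges H) = m"
        using ilm new EGH by (auto simp: fun_eq_iff PiE_def extensional_def merge_def)
      then show "split (merge ilm) = ilm" by (simp add: split_def ilm(1)) (simp add: merge_def)
      show "merge ilm \<in> labellings (edges ?J)"
        using ilm by (auto simp: EJ PiE_def Pi_def extensional_def merge_def)
    qed
  qed
  also have "\<dots> = (\<Sum>i<N. Psi G (x(a := add_mset i (x a))) * Psi H (x(b := add_mset i (x b))))"
    by (simp add: Psi_def sum.cartesian_product[symmetric] sum_product)
  finally show ?thesis .
qed

lemma Psi_singleton: "Psi ({v}, {}) x = multi_deriv (x v) P"
  by (simp add: Psi_def)

section \<open>Hessian factors along a chain\<close>

abbreviation leg :: "nat \<Rightarrow> nat \<Rightarrow> nat \<Rightarrow> nat multiset" where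
  "leg v i \<equiv> (\<lambda>_. {#})(v := {#i#})"

definition hess_op :: "(nat \<Rightarrow> cpoly) \<Rightarrow> nat \<Rightarrow> cpoly" where
  "hess_op c i = (\<Sum>j<N. partial_deriv i (partial_deriv j P) * c j)"

text \<open>The leaf carries two labels, the leg \<open>i\<close> and the label \<open>j\<close> of
  its only edge, so its factor is the Hessian entry \<open>i\<close>, \<open>j\<close>; the rest of
  the tree sees a leg \<open>j\<close> at the neighbour.\<close>

lemma Psi_leaf:
  assumes G: "is_graph G" and v: "inc (edges G) v = {{v, w}}"
  shows "Psi G (leg v i) = hess_op (\<lambda>j. Psi (verts G - {v}, edges G - {{v, w}}) (leg w j)) i"
proof -
  let ?H = "(verts G - {v}, edges G - {{v, w}})"
  have vw: "{v, w} \<in> edges G" using v by blast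
  note e = is_graph_edge[OF G vw]
  have H: "is_graph ?H" by (rule is_graph_remove_leaf[OF G v])
  have V: "is_graph ({v}, {})" by (simp add: is_graph_def)
  have J: "G = join_graph ({v}, {}) ?H v w"
    using vw e by (intro prod_eqI) (auto simp: join_graph_def)
  have "Psi (join_graph ({v}, {}) ?H v w) (leg v i) =
      (\<Sum>j<N. partial_deriv j (partial_deriv i P) * Psi ?H (leg w j))"
    using e by (subst Psi_join[OF V H]) (auto intro!: sum.cong Psi_cong arg_cong2[of _ _ _ _ "(*)"]
        simp: Psi_singleton)
  then show ?thesis using J by (simp add: hess_op_def partial_deriv_commute)
qed

text \<open>Removing the end vertex costs one Hessian and turns the next vertex, of degree 2, into a
  leaf. The last vertex of the chain is never removed; everything hanging on it is absorbed into
  \<open>c\<close>.\<close>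

lemma Psi_chain:
  assumes "is_graph G" "distinct (v # vs)" "successively (adj (edges G)) (v # vs)"
    "vs \<noteq> [] \<Longrightarrow> inc (edges G) v = {{v, hd vs}}"
    "\<And>u. u \<in> set (butlast vs) \<Longrightarrow> card (inc (edges G) u) = 2"
  shows "\<exists>c. (\<lambda>i. Psi G (leg v i)) = (hess_op ^^ length vs) c"
  using assms
proof (induction vs arbitrary: G v)
  case Nil
  show ?case by auto
next
  case (Cons w ws)
  let ?H = "(verts G - {v}, edges G - {{v, w}})"
  have v: "inc (edges G) v = {{v, w}}" using Cons.prems(4) by simp
  have vw: "v \<noteq> w" using Cons.prems(2) by simp
  have H: "is_graph ?H" by (rule is_graph_remove_leaf[OF Cons.prems(1) v])
  have "\<exists>c. (\<lambda>i. Psi ?H (leg w i)) = (hess_op ^^ length ws) c"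
  proof (rule Cons.IH[OF H])
    show "distinct (w # ws)" using Cons.prems(2) by simp
    have "successively (adj (edges G)) (w # ws)" using Cons.prems(3) by simp
    then show "successively (adj (edges ?H)) (w # ws)"
    proof (rule successively_mono)
      fix x y assume "x \<in> set (w # ws)" "y \<in> set (w # ws)" "{x, y} \<in> edges G"
      then show "{x, y} \<in> edges ?H" using Cons.prems(2) by (auto simp: doubleton_eq_iff)
    qed
    have other: "inc (edges ?H) u = inc (edges G) u" if "u \<noteq> v" "u \<noteq> w" for u
      using that by auto
    show "card (inc (edges ?H) u) = 2" if u: "u \<in> set (butlast ws)" for u
    proof -
      have "u \<in> set ws" using u by (rule in_set_butlastD)
      then have "u \<noteq> v" "u \<noteq> w" using Cons.prems(2) by auto
      moreover have "u \<in> set (butlast (w # ws))" using u by (cases ws) auto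
      ultimately show ?thesis using Cons.prems(5) other by simp
    qed
    assume ne: "ws \<noteq> []"
    then have "card (inc (edges G) w) = 2" using Cons.prems(5)[of w] by simp
    moreover have "{w, hd ws} \<in> edges G" using Cons.prems(3) ne by (cases ws) auto
    moreover have "{v, w} \<in> edges G" using v by blast
    moreover have "{v, w} \<noteq> {w, hd ws}" using Cons.prems(2) ne by (cases ws) (auto simp: doubleton_eq_iff)
    ultimately have *: "inc (edges G) w = {{v, w}, {w, hd ws}}"
      by (intro card_2_doubleton) auto
    have "inc (edges ?H) w = inc (edges G) w - {{v, w}}" by auto
    also have "\<dots> = {{w, hd ws}}"
      unfolding * using \<open>{v, w} \<noteq> {w, hd ws}\<close> by (simp add: insert_Diff_if)
    finally show "inc (edges ?H) w = {{w, hd ws}}" .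
  qed
  then obtain c where "(\<lambda>i. Psi ?H (leg w i)) = (hess_op ^^ length ws) c" by blast
  then have "(\<lambda>i. Psi G (leg v i)) = (hess_op ^^ length (w # ws)) c"
    using Psi_leaf[OF Cons.prems(1) v] by auto
  then show ?case by blast
qed

abbreviation zero_legs :: "nat \<Rightarrow> nat multiset" where
  "zero_legs \<equiv> \<lambda>_. {#}"

text \<open>Cutting the first edge leaves the second vertex as a leaf with a leg. Peeling from there
  gives one Hessian for each of the r - 2 interior vertices, whatever is attached at the two ends of
  the chain.\<close>

lemma Psi_naked_chain:
  assumes tG: "is_tree G" and ch: "is_naked_chain G r vs" and r: "3 \<le> r"
    and nil: "\<And>c i. i < N \<Longrightarrow> (hess_op ^^ (r - 2)) c i = 0"
  shows "Psi G zero_legs = 0"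
proof -
  have G: "is_graph G" using tG by (simp add: is_tree_def)
  have geo: "is_geodesic G vs" and len: "length vs = r" using ch by (auto simp: is_naked_chain_def)
  \<comment> \<open>The edge from \<open>u\<close> to \<open>v\<close> is the one to be cut. Since r
    is at least 3, \<open>ws\<close> is nonempty, so \<open>v\<close> is an interior vertex of the
    chain.\<close>
  obtain u v ws where vs: "vs = u # v # ws" and lws: "length ws = r - 2" "ws \<noteq> []"
  proof -
    from len r obtain u v w ws where "vs = u # v # w # ws"
      by (auto simp: Suc_le_length_iff numeral_3_eq_3)
    with len show thesis by (intro that[of u v "w # ws"]) auto
  qed
  have dist: "distinct vs" using geodesic_distinct[OF geo] .
  have succ: "successively (adj (edges G)) vs" using geo by (simp add: is_geodesic_def is_walk_def)
  have deg: "card (inc (edges G) x) = 2" if "x \<in> set (v # butlast ws)" for x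
  proof -
    have "butlast (v # ws) = v # butlast ws" using lws by simp
    then have "x \<in> set (butlast (v # ws))" using that by simp
    then obtain k where k: "k < length ws" "x = butlast (v # ws) ! k"
      unfolding in_set_conv_nth length_butlast by auto
    then have "x = vs ! Suc k" using lws nth_butlast[of k "v # ws"] by (simp add: vs)
    moreover have "Suc k < r - 1" using k lws r by simp
    ultimately show ?thesis using ch by (auto simp: is_naked_chain_def vdegree_def)
  qed
  have uv: "{u, v} \<in> edges G" using succ vs by simp
  have vu: "{v, u} \<in> edges G" using uv by (simp add: insert_commute)
  let ?A = "side G u v" and ?B = "side G v u"
  note A = is_tree_side[OF tG uv] and B = is_tree_side[OF tG vu] and sp = tree_split[OF tG uv]
  have gA: "is_graph ?A" and gB: "is_graph ?B" using A B by (auto simp: is_tree_def)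
  have "successively (adj (edges G - {{v, u}})) (v # ws)"
  proof (rule successively_mono[of "adj (edges G)"])
    show "successively (adj (edges G)) (v # ws)" using succ vs by simp
    fix x y assume "x \<in> set (v # ws)" "y \<in> set (v # ws)" "{x, y} \<in> edges G"
    then show "{x, y} \<in> edges G - {{v, u}}" using dist vs by (auto simp: doubleton_eq_iff)
  qed
  moreover have "set (v # ws) \<subseteq> verts ?B"
  proof
    fix x assume "x \<in> set (v # ws)"
    then obtain as bs where s: "v # ws = as @ x # bs" by (auto dest: split_list simp del: set_simps)
    then have "successively (adj (edges G - {{v, u}})) (as @ [x])"
      using calculation by (auto simp: successively_append_iff)
    moreover have "hd (as @ [x]) = v" using s by (cases as) auto
    ultimately have "reach (edges G - {{v, u}}) v x"
      using successively_imp_rtranclp[of _ "as @ [x]"] by simp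
    then show "x \<in> verts ?B" by (simp add: side_def Let_def)
  qed
  ultimately have succB: "successively (adj (edges ?B)) (v # ws)" and sub: "set (v # ws) \<subseteq> verts ?B"
  proof -
    assume s: "successively (adj (edges G - {{v, u}})) (v # ws)" and sub: "set (v # ws) \<subseteq> verts ?B"
    show "successively (adj (edges ?B)) (v # ws)"
    proof (rule successively_mono[OF s])
      fix x y assume xy: "x \<in> set (v # ws)" "y \<in> set (v # ws)" "{x, y} \<in> edges G - {{v, u}}"
      have "edges ?B = {e \<in> edges G. e \<subseteq> verts ?B}" by (simp add: side_def Let_def)
      with xy sub show "{x, y} \<in> edges ?B" by blast
    qed
    show "set (v # ws) \<subseteq> verts ?B" by (rule sub)
  qed
  have "edges G = insert {u, v} (edges ?A \<union> edges ?B)"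
    using arg_cong[OF sp(1), of edges] by (simp add: join_graph_def)
  then have inc: "inc (edges G) x = (if x = v then insert {u, v} (inc (edges ?B) x) else inc (edges ?B) x)"
    if "x \<in> verts ?B" for x
    using that sp(2) gA A(2) by (auto simp: is_graph_def)
  have new: "{u, v} \<notin> edges ?B" using join_new_edge[OF gA gB sp(2) A(2) B(2)] by simp
  have "\<exists>c. (\<lambda>i. Psi ?B (leg v i)) = (hess_op ^^ length ws) c"
  proof (rule Psi_chain[OF gB _ succB])
    show "distinct (v # ws)" using dist vs by simp
    show "card (inc (edges ?B) x) = 2" if x: "x \<in> set (butlast ws)" for x
    proof -
      have "x \<in> set ws" using x by (rule in_set_butlastD)
      moreover from this have "x \<noteq> v" using dist vs by auto
      ultimately show ?thesis using inc[of x] deg[of x] x sub by auto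
    qed
    have e: "{v, hd ws} \<in> edges ?B" using succB lws by (cases ws) auto
    \<comment> \<open>\<open>v\<close> has degree 2 in \<open>G\<close>, so without the edge to
      \<open>u\<close> only the edge along the chain is left.\<close>
    have "card (insert {u, v} (inc (edges ?B) v)) = 2" using deg[of v] inc[of v] B(2) by simp
    then have "card (inc (edges ?B) v) = 1"
      using new is_graph_finite_edges[OF gB] by simp
    then obtain f where f: "inc (edges ?B) v = {f}" by (rule card_1_singletonE)
    have "{v, hd ws} \<in> {f}" unfolding f[symmetric] using e by simp
    then show "inc (edges ?B) v = {{v, hd ws}}" by (simp add: f)
  qed
  then obtain c where c: "\<And>i. Psi ?B (leg v i) = (hess_op ^^ length ws) c i" by (metis)
  have "Psi (join_graph ?A ?B u v) zero_legs = (\<Sum>i<N. Psi ?A (leg u i) * Psi ?B (leg v i))"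
    by (subst Psi_join[OF gA gB sp(2) A(2) B(2)]) simp
  also have "\<dots> = 0" using nil lws by (simp add: c)
  finally show ?thesis using sp(1) by simp
qed

lemma Psi_degree:
  assumes G: "is_graph G" and d: "degree_le d P" and v: "v \<in> verts G" "d + 1 \<le> vdegree G v"
  shows "Psi G zero_legs = 0"
  unfolding Psi_def
proof (intro sum.neutral ballI prod_zero)
  show "finite (verts G)" using G by (simp add: is_graph_def)
  fix l
  show "\<exists>v\<in>verts G. multi_deriv ({#} + image_mset l (mset_set (inc (edges G) v))) P = 0"
    using v by (intro bexI[of _ v] multi_deriv_degree_le[OF d]) (auto simp: vdegree_def)
qed

lemma polys_Psi: "P \<in> polys n \<Longrightarrow> Psi G x \<in> polys n"
  unfolding Psi_def by (intro polys_sum polys_prod polys_multi_deriv)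

end

subsection \<open>Grafting and the tree module\<close>

lemma rep_utree_tree: "is_tree (rep_utree T)"
  using Quotient3_rep_reflp[OF Quotient3_utree] by (auto simp: tree_iso_def)

lemma abs_rep_utree: "abs_utree (rep_utree T) = T"
  by (rule Quotient3_abs_rep[OF Quotient3_utree])

lemma abs_utree_eqI: "is_tree G \<Longrightarrow> is_iso f G H \<Longrightarrow> abs_utree G = abs_utree H"
  by (rule Quotient3_rel_abs[OF Quotient3_utree]) (auto simp: tree_iso_def intro: is_tree_iso)

lemma rep_abs_utree:
  assumes "is_tree G"
  obtains f where "is_iso f (rep_utree (abs_utree G)) G"
proof -
  have "tree_iso G G" using assms is_iso_id[of G] unfolding tree_iso_def by blast
  then have "tree_iso (rep_utree (abs_utree G)) G"
    using Quotient3_rep_abs[OF Quotient3_utree] by blast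
  then show thesis using that by (auto simp: tree_iso_def)
qed

lemma rep_rtree_rtree: "is_rtree (rep_rtree S)"
  using Quotient3_rep_reflp[OF Quotient3_rtree] by (auto simp: rtree_iso_def)

definition image_graph :: "(nat \<Rightarrow> nat) \<Rightarrow> graph \<Rightarrow> graph" where
  "image_graph f G = (f ` verts G, (\<lambda>e. f ` e) ` edges G)"

lemma is_iso_image_graph: "inj_on f (verts G) \<Longrightarrow> is_iso f G (image_graph f G)"
  by (simp add: is_iso_def image_graph_def bij_betw_def)

lemma relabel_eq_iff [simp]: "relabel i u = relabel j v \<longleftrightarrow> i = j \<and> u = v"
  by (simp add: relabel_def)

lemma relabel_eq_decode: "w = relabel i v \<longleftrightarrow> prod_decode w = (i, v)"
  by (metis prod_decode_inverse prod_encode_inverse relabel_def)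

lemma inj_relabel: "inj_on (relabel i) A"
  by (auto simp: inj_on_def)

lemma graft_Nil: "graft [] [] T = image_graph (relabel 0) T"
  by (simp add: graft_def image_graph_def)

text \<open>Tags are positions in the list, so appending a branch at the end leaves the earlier tags
  unchanged. For this reason inductions over grafts use \<open>rev_induct\<close>, and
  \<open>branch_op\<close> appears with the reversed list.\<close>

lemma graft_snoc:
  assumes "length vs = length Ss"
  shows "graft (Ss @ [S]) (vs @ [v]) T =
    join_graph (graft Ss vs T) (image_graph (relabel (Suc (length Ss))) (fst S))
      (relabel 0 v) (relabel (Suc (length Ss)) (snd S))"
proof -
  have nth: "(Ss @ [S]) ! i = Ss ! i" "(vs @ [v]) ! i = vs ! i" if "i < length Ss" for i
    using that assms by (auto simp: nth_append)
  have nth': "(Ss @ [S]) ! length Ss = S" "(vs @ [v]) ! length Ss = v"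
    using assms by (auto simp: nth_append)
  show ?thesis
    using nth nth' by (intro prod_eqI)
      (auto simp: graft_def join_graph_def image_graph_def lessThan_Suc cong: image_cong_simp)
qed

lemma verts_graft:
  "verts (graft Ss vs T) = relabel 0 ` verts T \<union> (\<Union>i<length Ss. relabel (Suc i) ` verts (fst (Ss ! i)))"
  by (simp add: graft_def)

lemma graft_disjoint:
  "verts (graft Ss vs T) \<inter> verts (image_graph (relabel (Suc (length Ss))) G) = {}"
  by (auto simp: verts_graft image_graph_def)

lemma is_tree_image_graph: "is_tree G \<Longrightarrow> inj_on f (verts G) \<Longrightarrow> is_tree (image_graph f G)"
  using is_tree_iso is_iso_image_graph by blast

lemma is_tree_graft:
  assumes T: "is_tree T"
  shows "\<forall>S\<in>set Ss. is_rtree S \<Longrightarrow> length vs = length Ss \<Longrightarrow> set vs \<subseteq> verts T \<Longrightarrow>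
    is_tree (graft Ss vs T)"
proof (induction Ss arbitrary: vs rule: rev_induct)
  case Nil
  then show ?case using T by (simp add: graft_Nil is_tree_image_graph inj_relabel)
next
  case (snoc S Ss)
  then obtain ws w where vs: "vs = ws @ [w]" "length ws = length Ss" by (cases vs rule: rev_cases) auto
  then have "is_tree (graft Ss ws T)" using snoc by auto
  moreover have "is_tree (image_graph (relabel (Suc (length Ss))) (fst S))"
    using snoc.prems by (simp add: is_rtree_def is_tree_image_graph inj_relabel)
  ultimately show ?case
    unfolding vs(1) graft_snoc[OF vs(2)]
    by (rule is_tree_join[OF _ _ graft_disjoint])
      (use snoc.prems vs in \<open>auto simp: verts_graft image_graph_def is_rtree_def\<close>)
qed

lemma act_basis_eq:
  "act_basis S T = (\<Sum>vs | set vs \<subseteq> verts (rep_utree T) \<and> length vs = length (branches (rep_rtree S)).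
     tree_basis (abs_utree (graft (branches (rep_rtree S)) vs (rep_utree T))))"
  by (simp add: act_basis_def Let_def)

section \<open>Rooted trees as differential operators\<close>

context potential
begin

text \<open>The coefficients stay outside all derivatives: branches are grafted at vertices of the
  target only, never at vertices of another branch.\<close>

primrec branch_op :: "(graph \<times> nat) list \<Rightarrow> cpoly \<Rightarrow> cpoly" where
  "branch_op [] f = f"
| "branch_op (S # Ss) f = (\<Sum>i<N. Psi (fst S) (leg (snd S) i) * branch_op Ss (partial_deriv i f))"

lemma branch_op_add: "branch_op Ss (f + g) = branch_op Ss f + branch_op Ss g"
  by (induction Ss arbitrary: f g) (auto simp: partial_deriv_add sum.distrib algebra_simps)

lemma branch_op_0 [simp]: "branch_op Ss 0 = 0"
  by (induction Ss) auto

lemma branch_op_sum: "branch_op Ss (\<Sum>x\<in>A. f x) = (\<Sum>x\<in>A. branch_op Ss (f x))"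
  by (induction A rule: infinite_finite_induct) (auto simp: branch_op_add)

lemma branch_op_const_mult: "branch_op Ss (const_poly c * f) = const_poly c * branch_op Ss f"
  by (induction Ss arbitrary: f)
    (simp_all add: partial_deriv_const_mult sum_distrib_left mult.left_commute)

text \<open>In a graft the target has tag 0; its legs are carried over to that copy, and the
  branches receive none.\<close>

abbreviation push_legs :: "(nat \<Rightarrow> nat multiset) \<Rightarrow> nat \<Rightarrow> nat multiset" where
  "push_legs x w \<equiv> (if fst (prod_decode w) = 0 then x (snd (prod_decode w)) else {#})"

lemma sum_lists_Suc:
  assumes "finite A"
  shows "(\<Sum>vs | set vs \<subseteq> A \<and> length vs = Suc k. f vs) =
    (\<Sum>vs | set vs \<subseteq> A \<and> length vs = k. \<Sum>v\<in>A. f (vs @ [v]))"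
proof -
  have "(\<Sum>vs | set vs \<subseteq> A \<and> length vs = k. \<Sum>v\<in>A. f (vs @ [v])) =
      (\<Sum>(vs, v)\<in>{vs. set vs \<subseteq> A \<and> length vs = k} \<times> A. f (vs @ [v]))"
    using finite_lists_length_eq[OF assms] by (simp add: sum.cartesian_product)
  also have "\<dots> = (\<Sum>vs | set vs \<subseteq> A \<and> length vs = Suc k. f vs)"
    by (rule sum.reindex_bij_witness[of _ "\<lambda>vs. (butlast vs, last vs)" "\<lambda>(vs, v). vs @ [v]"])
      (auto simp: length_Suc_conv_rev)
  finally show ?thesis by simp
qed

text \<open>Joining a branch by an edge labelled \<open>i\<close>, summed over all places
  \<open>v\<close>, is differentiation by \<open>partial_deriv_Psi\<close>. The legs
  \<open>x\<close> are arbitrary because splitting off the last branch leaves a leg at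
  \<open>v\<close>.\<close>

lemma sum_Psi_graft:
  assumes T: "is_tree T"
  shows "\<forall>S\<in>set Ss. is_rtree S \<Longrightarrow>
    (\<Sum>vs | set vs \<subseteq> verts T \<and> length vs = length Ss. Psi (graft Ss vs T) (push_legs x)) =
      branch_op (rev Ss) (Psi T x)"
proof (induction Ss arbitrary: x rule: rev_induct)
  case Nil
  have "is_graph T" using T by (simp add: is_tree_def)
  then have "Psi (graft [] [] T) (push_legs x) = Psi T (push_legs x \<circ> relabel 0)"
    unfolding graft_Nil by (rule Psi_iso) (rule is_iso_image_graph[OF inj_relabel])
  also have "push_legs x \<circ> relabel 0 = x" by (auto simp: relabel_def)
  moreover have "{vs. set vs \<subseteq> verts T \<and> length vs = length ([] :: (graph \<times> nat) list)} = {[]}" by auto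
  ultimately show ?case by simp
next
  case (snoc S Ss)
  have fin: "finite (verts T)" using T by (simp add: is_tree_def is_graph_def)
  let ?k = "Suc (length Ss)"
  let ?I = "image_graph (relabel ?k) (fst S)"
  have S: "is_tree (fst S)" "is_graph (fst S)" "snd S \<in> verts (fst S)"
    using snoc.prems by (auto simp: is_rtree_def is_tree_def)
  have I: "is_graph ?I" using is_graph_iso[OF S(2) is_iso_image_graph[OF inj_relabel]] .
  have leg: "Psi ?I ((push_legs x)(relabel ?k (snd S) := add_mset i (push_legs x (relabel ?k (snd S))))) =
      Psi (fst S) (leg (snd S) i)" for i x
    unfolding Psi_iso[OF S(2) is_iso_image_graph[OF inj_relabel]]
    by (rule Psi_cong) (auto simp: relabel_def)
  have push: "(push_legs x)(relabel 0 v := add_mset i (push_legs x (relabel 0 v))) =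
      push_legs (x(v := add_mset i (x v)))" for i v and x :: "nat \<Rightarrow> nat multiset"
  proof (rule ext)
    fix w
    show "((push_legs x)(relabel 0 v := add_mset i (push_legs x (relabel 0 v)))) w =
        push_legs (x(v := add_mset i (x v))) w"
      by (cases "prod_decode w") (auto simp: relabel_eq_decode, auto simp: relabel_def)
  qed
  have step: "Psi (graft (Ss @ [S]) (vs @ [v]) T) (push_legs x) =
      (\<Sum>i<N. Psi (graft Ss vs T) (push_legs (x(v := add_mset i (x v)))) * Psi (fst S) (leg (snd S) i))"
    if vs: "set vs \<subseteq> verts T" "length vs = length Ss" and v: "v \<in> verts T" for vs v
  proof -
    have "is_tree (graft Ss vs T)" using is_tree_graft[OF T _ vs(2,1)] snoc.prems by simp
    then have g: "is_graph (graft Ss vs T)" by (simp add: is_tree_def)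
    have "relabel 0 v \<in> verts (graft Ss vs T)" using v by (simp add: verts_graft)
    moreover have "relabel ?k (snd S) \<in> verts ?I" using S by (simp add: image_graph_def)
    ultimately have "Psi (graft (Ss @ [S]) (vs @ [v]) T) (push_legs x) = (\<Sum>i<N.
        Psi (graft Ss vs T) ((push_legs x)(relabel 0 v := add_mset i (push_legs x (relabel 0 v)))) *
        Psi ?I ((push_legs x)(relabel ?k (snd S) := add_mset i (push_legs x (relabel ?k (snd S))))))"
      unfolding graft_snoc[OF vs(2)] by (rule Psi_join[OF g I graft_disjoint])
    then show ?thesis by (simp only: leg push)
  qed
  let ?L = "{vs. set vs \<subseteq> verts T \<and> length vs = length Ss}"
  let ?t = "\<lambda>vs v i. Psi (graft Ss vs T) (push_legs (x(v := add_mset i (x v)))) * Psi (fst S) (leg (snd S) i)"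
  have "(\<Sum>vs | set vs \<subseteq> verts T \<and> length vs = length (Ss @ [S]).
        Psi (graft (Ss @ [S]) vs T) (push_legs x)) =
      (\<Sum>vs\<in>?L. \<Sum>v\<in>verts T. Psi (graft (Ss @ [S]) (vs @ [v]) T) (push_legs x))"
    by (simp add: sum_lists_Suc[OF fin])
  also have "\<dots> = (\<Sum>vs\<in>?L. \<Sum>v\<in>verts T. \<Sum>i<N. ?t vs v i)"
    by (intro sum.cong refl step) auto
  also have "\<dots> = (\<Sum>i<N. \<Sum>v\<in>verts T. \<Sum>vs\<in>?L. ?t vs v i)"
    by (rule trans[OF sum_rotate]) (intro sum.cong refl sum.swap)
  also have "\<dots> = (\<Sum>i<N. \<Sum>v\<in>verts T.
        branch_op (rev Ss) (Psi T (x(v := add_mset i (x v)))) * Psi (fst S) (leg (snd S) i))"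
    using snoc by (simp add: sum_distrib_right[symmetric])
  also have "\<dots> = branch_op (rev (Ss @ [S])) (Psi T x)"
    by (simp add: partial_deriv_Psi[OF fin] branch_op_sum sum_distrib_left mult.commute)
  finally show ?case .
qed

section \<open>The linear map from the tree module to polynomials\<close>

definition tree_poly :: "utree \<Rightarrow> cpoly" where
  "tree_poly T = Psi (rep_utree T) zero_legs"

lemma tree_poly_abs:
  assumes "is_tree G"
  shows "tree_poly (abs_utree G) = Psi G zero_legs"
proof -
  obtain f where "is_iso f (rep_utree (abs_utree G)) G" using rep_abs_utree[OF assms] .
  moreover have "is_graph (rep_utree (abs_utree G))" using rep_utree_tree by (simp add: is_tree_def)
  ultimately show ?thesis unfolding tree_poly_def by (subst Psi_iso[of "rep_utree (abs_utree G)"]) (auto simp: comp_def)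
qed

abbreviation rat_poly :: "rat \<Rightarrow> cpoly" where
  "rat_poly c \<equiv> const_poly (of_rat c)"

definition Phi :: "tree_module \<Rightarrow> cpoly" where
  "Phi x = (\<Sum>T\<in>keys x. rat_poly (lookup x T) * tree_poly T)"

lemma Phi_superset:
  "finite A \<Longrightarrow> keys x \<subseteq> A \<Longrightarrow> Phi x = (\<Sum>T\<in>A. rat_poly (lookup x T) * tree_poly T)"
  unfolding Phi_def by (intro sum.mono_neutral_left) (auto simp: in_keys_iff)

lemma Phi_add: "Phi (x + y) = Phi x + Phi y"
  using keys_add[of x y]
  by (simp add: Phi_superset[of "keys x \<union> keys y"] lookup_add of_rat_add const_poly_add
      sum.distrib algebra_simps)

lemma Phi_0 [simp]: "Phi 0 = 0"
  by (simp add: Phi_def)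

lemma Phi_sum: "Phi (\<Sum>x\<in>A. f x) = (\<Sum>x\<in>A. Phi (f x))"
  by (induction A rule: infinite_finite_induct) (auto simp: Phi_add)

lemma Phi_tscale: "Phi (tscale c x) = rat_poly c * Phi x"
proof -
  have "keys (tscale c x) \<subseteq> keys x" by (auto simp: in_keys_iff lookup_tscale)
  then show ?thesis
    by (simp add: Phi_superset[of "keys x"] lookup_tscale of_rat_mult const_poly_mult
        sum_distrib_left mult.assoc)
qed

lemma Phi_basis [simp]: "Phi (tree_basis T) = tree_poly T"
  by (simp add: Phi_def)

lemma Phi_act_basis: "Phi (act_basis S T) = branch_op (rev (branches (rep_rtree S))) (tree_poly T)"
proof -
  let ?Ss = "branches (rep_rtree S)" and ?G = "rep_utree T"
  have Ss: "\<forall>S\<in>set ?Ss. is_rtree S" using branches_rtree[OF rep_rtree_rtree] by blast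
  have "Phi (act_basis S T) = (\<Sum>vs | set vs \<subseteq> verts ?G \<and> length vs = length ?Ss.
      Psi (graft ?Ss vs ?G) zero_legs)"
    unfolding act_basis_eq Phi_sum
    using is_tree_graft[OF rep_utree_tree Ss] by (intro sum.cong refl) (auto simp: tree_poly_abs)
  also have "zero_legs = push_legs zero_legs" by auto
  then have "(\<Sum>vs | set vs \<subseteq> verts ?G \<and> length vs = length ?Ss. Psi (graft ?Ss vs ?G) zero_legs) =
      (\<Sum>vs | set vs \<subseteq> verts ?G \<and> length vs = length ?Ss. Psi (graft ?Ss vs ?G) (push_legs zero_legs))"
    by (rule arg_cong)
  also have "\<dots> = branch_op (rev ?Ss) (Psi ?G zero_legs)"
    by (rule sum_Psi_graft[OF rep_utree_tree Ss])
  finally show ?thesis by (simp add: tree_poly_def)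
qed

text \<open>On the right \<open>x\<close> enters only through \<open>Phi x\<close>, which is why the
  kernel of \<open>Phi\<close> is closed under the action.\<close>

lemma Phi_act:
  "Phi (act h x) = (\<Sum>S\<in>keys h. rat_poly (lookup h S) * branch_op (rev (branches (rep_rtree S))) (Phi x))"
proof -
  have "branch_op Ss (Phi x) = (\<Sum>T\<in>keys x. rat_poly (lookup x T) * branch_op Ss (tree_poly T))" for Ss
    by (simp add: Phi_def branch_op_sum branch_op_const_mult)
  then show ?thesis
    by (simp add: act_def Phi_sum Phi_tscale Phi_act_basis of_rat_mult const_poly_mult
        sum_distrib_left mult.assoc)
qed

lemma gl_submodule_kernel: "gl_submodule {x. Phi x = 0}"
  by (auto simp: gl_submodule_def TM.subspace_def Phi_add Phi_tscale Phi_act)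

lemma chain_submodule_kernel:
  assumes "3 \<le> r" "\<And>c i. i < N \<Longrightarrow> (hess_op ^^ (r - 2)) c i = 0"
  shows "chain_submodule r \<subseteq> {x. Phi x = 0}"
  unfolding chain_submodule_def
proof (rule hull_minimal)
  show "gl_submodule {x. Phi x = 0}" by (rule gl_submodule_kernel)
  have "Psi G zero_legs = 0" if "is_tree G" "is_naked_chain G r vs" for G vs
    using Psi_naked_chain[OF that assms] .
  then show "{tree_basis (abs_utree G) |G. is_tree G \<and> (\<exists>vs. is_naked_chain G r vs)} \<subseteq> {x. Phi x = 0}"
    by (auto simp: tree_poly_abs simp del: split_paired_Ex)
qed

lemma degree_submodule_kernel:
  assumes "degree_le d P"
  shows "degree_submodule d \<subseteq> {x. Phi x = 0}"
  unfolding degree_submodule_def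
proof (rule TM.span_minimal)
  show "TM.subspace {x. Phi x = 0}" using gl_submodule_kernel by (simp add: gl_submodule_def)
  show "{tree_basis (abs_utree G) |G. is_tree G \<and> (\<exists>v\<in>verts G. d + 1 \<le> vdegree G v)} \<subseteq> {x. Phi x = 0}"
  proof clarify
    fix G v assume "is_tree G" "v \<in> verts G" "d + 1 \<le> vdegree G v"
    then show "Phi (tree_basis (abs_utree G)) = 0"
      using Psi_degree[OF _ assms, of G v] by (simp add: tree_poly_abs is_tree_def[of G])
  qed
qed

lemma Phi_eq_0_if_mbar_eq_0:
  assumes "mbar r d x = mbar r d 0" "degree_le d P" "3 \<le> r"
    and "\<And>c i. i < N \<Longrightarrow> (hess_op ^^ (r - 2)) c i = 0"
  shows "Phi x = 0"
proof -
  \<comment> \<open>Since 0 lies in the sum of the two submodules, \<open>x\<close> lies in its own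
    coset, hence in the coset of 0, which is that sum.\<close>
  have "0 \<in> chain_submodule r"
    unfolding chain_submodule_def hull_def gl_submodule_def by (auto simp: TM.subspace_0)
  moreover have "0 \<in> degree_submodule d" unfolding degree_submodule_def by (rule TM.span_zero)
  ultimately have "0 + 0 \<in> chain_submodule r + degree_submodule d" by (rule set_plus_intro)
  then have "x + (0 + 0) \<in> mbar r d x" unfolding mbar_def by (rule set_plus_intro2)
  then have "x \<in> mbar r d 0" using assms(1) by simp
  then obtain y z where "x = y + z" "y \<in> chain_submodule r" "z \<in> degree_submodule d"
    by (auto simp: mbar_def elt_set_plus_def elim: set_plus_elim)
  then show ?thesis
    using chain_submodule_kernel[OF assms(3,4)] degree_submodule_kernel[OF assms(2)]
    by (auto simp: Phi_add subset_iff)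
qed

end

subsection \<open>Labelled trees and the recursion for the weighted tree sums\<close>

lemma image_graph_image_graph: "image_graph f (image_graph g G) = image_graph (f \<circ> g) G"
  by (simp add: image_graph_def image_image)

lemma is_iso_iff_image_graph: "is_iso f G H \<longleftrightarrow> inj_on f (verts G) \<and> image_graph f G = H"
  by (auto simp: is_iso_def image_graph_def bij_betw_def)

lemma verts_image_graph [simp]: "verts (image_graph f G) = f ` verts G"
  by (simp add: image_graph_def)

lemma image_graph_ident:
  assumes "is_graph G" "\<And>x. x \<in> verts G \<Longrightarrow> f x = x"
  shows "image_graph f G = G"
proof -
  have "f ` e = e" if "e \<in> edges G" for e
  proof -
    have "e \<subseteq> verts G" using assms that by (auto simp: is_graph_def)
    then show ?thesis using assms(2) by force
  qed
  then show ?thesis using assms(2) by (intro prod_eqI) (auto simp: image_graph_def)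
qed

text \<open>Trees on a fixed vertex set: counting these replaces the weights 1/|Aut T| by plain
  sums.\<close>

definition ltrees :: "nat set \<Rightarrow> graph set" where
  "ltrees V = {G. is_tree G \<and> verts G = V}"

lemma finite_ltrees: "finite V \<Longrightarrow> finite (ltrees V)"
  by (rule finite_subset[of _ "{V} \<times> Pow (Pow V)"])
    (auto simp: ltrees_def is_tree_def is_graph_def)

lemma ltrees_empty [simp]: "ltrees {} = {}"
  by (auto simp: ltrees_def is_tree_def)

lemma ltrees_singleton: "ltrees {v} = {({v}, {})}"
proof (intro subset_antisym subsetI)
  fix G assume "G \<in> ltrees {v}"
  then have G: "is_graph G" and V: "verts G = {v}" by (auto simp: ltrees_def is_tree_def)
  have False if "e \<in> edges G" for e using is_graph_edgeE[OF G that] V by auto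
  then show "G \<in> {({v}, {})}" using V by (auto simp: prod_eq_iff)
next
  fix G assume "G \<in> {({v}, {} :: nat set set)}"
  then show "G \<in> ltrees {v}"
    by (auto simp: ltrees_def is_graph_def bridges_def intro!: is_treeI[of _ v])
qed

lemma image_graph_ltrees:
  assumes "bij_betw f V W" "G \<in> ltrees V"
  shows "image_graph f G \<in> ltrees W"
  using assms is_tree_image_graph[of G f] by (auto simp: ltrees_def bij_betw_def)

lemma finite_ordered_edges:
  assumes G: "is_graph G"
  shows "finite {(a, b). {a, b} \<in> edges G}"
proof (rule finite_subset[of _ "verts G \<times> verts G"])
  show "{(a, b). {a, b} \<in> edges G} \<subseteq> verts G \<times> verts G" using is_graph_edge[OF G] by blast
  show "finite (verts G \<times> verts G)" using G by (simp add: is_graph_def)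
qed

lemma card_ordered_edges:
  assumes G: "is_graph G"
  shows "card {(a, b). {a, b} \<in> edges G} = 2 * card (edges G)"
proof -
  note fin = finite_ordered_edges[OF G]
  have "card {(a, b). {a, b} \<in> edges G} =
      (\<Sum>e\<in>edges G. \<Sum>x\<in>{x \<in> {(a, b). {a, b} \<in> edges G}. (case x of (a, b) \<Rightarrow> {a, b}) = e}. 1)"
    unfolding card_eq_sum by (subst sum.group) (use fin is_graph_finite_edges[OF G] in auto)
  also have "\<dots> = (\<Sum>e\<in>edges G. 2)"
  proof (rule sum.cong[OF refl])
    fix e assume e: "e \<in> edges G"
    then obtain u v where uv: "e = {u, v}" "u \<noteq> v" using is_graph_edgeE[OF G] by metis
    then have "{x \<in> {(a, b). {a, b} \<in> edges G}. (case x of (a, b) \<Rightarrow> {a, b}) = e} = {(u, v), (v, u)}"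
      using e by (auto simp: doubleton_eq_iff insert_commute)
    then show "(\<Sum>x\<in>{x \<in> {(a, b). {a, b} \<in> edges G}. (case x of (a, b) \<Rightarrow> {a, b}) = e}. 1) = (2::nat)"
      using uv by simp
  qed
  finally show ?thesis by simp
qed

lemma order_tree_abs:
  assumes "is_tree G"
  shows "order_tree (abs_utree G) = card (verts G)"
proof -
  obtain f where "is_iso f (rep_utree (abs_utree G)) G" using rep_abs_utree[OF assms] .
  then show ?thesis by (auto simp: order_tree_def is_iso_def bij_betw_same_card)
qed

text \<open>Orbit counting for the action of the permutations of the vertices.\<close>

lemma card_labellings_of_tree:
  "card {G \<in> ltrees {..<order_tree T}. abs_utree G = T} * aut_count T = fact (order_tree T)"
proof -
  define H where "H = rep_utree T"
  define m where "m = order_tree T"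
  let ?V = "verts H"
  let ?S = "{\<pi>. \<pi> permutes ?V}" and ?O = "{G \<in> ltrees {..<m}. abs_utree G = T}"
  have tH: "is_tree H" unfolding H_def by (rule rep_utree_tree)
  have gH: "is_graph H" using tH by (simp add: is_tree_def)
  have fin: "finite ?V" using gH by (simp add: is_graph_def)
  have m: "card ?V = m" by (simp add: m_def order_tree_def H_def)
  \<comment> \<open>\<open>f\<close> fixes one numbering of the vertices of the representative; all
    others arise by permuting the vertices first.\<close>
  obtain f where f: "bij_betw f ?V {..<m}"
    using ex_bij_betw_finite_nat[OF fin] m by (auto simp: lessThan_atLeast0)
  have bij: "bij_betw (f \<circ> \<pi>) ?V {..<m}" if "\<pi> permutes ?V" for \<pi>
    using permutes_imp_bij[OF that] f by (rule bij_betw_trans)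
  define act where "act \<pi> = image_graph (f \<circ> \<pi>) H" for \<pi>
  have act: "act \<pi> \<in> ?O" if "\<pi> \<in> ?S" for \<pi>
  proof -
    have b: "bij_betw (f \<circ> \<pi>) ?V {..<m}" using bij that by simp
    then have "act \<pi> \<in> ltrees {..<m}"
      unfolding act_def using tH by (intro image_graph_ltrees) (auto simp: ltrees_def)
    moreover have "abs_utree H = abs_utree (act \<pi>)"
      by (rule abs_utree_eqI[OF tH, of "f \<circ> \<pi>"])
        (use b in \<open>auto simp: act_def is_iso_iff_image_graph bij_betw_def\<close>)
    ultimately show ?thesis by (simp add: H_def abs_rep_utree)
  qed
  have fib: "card {\<pi> \<in> ?S. act \<pi> = G} = card (automorphisms H)" if G: "G \<in> ?O" for G
  proof -
    have "tree_iso H G"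
      using G tH is_iso_id[of G] is_iso_id[of H] Quotient3_rel[OF Quotient3_utree, of H G]
      unfolding tree_iso_def by (auto simp: ltrees_def H_def abs_rep_utree)
    then obtain g where g: "is_iso g H G" by (auto simp: tree_iso_def)
    then have bg: "bij_betw g ?V {..<m}" using G by (auto simp: is_iso_def ltrees_def)
    define \<pi> where "\<pi> x = (if x \<in> ?V then the_inv_into ?V f (g x) else x)" for x
    have "bij_betw (the_inv_into ?V f \<circ> g) ?V ?V"
      using bg bij_betw_the_inv_into[OF f] by (rule bij_betw_trans)
    then have "bij_betw \<pi> ?V ?V" by (rule bij_betw_cong[THEN iffD1, rotated]) (simp add: \<pi>_def)
    then have \<pi>: "\<pi> permutes ?V" by (rule bij_imp_permutes) (simp add: \<pi>_def)
    have f\<pi>: "f (\<pi> x) = g x" if "x \<in> ?V" for x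
    proof -
      have "g x \<in> f ` ?V" using that bg f by (auto simp: bij_betw_def)
      then show ?thesis using f that f_the_inv_into_f[of f ?V "g x"] by (simp add: \<pi>_def bij_betw_def)
    qed
    have "image_graph (f \<circ> \<pi>) H = image_graph g H"
    proof -
      have "(f \<circ> \<pi>) ` e = g ` e" if "e \<in> edges H" for e
        using gH that f\<pi> by (intro image_cong) (auto simp: is_graph_def)
      moreover have "(f \<circ> \<pi>) ` ?V = g ` ?V" using f\<pi> by (intro image_cong) auto
      ultimately show ?thesis by (simp add: image_graph_def)
    qed
    then have act\<pi>: "act \<pi> = G" using g by (simp add: act_def is_iso_iff_image_graph)
    \<comment> \<open>The fibre over \<open>G\<close> is the translate by \<pi> of the automorphism
      group, so all fibres have the same size.\<close>
    have "bij_betw (\<lambda>\<sigma>. \<pi> \<circ> \<sigma>) (automorphisms H) {\<pi> \<in> ?S. act \<pi> = G}"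
    proof (rule bij_betw_byWitness[of _ "\<lambda>\<rho>. inv_into UNIV \<pi> \<circ> \<rho>"])
      show "\<forall>\<sigma>\<in>automorphisms H. inv_into UNIV \<pi> \<circ> (\<pi> \<circ> \<sigma>) = \<sigma>"
        using permutes_inv_o[OF \<pi>] by (simp add: comp_assoc[symmetric])
      show "\<forall>\<rho>\<in>{\<pi> \<in> ?S. act \<pi> = G}. \<pi> \<circ> (inv_into UNIV \<pi> \<circ> \<rho>) = \<rho>"
        using permutes_inv_o[OF \<pi>] by (simp add: comp_assoc[symmetric])
      show "(\<lambda>\<sigma>. \<pi> \<circ> \<sigma>) ` automorphisms H \<subseteq> {\<pi> \<in> ?S. act \<pi> = G}"
      proof (rule image_subsetI)
        fix \<sigma> assume "\<sigma> \<in> automorphisms H"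
        then have \<sigma>: "\<sigma> permutes ?V" "image_graph \<sigma> H = H"
          by (auto simp: automorphisms_def is_iso_iff_image_graph)
        have "act (\<pi> \<circ> \<sigma>) = image_graph (f \<circ> \<pi>) (image_graph \<sigma> H)"
          by (simp add: act_def image_graph_image_graph comp_assoc)
        also have "\<dots> = G" using \<sigma>(2) act\<pi> by (simp add: act_def)
        finally show "\<pi> \<circ> \<sigma> \<in> {\<pi> \<in> ?S. act \<pi> = G}"
          using permutes_compose[OF \<sigma>(1) \<pi>] by simp
      qed
      show "(\<lambda>\<rho>. inv_into UNIV \<pi> \<circ> \<rho>) ` {\<pi> \<in> ?S. act \<pi> = G} \<subseteq> automorphisms H"
      proof (rule image_subsetI)
        fix \<rho> assume "\<rho> \<in> {\<pi> \<in> ?S. act \<pi> = G}"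
        then have \<rho>: "\<rho> permutes ?V" and G': "G = act \<rho>" by auto
        let ?\<sigma> = "inv_into UNIV \<pi> \<circ> \<rho>"
        have \<sigma>: "?\<sigma> permutes ?V" using permutes_compose[OF \<rho> permutes_inv[OF \<pi>]] .
        have inj: "inj_on (f \<circ> \<pi>) ?V" using bij[OF \<pi>] by (simp add: bij_betw_def)
        let ?h = "the_inv_into ?V (f \<circ> \<pi>)"
        have cancel: "image_graph ?h (image_graph (f \<circ> \<pi>) K) = K" if "is_graph K" "verts K = ?V" for K
          unfolding image_graph_image_graph
          by (rule image_graph_ident[OF that(1)]) (use the_inv_into_f_f[OF inj] that in auto)
        have "(f \<circ> \<pi>) \<circ> ?\<sigma> = f \<circ> (\<pi> \<circ> inv_into UNIV \<pi>) \<circ> \<rho>" by (simp add: comp_assoc)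
        also have "\<dots> = f \<circ> \<rho>" using permutes_inv_o[OF \<pi>] by simp
        finally have "image_graph (f \<circ> \<pi>) (image_graph ?\<sigma> H) = image_graph (f \<circ> \<pi>) H"
          using G' act\<pi> by (simp add: act_def image_graph_image_graph)
        then have "image_graph ?h (image_graph (f \<circ> \<pi>) (image_graph ?\<sigma> H)) =
            image_graph ?h (image_graph (f \<circ> \<pi>) H)" by simp
        moreover have "is_graph (image_graph ?\<sigma> H)" "verts (image_graph ?\<sigma> H) = ?V"
          using is_graph_iso[OF gH is_iso_image_graph] permutes_inj_on[OF \<sigma>] permutes_image[OF \<sigma>]
          by auto
        ultimately have "image_graph ?\<sigma> H = H" using cancel[of H] cancel[of "image_graph ?\<sigma> H"] gH by simp
        then show "?\<sigma> \<in> automorphisms H"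
          using \<sigma> permutes_inj_on[OF \<sigma>] by (simp add: automorphisms_def is_iso_iff_image_graph)
      qed
    qed
    then show ?thesis by (simp add: bij_betw_same_card)
  qed
  have "fact m = card ?S" using card_permutations[OF m fin] by simp
  also have "\<dots> = (\<Sum>G\<in>?O. \<Sum>\<pi>\<in>{\<pi> \<in> ?S. act \<pi> = G}. 1)"
    unfolding card_eq_sum
    by (rule sum.group[symmetric]) (use finite_permutations[OF fin] finite_ltrees act in auto)
  also have "\<dots> = card ?O * aut_count T" using fib by (simp add: aut_count_def H_def)
  finally show ?thesis by (simp add: m_def)
qed

text \<open>The number of labelled representatives divides a factorial, so it is not 0 and every
  class is represented on the standard vertex set.\<close>

lemma order_tree_set: "{T. order_tree T = m} = abs_utree ` ltrees {..<m}"
proof (intro subset_antisym subsetI)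
  fix T assume "T \<in> {T. order_tree T = m}"
  then have "card {G \<in> ltrees {..<m}. abs_utree G = T} * aut_count T = fact m"
    using card_labellings_of_tree[of T] by simp
  then have "card {G \<in> ltrees {..<m}. abs_utree G = T} \<noteq> 0"
    using fact_nonzero[of m, where ?'a = nat] by (intro notI) simp
  then have "{G \<in> ltrees {..<m}. abs_utree G = T} \<noteq> {}" by (metis card.empty)
  then obtain G where "G \<in> ltrees {..<m}" "abs_utree G = T" by blast
  then show "T \<in> abs_utree ` ltrees {..<m}" by (intro image_eqI[of _ _ G]) simp_all
next
  fix T assume "T \<in> abs_utree ` ltrees {..<m}"
  then obtain G where "T = abs_utree G" "is_tree G" "verts G = {..<m}"
    unfolding ltrees_def by blast
  then show "T \<in> {T. order_tree T = m}" by (simp add: order_tree_abs)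
qed

lemma sum_Pow_card:
  assumes "finite V"
  shows "(\<Sum>A\<in>Pow V. g (card A)) = (\<Sum>k\<le>card V. of_nat (card V choose k) * (g k :: 'a::comm_ring_1))"
proof -
  have "(\<Sum>A\<in>Pow V. g (card A)) = (\<Sum>k\<le>card V. \<Sum>A\<in>{A \<in> Pow V. card A = k}. g (card A))"
    by (rule sum.group[symmetric]) (use assms card_mono in auto)
  also have "\<dots> = (\<Sum>k\<le>card V. of_nat (card V choose k) * g k)"
    using n_subsets[OF assms] by (intro sum.cong refl) (simp add: Pow_def)
  finally show ?thesis .
qed

lemma of_nat_cpoly_cancel:
  assumes "of_nat k * p = of_nat k * (q :: cpoly)" "k \<noteq> 0"
  shows "p = q"
proof -
  have "const_poly (1 / of_nat k) * (of_nat k * p) = const_poly (1 / of_nat k) * (of_nat k * q)"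
    using assms by simp
  then show ?thesis
    using assms(2) by (simp add: const_poly_of_nat[symmetric] mult.assoc[symmetric] const_poly_mult[symmetric])
qed

section \<open>Sums over labelled trees\<close>

context potential
begin

text \<open>Up to the factor m! this is the image of \<open>nu m\<close> when \<open>V\<close> has m
  elements, with the automorphism groups gone.\<close>

definition lsum :: "nat set \<Rightarrow> cpoly" where
  "lsum V = (\<Sum>G\<in>ltrees V. Psi G zero_legs)"

lemma lsum_bij:
  assumes f: "bij_betw f V W"
  shows "lsum V = lsum W"
proof -
  have inj: "inj_on f V" using f by (simp add: bij_betw_def)
  have b: "bij_betw (the_inv_into V f) W V" using bij_betw_the_inv_into[OF f] .
  show ?thesis
    unfolding lsum_def
  proof (rule sum.reindex_bij_witness[of _ "image_graph (the_inv_into V f)" "image_graph f"])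
    fix G assume G: "G \<in> ltrees V"
    then have g: "is_graph G" "verts G = V" by (auto simp: ltrees_def is_tree_def)
    show "image_graph (the_inv_into V f) (image_graph f G) = G"
      unfolding image_graph_image_graph
      by (rule image_graph_ident) (use g the_inv_into_f_f[OF inj] in auto)
    show "image_graph f G \<in> ltrees W" by (rule image_graph_ltrees[OF f G])
    show "Psi (image_graph f G) zero_legs = Psi G zero_legs"
      using Psi_iso[OF g(1) is_iso_image_graph] inj g by (simp add: comp_def)
  next
    fix G assume G: "G \<in> ltrees W"
    then have g: "is_graph G" "verts G = W" by (auto simp: ltrees_def is_tree_def)
    have "f (the_inv_into V f x) = x" if "x \<in> W" for x
      using f_the_inv_into_f[OF inj] that f by (auto simp: bij_betw_def)
    then show "image_graph f (image_graph (the_inv_into V f) G) = G"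
      unfolding image_graph_image_graph by (intro image_graph_ident) (use g in auto)
    show "image_graph (the_inv_into V f) G \<in> ltrees V" by (rule image_graph_ltrees[OF b G])
  qed
qed

lemma lsum_card: "finite V \<Longrightarrow> lsum V = lsum {..<card V}"
  using ex_bij_betw_finite_nat[of V] lsum_bij by (auto simp: lessThan_atLeast0)

text \<open>Deleting an edge of a labelled tree leaves two labelled trees, each with a distinguished
  vertex.\<close>

lemma lsum_recursion:
  assumes fin: "finite V"
  shows "of_nat (2 * (card V - 1)) * lsum V =
    (\<Sum>A\<in>Pow V. \<Sum>i<N. partial_deriv i (lsum A) * partial_deriv i (lsum (V - A)))"
proof -
  let ?X = "SIGMA G:ltrees V. {(a, b). {a, b} \<in> edges G}"
  let ?Y = "SIGMA A:Pow V. SIGMA G:ltrees A. SIGMA H:ltrees (V - A). A \<times> (V - A)"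
  have fin_pairs: "finite {(a, b). {a, b} \<in> edges G}" if "G \<in> ltrees V" for G
    using that finite_ordered_edges by (auto simp: ltrees_def is_tree_def)
  \<comment> \<open>A tree on \<open>V\<close> has \<open>card V - 1\<close> edges, each with two
    orientations; orienting the edge orders the two pieces.\<close>
  have "of_nat (2 * (card V - 1)) * lsum V =
      (\<Sum>G\<in>ltrees V. \<Sum>(a, b)\<in>{(a, b). {a, b} \<in> edges G}. Psi G zero_legs)"
    unfolding lsum_def sum_distrib_left
  proof (rule sum.cong[OF refl])
    fix G assume "G \<in> ltrees V"
    then have tG: "is_tree G" and V: "verts G = V" by (auto simp: ltrees_def)
    have "card V - 1 = card (edges G)" using card_edges_tree[OF tG] V by simp
    then have "of_nat (2 * (card V - 1)) * Psi G zero_legs =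
        of_nat (card {(a, b). {a, b} \<in> edges G}) * Psi G zero_legs"
      using card_ordered_edges tG by (simp add: is_tree_def)
    then show "of_nat (2 * (card V - 1)) * Psi G zero_legs =
        (\<Sum>(a, b)\<in>{(a, b). {a, b} \<in> edges G}. Psi G zero_legs)"
      by (simp add: case_prod_beta)
  qed
  also have "\<dots> = (\<Sum>(G, a, b)\<in>?X. Psi G zero_legs)"
    using fin_pairs finite_ltrees[OF fin] by (subst sum.Sigma) (auto simp: case_prod_beta)
  \<comment> \<open>The two directions of the bijection are \<open>tree_split\<close> and
    \<open>side_join\<close>.\<close>
  also have "\<dots> = (\<Sum>(A, G, H, a, b)\<in>?Y. Psi (join_graph G H a b) zero_legs)"
  proof (rule sum.reindex_bij_witness[of _ "\<lambda>(A, G, H, a, b). (join_graph G H a b, a, b)"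
        "\<lambda>(G, a, b). (verts (side G a b), side G a b, side G b a, a, b)"])
    fix x assume "x \<in> ?X"
    then obtain G a b where x: "x = (G, a, b)" and tG: "is_tree G" and V: "verts G = V"
      and ab: "{a, b} \<in> edges G" by (auto simp: ltrees_def)
    have ba: "{b, a} \<in> edges G" using ab by (simp add: insert_commute)
    note A = is_tree_side[OF tG ab] and B = is_tree_side[OF tG ba] and sp = tree_split[OF tG ab]
    show "(case case x of (G, a, b) \<Rightarrow> (verts (side G a b), side G a b, side G b a, a, b) of
        (A, G, H, a, b) \<Rightarrow> (join_graph G H a b, a, b)) = x"
      using sp(1) x by simp
    show "(case x of (G, a, b) \<Rightarrow> (verts (side G a b), side G a b, side G b a, a, b)) \<in> ?Y"
      using A B sp(3) V x by (auto simp: ltrees_def)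
    show "(case case x of (G, a, b) \<Rightarrow> (verts (side G a b), side G a b, side G b a, a, b) of
        (A, G, H, a, b) \<Rightarrow> Psi (join_graph G H a b) zero_legs) = (case x of (G, a, b) \<Rightarrow> Psi G zero_legs)"
      using sp(1) x by simp
  next
    fix y assume "y \<in> ?Y"
    then obtain A G H a b where y: "y = (A, G, H, a, b)" "A \<subseteq> V" and tG: "is_tree G" "verts G = A"
      and tH: "is_tree H" "verts H = V - A" and ab: "a \<in> A" "b \<in> V - A" by (auto simp: ltrees_def)
    have d: "verts G \<inter> verts H = {}" "verts H \<inter> verts G = {}" using tG tH by auto
    have "side (join_graph G H a b) a b = G"
      by (rule side_join[OF tG(1) tH(1) d(1)]) (use ab tG tH in auto)
    moreover have "side (join_graph G H a b) b a = H"
      unfolding join_commute[of G H] by (rule side_join[OF tH(1) tG(1) d(2)]) (use ab tG tH in auto)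
    ultimately show "(case case y of (A, G, H, a, b) \<Rightarrow> (join_graph G H a b, a, b) of
        (G, a, b) \<Rightarrow> (verts (side G a b), side G a b, side G b a, a, b)) = y"
      using y tG by simp
    have "is_tree (join_graph G H a b)"
      by (rule is_tree_join[OF tG(1) tH(1) d(1)]) (use ab tG tH in auto)
    then show "(case y of (A, G, H, a, b) \<Rightarrow> (join_graph G H a b, a, b)) \<in> ?X"
      using y tG tH by (auto simp: ltrees_def join_graph_def)
  qed
  also have "\<dots> = (\<Sum>A\<in>Pow V. \<Sum>G\<in>ltrees A. \<Sum>H\<in>ltrees (V - A). \<Sum>a\<in>A. \<Sum>b\<in>V - A.
      Psi (join_graph G H a b) zero_legs)"
  proof -
    have f: "finite (ltrees A)" "finite (ltrees (V - A))" "finite A" "finite (V - A)" if "A \<subseteq> V" for A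
      using that fin finite_ltrees finite_subset by auto
    show ?thesis
      using fin f by (simp add: sum.Sigma sum.cartesian_product case_prod_beta)
  qed
  also have "\<dots> = (\<Sum>A\<in>Pow V. \<Sum>i<N. partial_deriv i (lsum A) * partial_deriv i (lsum (V - A)))"
  proof (rule sum.cong[OF refl])
    fix A assume "A \<in> Pow V"
    then have fA: "finite A" "finite (V - A)" using fin finite_subset by auto
    \<comment> \<open>For fixed pieces, the free choice of the end \<open>a\<close> is the sum over
      vertices in \<open>partial_deriv_Psi\<close>, and likewise for \<open>b\<close>.\<close>
    have "(\<Sum>a\<in>A. \<Sum>b\<in>V - A. Psi (join_graph G H a b) zero_legs) =
        (\<Sum>i<N. partial_deriv i (Psi G zero_legs) * partial_deriv i (Psi H zero_legs))"
      if G: "G \<in> ltrees A" and H: "H \<in> ltrees (V - A)" for G H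
    proof -
      have g: "is_graph G" "is_graph H" "verts G = A" "verts H = V - A"
        using G H by (auto simp: ltrees_def is_tree_def)
      have "(\<Sum>a\<in>A. \<Sum>b\<in>V - A. Psi (join_graph G H a b) zero_legs) =
          (\<Sum>a\<in>A. \<Sum>b\<in>V - A. \<Sum>i<N. Psi G (leg a i) * Psi H (leg b i))"
        using g by (intro sum.cong refl) (auto simp: Psi_join)
      also have "\<dots> = (\<Sum>i<N. \<Sum>a\<in>A. \<Sum>b\<in>V - A. Psi G (leg a i) * Psi H (leg b i))"
        by (rule sum_rotate)
      also have "\<dots> = (\<Sum>i<N. partial_deriv i (Psi G zero_legs) * partial_deriv i (Psi H zero_legs))"
        using fA g by (simp add: partial_deriv_Psi sum_product)
      finally show ?thesis .
    qed
    note * = this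
    have "(\<Sum>G\<in>ltrees A. \<Sum>H\<in>ltrees (V - A). \<Sum>a\<in>A. \<Sum>b\<in>V - A. Psi (join_graph G H a b) zero_legs) =
        (\<Sum>G\<in>ltrees A. \<Sum>H\<in>ltrees (V - A). \<Sum>i<N.
          partial_deriv i (Psi G zero_legs) * partial_deriv i (Psi H zero_legs))"
      by (rule sum.cong[OF refl], rule sum.cong[OF refl]) (rule *)
    also have "\<dots> = (\<Sum>i<N. \<Sum>G\<in>ltrees A. \<Sum>H\<in>ltrees (V - A).
          partial_deriv i (Psi G zero_legs) * partial_deriv i (Psi H zero_legs))"
      by (rule sum_rotate)
    also have "\<dots> = (\<Sum>i<N. partial_deriv i (lsum A) * partial_deriv i (lsum (V - A)))"
      by (simp add: lsum_def partial_deriv_sum sum_product)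
    finally show "(\<Sum>G\<in>ltrees A. \<Sum>H\<in>ltrees (V - A). \<Sum>a\<in>A. \<Sum>b\<in>V - A.
        Psi (join_graph G H a b) zero_legs) =
        (\<Sum>i<N. partial_deriv i (lsum A) * partial_deriv i (lsum (V - A)))" .
  qed
  finally show ?thesis .
qed

text \<open>By orbit counting a class \<open>T\<close> is hit by m!/|Aut T| labelled trees, which is
  m! times its coefficient in \<open>nu m\<close>.\<close>

lemma lsum_eq_Phi_nu: "lsum {..<m} = of_nat (fact m) * Phi (nu m)"
proof -
  have "lsum {..<m} = (\<Sum>G\<in>ltrees {..<m}. tree_poly (abs_utree G))"
    unfolding lsum_def by (intro sum.cong refl) (auto simp: ltrees_def tree_poly_abs)
  also have "\<dots> = (\<Sum>T | order_tree T = m. \<Sum>G\<in>{G \<in> ltrees {..<m}. abs_utree G = T}.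
      tree_poly (abs_utree G))"
    by (rule sum.group[symmetric]) (auto simp: order_tree_set finite_ltrees)
  also have "\<dots> = (\<Sum>T | order_tree T = m. of_nat (fact m) * (rat_poly (1 / of_nat (aut_count T)) * tree_poly T))"
  proof (rule sum.cong[OF refl])
    fix T assume "T \<in> {T. order_tree T = m}"
    then have c: "card {G \<in> ltrees {..<m}. abs_utree G = T} * aut_count T = fact m"
      using card_labellings_of_tree[of T] by simp
    then have nz: "aut_count T \<noteq> 0" by (metis fact_nonzero mult_0_right)
    have "of_nat (card {G \<in> ltrees {..<m}. abs_utree G = T}) =
        (of_nat (fact m) * of_rat (1 / of_nat (aut_count T)) :: complex)"
      using nz by (simp add: c[symmetric] of_rat_divide)
    then have "const_poly (of_nat (card {G \<in> ltrees {..<m}. abs_utree G = T})) =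
        of_nat (fact m) * rat_poly (1 / of_nat (aut_count T))"
      by (simp only: const_poly_mult const_poly_of_nat)
    then show "(\<Sum>G\<in>{G \<in> ltrees {..<m}. abs_utree G = T}. tree_poly (abs_utree G)) =
        of_nat (fact m) * (rat_poly (1 / of_nat (aut_count T)) * tree_poly T)"
      by (simp add: const_poly_of_nat mult.assoc)
  qed
  also have "\<dots> = of_nat (fact m) * Phi (nu m)"
    by (simp add: nu_def Phi_sum Phi_tscale sum_distrib_left)
  finally show ?thesis .
qed

lemma Phi_nu_0: "Phi (nu 0) = 0"
  using lsum_eq_Phi_nu[of 0] by (simp add: lsum_def)

lemma Phi_nu_1: "Phi (nu 1) = P"
  using lsum_eq_Phi_nu[of 1] by (simp add: lsum_def lessThan_Suc ltrees_singleton Psi_singleton)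

text \<open>This is \<open>lsum_recursion\<close> divided by m!: the binomial coefficient counting
  vertex sets of size k is absorbed by the factorials belonging to the two pieces.\<close>

lemma Phi_nu_recursion:
  "of_nat (2 * (m - 1)) * Phi (nu m) =
     (\<Sum>k\<le>m. \<Sum>i<N. partial_deriv i (Phi (nu k)) * partial_deriv i (Phi (nu (m - k))))"
proof (rule of_nat_cpoly_cancel[of "fact m"])
  let ?D = "\<lambda>k. \<Sum>i<N. partial_deriv i (lsum {..<k}) * partial_deriv i (lsum {..<m - k})"
  have "of_nat (fact m) * (of_nat (2 * (m - 1)) * Phi (nu m)) = of_nat (2 * (m - 1)) * lsum {..<m}"
    by (simp add: lsum_eq_Phi_nu mult.left_commute)
  also have "\<dots> = (\<Sum>A\<in>Pow {..<m}. \<Sum>i<N. partial_deriv i (lsum A) * partial_deriv i (lsum ({..<m} - A)))"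
    using lsum_recursion[of "{..<m}"] by simp
  also have "\<dots> = (\<Sum>A\<in>Pow {..<m}. ?D (card A))"
  proof (rule sum.cong[OF refl])
    fix A assume "A \<in> Pow {..<m}"
    then have A: "A \<subseteq> {..<m}" by simp
    then have "finite A" using finite_subset by blast
    moreover from this have "card ({..<m} - A) = m - card A" using card_Diff_subset[OF _ A] by simp
    ultimately show "(\<Sum>i<N. partial_deriv i (lsum A) * partial_deriv i (lsum ({..<m} - A))) = ?D (card A)"
      using lsum_card[of A] lsum_card[of "{..<m} - A"] by simp
  qed
  also have "\<dots> = (\<Sum>k\<le>m. of_nat (m choose k) * ?D k)"
    using sum_Pow_card[of "{..<m}" ?D] by simp
  also have "\<dots> = (\<Sum>k\<le>m. of_nat (fact m) *
      (\<Sum>i<N. partial_deriv i (Phi (nu k)) * partial_deriv i (Phi (nu (m - k)))))"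
  proof (rule sum.cong[OF refl])
    fix k assume "k \<in> {..m}"
    then have "fact m = (m choose k) * fact k * fact (m - k)"
      using binomial_fact_lemma[of k m] by (simp add: mult_ac)
    then have "of_nat (fact m) = (of_nat (m choose k) * of_nat (fact k) * of_nat (fact (m - k)) :: cpoly)"
      by (simp only: of_nat_mult)
    then show "of_nat (m choose k) * ?D k = of_nat (fact m) *
        (\<Sum>i<N. partial_deriv i (Phi (nu k)) * partial_deriv i (Phi (nu (m - k))))"
      by (simp add: lsum_eq_Phi_nu partial_deriv_mult sum_distrib_left mult_ac del: of_nat_fact)
  qed
  finally show "of_nat (fact m) * (of_nat (2 * (m - 1)) * Phi (nu m)) = of_nat (fact m) *
      (\<Sum>k\<le>m. \<Sum>i<N. partial_deriv i (Phi (nu k)) * partial_deriv i (Phi (nu (m - k))))"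
    by (simp add: sum_distrib_left)
qed simp

lemma polys_tree_poly: "P \<in> polys n \<Longrightarrow> tree_poly T \<in> polys n"
  unfolding tree_poly_def by (rule polys_Psi)

lemma polys_Phi: "P \<in> polys n \<Longrightarrow> Phi x \<in> polys n"
  unfolding Phi_def by (intro polys_sum polys_mult polys_const polys_tree_poly)

text \<open>For \<open>m > 2M\<close> one of the two factors in each term of the recursion has an index
  between \<open>M + 1\<close> and \<open>m - 1\<close>.\<close>

lemma Phi_nu_gap:
  assumes "0 < M" "\<And>m. M + 1 \<le> m \<Longrightarrow> m \<le> 2 * M \<Longrightarrow> Phi (nu m) = 0"
  shows "M + 1 \<le> m \<Longrightarrow> Phi (nu m) = 0"
proof (induction m rule: less_induct)
  case (less m)
  show ?case
  proof (cases "m \<le> 2 * M")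
    case False
    have *: "partial_deriv i (Phi (nu k)) * partial_deriv i (Phi (nu (m - k))) = 0" if k: "k \<le> m" for i k
    proof -
      consider "k = 0" | "k = m" | "M + 1 \<le> k" "k < m" | "M + 1 \<le> m - k" "m - k < m"
        using k False by linarith
      then show ?thesis
        by cases (use less.IH in \<open>auto simp: Phi_nu_0\<close>)
    qed
    have "of_nat (2 * (m - 1)) * Phi (nu m) = of_nat (2 * (m - 1)) * 0"
      unfolding Phi_nu_recursion mult_zero_right by (intro sum.neutral ballI *) simp
    then show ?thesis by (rule of_nat_cpoly_cancel) (use False assms(1) in simp)
  qed (use less assms in auto)
qed

end

subsection \<open>Inversion of gradient maps\<close>

text \<open>Divisibility by the k-th power of the variable with index \<open>N\<close>, that is, the
  t-adic filtration.\<close>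

definition ord_ge :: "nat \<Rightarrow> nat \<Rightarrow> cpoly \<Rightarrow> bool" where
  "ord_ge N k p \<longleftrightarrow> (\<forall>a\<in>keys p. k \<le> lookup a N)"

lemma ord_ge_0 [simp]: "ord_ge N k 0"
  by (simp add: ord_ge_def)

lemma ord_ge_add: "ord_ge N k p \<Longrightarrow> ord_ge N k q \<Longrightarrow> ord_ge N k (p + q)"
  using keys_add[of p q] by (auto simp: ord_ge_def)

lemma ord_ge_uminus: "ord_ge N k p \<Longrightarrow> ord_ge N k (- p)"
  by (auto simp: ord_ge_def in_keys_iff)

lemma ord_ge_diff: "ord_ge N k p \<Longrightarrow> ord_ge N k q \<Longrightarrow> ord_ge N k (p - q)"
  using ord_ge_add[of N k p "- q"] ord_ge_uminus by simp

lemma ord_ge_sum: "(\<And>x. x \<in> A \<Longrightarrow> ord_ge N k (f x)) \<Longrightarrow> ord_ge N k (\<Sum>x\<in>A. f x)"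
  by (induction A rule: infinite_finite_induct) (auto intro: ord_ge_add)

lemma ord_ge_mult:
  assumes "ord_ge N k p"
  shows "ord_ge N k (p * r)"
  unfolding ord_ge_def
proof
  fix c assume c: "c \<in> keys (p * r)"
  obtain a b where "c = a + b" "a \<in> keys p" using keys_mult[of p r] c by blast
  then show "k \<le> lookup c N" using assms by (auto simp: ord_ge_def lookup_add)
qed

lemma ord_ge_pvar_mult: "ord_ge N 1 (pvar N * p)"
  by (rule ord_ge_mult) (auto simp: ord_ge_def pvar_def)

lemma ord_ge_all_imp_0:
  assumes "\<And>k. ord_ge N k p"
  shows "p = 0"
proof (rule ccontr)
  assume "p \<noteq> 0"
  then obtain a where "a \<in> keys p" by (metis keys_eq_empty all_not_in_conv)
  then show False using assms[of "Suc (lookup a N)"] by (auto simp: ord_ge_def)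
qed

text \<open>In characteristic 0 the derivative in t kills only the terms free of t, which the first
  assumption excludes, and lowers the order of every other term by one.\<close>

lemma ord_ge_Suc:
  assumes "ord_ge N 1 p" "ord_ge N k (partial_deriv N p)"
  shows "ord_ge N (Suc k) p"
  unfolding ord_ge_def
proof
  fix a assume a: "a \<in> keys p"
  then have pos: "1 \<le> lookup a N" using assms(1) by (auto simp: ord_ge_def)
  then have eq: "a - single N 1 + single N 1 = a"
    by (intro poly_mapping_eqI) (auto simp: lookup_add lookup_minus lookup_single when_def)
  have "lookup (partial_deriv N p) (a - single N 1) = of_nat (lookup a N) * lookup p a"
    unfolding lookup_partial_deriv eq using pos by (simp add: lookup_minus)
  then have "a - single N 1 \<in> keys (partial_deriv N p)" using a pos by (auto simp: in_keys_iff)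
  then have "k \<le> lookup (a - single N 1) N" using assms(2) unfolding ord_ge_def by blast
  then show "Suc k \<le> lookup a N" using pos by (simp add: lookup_minus)
qed

lemma ord_ge_partial_deriv:
  assumes "ord_ge N k p" "j \<noteq> N"
  shows "ord_ge N k (partial_deriv j p)"
  unfolding ord_ge_def
proof
  fix b assume "b \<in> keys (partial_deriv j p)"
  then have "b + single j 1 \<in> keys p" by (auto simp: in_keys_iff lookup_partial_deriv)
  then have "k \<le> lookup (b + single j 1) N" using assms(1) unfolding ord_ge_def by blast
  then show "k \<le> lookup b N" using assms(2) by (simp add: lookup_add lookup_single)
qed

text \<open>Uniqueness for a formal initial value problem: \<open>w\<close> vanishes at t = 0, and
  an order bound for \<open>w\<close> carries over to its derivative in t, so the order can be
  raised forever. A polynomial of infinite order is 0.\<close>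

lemma transport_zero:
  assumes ord: "\<And>i. i < N \<Longrightarrow> ord_ge N 1 (w i)"
    and step: "\<And>k i. (\<And>j. j < N \<Longrightarrow> ord_ge N k (w j)) \<Longrightarrow> i < N \<Longrightarrow> ord_ge N k (partial_deriv N (w i))"
    and "i < N"
  shows "w i = 0"
proof (rule ord_ge_all_imp_0)
  fix k
  have "\<forall>i<N. ord_ge N k (w i)"
  proof (induction k)
    case 0
    show ?case by (simp add: ord_ge_def)
  next
    case (Suc k)
    then show ?case using ord_ge_Suc[OF ord step] by blast
  qed
  then show "ord_ge N k (w i)" using \<open>i < N\<close> by blast
qed

text \<open>A substitution that is the identity at t = 0 changes every polynomial by a multiple of t
  only.\<close>

lemma ord_ge_psubst_diff:
  assumes "\<And>j. ord_ge N 1 (s j - pvar j)"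
  shows "ord_ge N 1 (psubst s p - p)"
proof (induction p rule: cpoly_induct)
  case (add p q)
  have *: "psubst s (p + q) - (p + q) = (psubst s p - p) + (psubst s q - q)" by (simp add: psubst_simps)
  show ?case unfolding * by (rule ord_ge_add[OF add])
next
  case (mult p q)
  have "psubst s (p * q) - p * q = (psubst s p - p) * psubst s q + (psubst s q - q) * p"
    by (simp add: psubst_simps algebra_simps)
  then show ?case using mult ord_ge_add ord_ge_mult by simp
qed (use assms in simp_all)

lemma partial_deriv_power: "partial_deriv i (p ^ k) = of_nat k * p ^ (k - 1) * partial_deriv i p"
proof (induction k)
  case (Suc k)
  then show ?case by (cases k) (auto simp: partial_deriv_mult algebra_simps)
qed simp

text \<open>\<open>q\<close> is the sequence of coefficients of a polynomial solution \<open>Q = \<Sum>\<^sub>m t^(m-1) q\<^sub>m\<close> of the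
  Hamilton--Jacobi equation \<open>2 \<partial>\<^sub>t Q = \<Sum>\<^sub>i (\<partial>\<^sub>i Q)^2\<close> with initial value \<open>P\<close>; the time \<open>t\<close> is the
  variable with index \<^term>\<open>N\<close>.\<close>

locale hamilton_jacobi =
  fixes N K :: nat and P :: cpoly and q :: "nat \<Rightarrow> cpoly"
  assumes q_polys: "q m \<in> polys N" and q_0: "q 0 = 0" and q_1: "q 1 = P" and K_pos: "0 < K"
    and q_large: "K < m \<Longrightarrow> q m = 0"
    and q_rec: "of_nat (2 * (m - 1)) * q m =
      (\<Sum>k\<le>m. \<Sum>i<N. partial_deriv i (q k) * partial_deriv i (q (m - k)))"
begin

abbreviation "D \<equiv> partial_deriv"
abbreviation "T \<equiv> pvar N"

text \<open>The exponent \<open>m - 1\<close> truncates at m = 0, where the coefficient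
  \<open>q 0\<close> is zero.\<close>

definition Q :: cpoly where "Q = (\<Sum>m\<le>K. T ^ (m - 1) * q m)"
definition u :: "nat \<Rightarrow> cpoly" where "u i = D i Q"

lemma P_polys: "P \<in> polys N"
  using q_polys[of 1] unfolding q_1 .

lemma DT: "i < N \<Longrightarrow> D i T = 0" "D N T = 1"
  by (auto simp: partial_deriv_pvar)

lemma u_eq: "i < N \<Longrightarrow> u i = (\<Sum>m\<le>K. T ^ (m - 1) * D i (q m))"
  by (simp add: u_def Q_def partial_deriv_sum partial_deriv_mult partial_deriv_power DT)

lemma u_polys: "u i \<in> polys (Suc N)"
  unfolding u_def Q_def
  by (intro polys_partial_deriv polys_sum polys_mult polys_power polys_pvar polys_mono[OF q_polys]) auto

text \<open>Comparison of powers of t: the derivative puts m - 1 in front of \<open>q m\<close>, and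
  the recursion turns this into the Cauchy product of the gradient with itself.\<close>

lemma hamilton_jacobi_eq: "of_nat 2 * D N Q = (\<Sum>i<N. u i * u i)"
proof -
  let ?c = "\<lambda>k l. \<Sum>i<N. D i (q k) * D i (q l)"
  have c0: "?c k l = 0" if "k = 0 \<or> l = 0 \<or> K < k \<or> K < l" for k l
    using that by (auto simp: q_0 q_large)
  have "of_nat 2 * D N Q = (\<Sum>m\<le>K. T ^ (m - 2) * (of_nat (2 * (m - 1)) * q m))"
    unfolding Q_def partial_deriv_sum sum_distrib_left
  proof (rule sum.cong[OF refl])
    fix m
    show "of_nat 2 * D N (T ^ (m - 1) * q m) = T ^ (m - 2) * (of_nat (2 * (m - 1)) * q m)"
      unfolding of_nat_mult
      by (simp add: partial_deriv_mult partial_deriv_power DT partial_deriv_outside[OF q_polys]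
          mult_ac numeral_2_eq_2)
  qed
  \<comment> \<open>The Cauchy product of two sums up to \<open>K\<close> reaches 2
    \<open>K\<close>. The triangle of index pairs with sum at most 2 \<open>K\<close> contains the
    whole square, and the terms outside the square vanish.\<close>
  also have "\<dots> = (\<Sum>m\<le>2 * K. T ^ (m - 2) * (of_nat (2 * (m - 1)) * q m))"
    by (rule sum.mono_neutral_left) (auto simp: q_large)
  also have "\<dots> = (\<Sum>m\<le>2 * K. \<Sum>k\<le>m. T ^ (k + (m - k) - 2) * ?c k (m - k))"
    unfolding q_rec sum_distrib_left by (intro sum.cong refl) auto
  also have "\<dots> = (\<Sum>(k, l)\<in>{(k, l). k + l \<le> 2 * K}. T ^ (k + l - 2) * ?c k l)"
    by (rule sum.triangle_reindex_eq[symmetric])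
  also have "\<dots> = (\<Sum>(k, l)\<in>{..K} \<times> {..K}. T ^ (k + l - 2) * ?c k l)"
  proof (rule sum.mono_neutral_right)
    show "finite {(k, l). k + l \<le> 2 * K}"
      by (rule finite_subset[of _ "{..2 * K} \<times> {..2 * K}"]) auto
    show "\<forall>x\<in>{(k, l). k + l \<le> 2 * K} - {..K} \<times> {..K}. (case x of (k, l) \<Rightarrow> T ^ (k + l - 2) * ?c k l) = 0"
    proof
      fix x assume x: "x \<in> {(k, l). k + l \<le> 2 * K} - {..K} \<times> {..K}"
      obtain k l where kl: "x = (k, l)" by fastforce
      then have "?c k l = 0" using x by (intro c0) auto
      then show "(case x of (k, l) \<Rightarrow> T ^ (k + l - 2) * ?c k l) = 0" by (simp add: kl)
    qed
  qed auto
  also have "\<dots> = (\<Sum>k\<le>K. \<Sum>l\<le>K. \<Sum>i<N. (T ^ (k - 1) * D i (q k)) * (T ^ (l - 1) * D i (q l)))"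
  proof -
    have "T ^ (k + l - 2) * ?c k l = (\<Sum>i<N. (T ^ (k - 1) * D i (q k)) * (T ^ (l - 1) * D i (q l)))" for k l
    proof (cases "k = 0 \<or> l = 0")
      case True
      then show ?thesis by (auto simp: q_0)
    next
      case False
      then have "k + l - 2 = (k - 1) + (l - 1)" by auto
      then show ?thesis by (simp only: power_add sum_distrib_left mult_ac)
    qed
    then show ?thesis by (simp only: sum.cartesian_product[symmetric])
  qed
  also have "\<dots> = (\<Sum>i<N. \<Sum>k\<le>K. \<Sum>l\<le>K. (T ^ (k - 1) * D i (q k)) * (T ^ (l - 1) * D i (q l)))"
    by (rule sum_rotate)
  also have "\<dots> = (\<Sum>i<N. u i * u i)"
    by (intro sum.cong refl) (simp add: u_eq sum_product)
  finally show ?thesis .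
qed

text \<open>The gradient of the Hamilton--Jacobi equation; symmetry of the second derivatives of
  \<open>Q\<close> turns it into the inviscid Burgers equation.\<close>

lemma burgers: "D N (u i) = (\<Sum>j<N. u j * D j (u i))"
proof (rule of_nat_cpoly_cancel[of 2])
  have sym: "D i (u j) = D j (u i)" for j unfolding u_def by (rule partial_deriv_commute)
  have "of_nat 2 * D N (u i) = D i (of_nat 2 * D N Q)"
    by (simp add: u_def partial_deriv_mult partial_deriv_commute[of i N] del: of_nat_numeral)
  also have "\<dots> = of_nat 2 * (\<Sum>j<N. u j * D j (u i))"
    unfolding hamilton_jacobi_eq
    by (simp add: partial_deriv_sum partial_deriv_mult sum_distrib_left sym algebra_simps)
  finally show "of_nat 2 * D N (u i) = of_nat 2 * (\<Sum>j<N. u j * D j (u i))" .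
qed simp

lemma ord_u: "i < N \<Longrightarrow> ord_ge N 1 (u i - D i P)"
proof -
  assume i: "i < N"
  have "u i = (\<Sum>m\<in>{..K} - {1}. T ^ (m - 1) * D i (q m)) + D i P"
    unfolding u_eq[OF i] using K_pos sum.remove[of "{..K}" 1 "\<lambda>m. T ^ (m - 1) * D i (q m)"]
    by (simp add: q_1[simplified] add.commute)
  moreover have "ord_ge N 1 (\<Sum>m\<in>{..K} - {1}. T ^ (m - 1) * D i (q m))"
  proof (rule ord_ge_sum)
    fix m assume m: "m \<in> {..K} - {1}"
    show "ord_ge N 1 (T ^ (m - 1) * D i (q m))"
    proof (cases m)
      case 0
      then show ?thesis by (simp add: q_0)
    next
      case (Suc m')
      with m obtain l where "m' = Suc l" by (cases m') auto
      then have "T ^ (m - 1) * D i (q m) = T * (T ^ l * D i (q m))" using Suc by (simp add: mult.assoc)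
      then show ?thesis by (simp only: ord_ge_pvar_mult)
    qed
  qed
  ultimately show ?thesis by simp
qed

text \<open>The characteristics of the Burgers equation: each point moves with constant velocity -
  grad P, and \<open>bwd\<close> traces it back by means of \<open>u\<close>. The time coordinate is
  left fixed.\<close>

definition fwd :: "nat \<Rightarrow> cpoly" where "fwd j = (if j < N then pvar j - T * D j P else pvar j)"
definition bwd :: "nat \<Rightarrow> cpoly" where "bwd j = (if j < N then pvar j + T * u j else pvar j)"

lemma D_P_polys: "D j P \<in> polys N"
  by (rule polys_partial_deriv[OF P_polys])

text \<open>\<open>u\<close> is constant along characteristics. The defect vanishes at t = 0, and by
  the Burgers equation its derivative in t is a linear combination of the defects
  themselves.\<close>

lemma u_fwd: "i < N \<Longrightarrow> psubst fwd (u i) = D i P"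
proof -
  assume i: "i < N"
  let ?w = "\<lambda>i. psubst fwd (u i) - D i P"
  have DN: "D N (fwd k) = - D k P" if "k < N" for k
    using that by (simp add: fwd_def partial_deriv_diff partial_deriv_mult DT partial_deriv_pvar
        partial_deriv_outside[OF D_P_polys])
  have DN': "D N (fwd N) = 1" by (simp add: fwd_def DT)
  have flow: "D N (?w i) = (\<Sum>k<N. ?w k * psubst fwd (D k (u i)))" for i
  proof -
    have "D N (?w i) = (\<Sum>k<Suc N. psubst fwd (D k (u i)) * D N (fwd k))"
      by (simp only: partial_deriv_diff partial_deriv_psubst[OF u_polys]
          partial_deriv_outside[OF D_P_polys order.refl] diff_zero)
    also have "\<dots> = psubst fwd (D N (u i)) - (\<Sum>k<N. D k P * psubst fwd (D k (u i)))"
      by (simp add: DN DN' sum_negf[symmetric] mult.commute)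
    also have "\<dots> = (\<Sum>k<N. ?w k * psubst fwd (D k (u i)))"
      unfolding burgers by (simp add: psubst_simps sum_subtractf left_diff_distrib)
    finally show ?thesis .
  qed
  have "?w i = 0"
  proof (rule transport_zero[of N ?w, OF _ _ i])
    fix j assume "j < N"
    have "ord_ge N 1 (psubst fwd (u j) - u j)"
    proof (rule ord_ge_psubst_diff)
      show "ord_ge N 1 (fwd j - pvar j)" for j
        by (simp add: fwd_def ord_ge_uminus ord_ge_pvar_mult[simplified])
    qed
    from ord_ge_add[OF this ord_u[OF \<open>j < N\<close>]] show "ord_ge N 1 (?w j)" by simp
  next
    fix k i assume "\<And>j. j < N \<Longrightarrow> ord_ge N k (?w j)"
    then show "ord_ge N k (D N (?w i))" unfolding flow by (intro ord_ge_sum ord_ge_mult) simp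
  qed
  then show ?thesis by simp
qed

text \<open>Both terms of the difference obey the same law: their derivative in t is their
  derivative along \<open>u\<close>. Derivatives in the space variables do not lower the order in t,
  so \<open>transport_zero\<close> applies.\<close>

lemma u_bwd: "i < N \<Longrightarrow> psubst bwd (D i P) = u i"
proof -
  assume i: "i < N"
  let ?v = "\<lambda>i. u i - psubst bwd (D i P)"
  have flow: "D N (?v i) = (\<Sum>j<N. D j (?v i) * u j)" for i
  proof -
    let ?S = "\<lambda>k. psubst bwd (D k (D i P))"
    have Dj: "D j (?v i) = D j (u i) - (\<Sum>k<N. ?S k * D j (bwd k))" for j
      by (simp add: partial_deriv_diff partial_deriv_psubst[OF D_P_polys])
    have DN: "D N (bwd k) = u k + T * D N (u k)" if "k < N" for k
      using that by (simp add: bwd_def partial_deriv_add partial_deriv_mult DT partial_deriv_pvar)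
    have DB: "D j (bwd k) = (if j = k then 1 else 0) + T * D j (u k)" if "k < N" "j < N" for j k
      using that by (simp add: bwd_def partial_deriv_add partial_deriv_mult DT partial_deriv_pvar)
    have sumB: "(\<Sum>j<N. D j (bwd k) * u j) = D N (bwd k)" if k: "k < N" for k
    proof -
      have "(\<Sum>j<N. D j (bwd k) * u j) = (\<Sum>j<N. (if j = k then u j else 0) + T * (u j * D j (u k)))"
        using k by (intro sum.cong refl) (auto simp: DB algebra_simps)
      also have "\<dots> = u k + T * D N (u k)"
        unfolding burgers using k by (simp add: sum.distrib sum_distrib_left)
      finally show ?thesis using k by (simp add: DN)
    qed
    have "(\<Sum>j<N. D j (?v i) * u j) =
        (\<Sum>j<N. u j * D j (u i)) - (\<Sum>j<N. \<Sum>k<N. ?S k * (D j (bwd k) * u j))"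
      unfolding Dj left_diff_distrib sum_subtractf sum_distrib_right by (simp only: mult_ac)
    also have "(\<Sum>j<N. \<Sum>k<N. ?S k * (D j (bwd k) * u j)) = (\<Sum>k<N. ?S k * D N (bwd k))"
      by (subst sum.swap) (simp add: sum_distrib_left[symmetric] sumB)
    finally show ?thesis unfolding Dj burgers[symmetric] by simp
  qed
  have "?v i = 0"
  proof (rule transport_zero[of N ?v, OF _ _ i])
    fix j assume "j < N"
    have "ord_ge N 1 (psubst bwd (D j P) - D j P)"
    proof (rule ord_ge_psubst_diff)
      show "ord_ge N 1 (bwd j - pvar j)" for j
        by (simp add: bwd_def ord_ge_pvar_mult[simplified])
    qed
    from ord_ge_diff[OF ord_u[OF \<open>j < N\<close>] this] show "ord_ge N 1 (?v j)" by simp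
  next
    fix k i assume "\<And>j. j < N \<Longrightarrow> ord_ge N k (?v j)" and "i < N"
    then show "ord_ge N k (D N (?v i))"
      unfolding flow by (intro ord_ge_sum ord_ge_mult ord_ge_partial_deriv) auto
  qed
  then show ?thesis by simp
qed

theorem gradient_map_inverse:
  "\<exists>G. (\<forall>i<N. G i \<in> polys N) \<and>
     (\<forall>x. \<forall>i<N. peval (G i) (\<lambda>j. x j - peval (D j P) x) = x i) \<and>
     (\<forall>x. \<forall>i<N. peval (G i) x - peval (D i P) (\<lambda>j. peval (G j) x) = x i)"
proof -
  \<comment> \<open>Time is set to 1; the polynomials concerned involve no variable beyond the time
    variable \<open>N\<close>.\<close>
  define ext :: "(nat \<Rightarrow> complex) \<Rightarrow> nat \<Rightarrow> complex" where "ext z j = (if j < N then z j else 1)" for z j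
  define G where "G i = psubst (\<lambda>j. if j < N then pvar j else 1) (pvar i + u i)" for i
  have G_polys: "G i \<in> polys N" if "i < N" for i
    unfolding G_def
  proof (rule polys_psubst)
    show "pvar i + u i \<in> polys (Suc N)" using that by (intro polys_add polys_pvar u_polys) simp
    show "(if j < N then pvar j else 1) \<in> polys N" for j by (simp add: polys_pvar)
  qed
  have peval_G: "peval (G i) z = z i + peval (u i) (ext z)" if "i < N" for i z
  proof -
    have "(\<lambda>j. peval (if j < N then pvar j else 1) z) = ext z" by (auto simp: ext_def)
    then show ?thesis using that by (simp add: G_def peval_psubst ext_def)
  qed
  have cong: "peval (D i P) (ext z) = peval (D i P) z" for i z
    by (rule peval_cong[OF D_P_polys]) (simp add: ext_def)
  have "peval (G i) (\<lambda>j. x j - peval (D j P) x) = x i" if i: "i < N" for i x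
  proof -
    have "peval (u i) (ext (\<lambda>j. x j - peval (D j P) x)) = peval (psubst fwd (u i)) (ext x)"
      unfolding peval_psubst
      by (rule peval_cong[OF u_polys]) (auto simp: fwd_def cong less_Suc_eq, auto simp: ext_def)
    then show ?thesis using i by (simp add: peval_G u_fwd cong)
  qed
  moreover have "peval (G i) x - peval (D i P) (\<lambda>j. peval (G j) x) = x i" if i: "i < N" for i x
  proof -
    have "peval (D i P) (\<lambda>j. peval (G j) x) = peval (psubst bwd (D i P)) (ext x)"
      unfolding peval_psubst
      by (rule peval_cong[OF D_P_polys]) (auto simp: bwd_def peval_G, auto simp: ext_def)
    then show ?thesis using i by (simp add: peval_G u_bwd)
  qed
  ultimately show ?thesis using G_polys by blast
qed

end

lemma gradient_map_inverse_of_vanishing: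
  fixes P :: cpoly
  assumes P: "P \<in> polys N" and deg: "degree_le 4 P" and r: "3 \<le> r"
    and nil: "\<And>c i. i < N \<Longrightarrow> (potential.hess_op N P ^^ (r - 2)) c i = 0"
    and M: "0 < M" "\<And>m. M + 1 \<le> m \<Longrightarrow> m \<le> 2 * M \<Longrightarrow> mbar r 4 (nu m) = mbar r 4 0"
  shows "\<exists>G. (\<forall>i<N. G i \<in> polys N) \<and>
     (\<forall>x. \<forall>i<N. peval (G i) (\<lambda>j. x j - peval (partial_deriv j P) x) = x i) \<and>
     (\<forall>x. \<forall>i<N. peval (G i) x - peval (partial_deriv i P) (\<lambda>j. peval (G j) x) = x i)"
proof -
  interpret potential N P .
  have "Phi (nu m) = 0" if "M + 1 \<le> m" "m \<le> 2 * M" for m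
    using Phi_eq_0_if_mbar_eq_0[OF M(2)[OF that] deg r nil] .
  then have "Phi (nu m) = 0" if "M < m" for m
    using Phi_nu_gap[OF M(1)] that by simp
  then interpret hamilton_jacobi N M P "\<lambda>m. Phi (nu m)"
    using polys_Phi[OF P] Phi_nu_0 Phi_nu_1 Phi_nu_recursion M(1) by unfold_locales
  show ?thesis by (rule gradient_map_inverse)
qed

subsection \<open>Directional derivatives and polynomial inverses\<close>

definition dir_deriv :: "nat \<Rightarrow> cpoly \<Rightarrow> (nat \<Rightarrow> complex) \<Rightarrow> (nat \<Rightarrow> complex) \<Rightarrow> complex" where
  "dir_deriv n p x w = (\<Sum>i<n. w i * peval (partial_deriv i p) x)"

lemma dir_deriv_add: "dir_deriv n (p + q) x w = dir_deriv n p x w + dir_deriv n q x w"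
  and dir_deriv_diff: "dir_deriv n (p - q) x w = dir_deriv n p x w - dir_deriv n q x w"
  and dir_deriv_uminus: "dir_deriv n (- p) x w = - dir_deriv n p x w"
  and dir_deriv_mult: "dir_deriv n (p * q) x w = dir_deriv n p x w * peval q x + peval p x * dir_deriv n q x w"
  and dir_deriv_const: "dir_deriv n (const_poly c) x w = 0"
  and dir_deriv_0: "dir_deriv n 0 x w = 0"
  by (simp_all add: dir_deriv_def partial_deriv_add partial_deriv_diff partial_deriv_minus
      partial_deriv_mult sum.distrib sum_subtractf sum_negf sum_distrib_left sum_distrib_right
      algebra_simps)

lemma dir_deriv_sum: "dir_deriv n (\<Sum>a\<in>A. f a) x w = (\<Sum>a\<in>A. dir_deriv n (f a) x w)"
  by (induction A rule: infinite_finite_induct) (auto simp: dir_deriv_add dir_deriv_0)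

lemma dir_deriv_pvar: "dir_deriv n (pvar j) x w = (if j < n then w j else 0)"
proof -
  have "dir_deriv n (pvar j) x w = (\<Sum>i<n. if i = j then w i else 0)"
    unfolding dir_deriv_def by (intro sum.cong refl) (auto simp: partial_deriv_pvar)
  then show ?thesis by simp
qed

lemmas dir_deriv_simps = dir_deriv_add dir_deriv_diff dir_deriv_uminus dir_deriv_mult
  dir_deriv_const dir_deriv_0 dir_deriv_sum dir_deriv_pvar

lemma dir_deriv_more:
  assumes "p \<in> polys n" "n \<le> n'"
  shows "dir_deriv n' p x w = dir_deriv n p x w"
  unfolding dir_deriv_def
  by (rule sum.mono_neutral_right) (use assms partial_deriv_outside[OF assms(1)] in auto)

lemma dir_deriv_cong:
  assumes "p \<in> polys n" "\<And>i. i < n \<Longrightarrow> x i = y i" "\<And>i. i < n \<Longrightarrow> w i = v i"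
  shows "dir_deriv n p x w = dir_deriv n p y v"
  unfolding dir_deriv_def
  by (intro sum.cong refl arg_cong2[of _ _ _ _ "(*)"] peval_cong[OF polys_partial_deriv[OF assms(1)]])
    (use assms in auto)

lemma dir_deriv_zero: "(\<And>i. i < n \<Longrightarrow> w i = 0) \<Longrightarrow> dir_deriv n p x w = 0"
  by (simp add: dir_deriv_def)

lemma dir_deriv_psubst:
  assumes "p \<in> polys m"
  shows "dir_deriv n (psubst g p) x w =
    dir_deriv m p (\<lambda>k. peval (g k) x) (\<lambda>k. dir_deriv n (g k) x w)"
proof -
  have "dir_deriv n (psubst g p) x w = (\<Sum>i<n. \<Sum>k<m. w i * (peval (partial_deriv k p) (\<lambda>k. peval (g k) x) *
      peval (partial_deriv i (g k)) x))"
    by (simp add: dir_deriv_def partial_deriv_psubst[OF assms] peval_psubst sum_distrib_left)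
  also have "\<dots> = (\<Sum>k<m. \<Sum>i<n. w i * (peval (partial_deriv k p) (\<lambda>k. peval (g k) x) *
      peval (partial_deriv i (g k)) x))"
    by (rule sum.swap)
  also have "\<dots> = dir_deriv m p (\<lambda>k. peval (g k) x) (\<lambda>k. dir_deriv n (g k) x w)"
    unfolding dir_deriv_def sum_distrib_right by (simp only: mult_ac)
  finally show ?thesis .
qed

text \<open>Injectivity of the derivative at every point. Unlike a determinant condition it can be
  carried through added variables one direction vector at a time.\<close>

definition keller :: "nat \<Rightarrow> (nat \<Rightarrow> cpoly) \<Rightarrow> bool" where
  "keller n p \<longleftrightarrow> (\<forall>x w. (\<forall>j<n. dir_deriv n (p j) x w = 0) \<longrightarrow> (\<forall>i<n. w i = 0))"

definition has_inverse :: "nat \<Rightarrow> (nat \<Rightarrow> cpoly) \<Rightarrow> bool" where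
  "has_inverse n p \<longleftrightarrow> (\<exists>G. (\<forall>j<n. G j \<in> polys n) \<and>
     (\<forall>x. \<forall>i<n. peval (G i) (\<lambda>j. peval (p j) x) = x i \<and> peval (p i) (\<lambda>j. peval (G j) x) = x i))"

text \<open>If the larger map agrees with \<open>p\<close> on the locus where its additional
  components vanish, feeding zeros into these components of its inverse inverts \<open>p\<close>.
  The assumption \<open>lift\<close> gives a point of the locus over each \<open>x\<close>, and
  \<open>restrict\<close> gives the agreement.\<close>

lemma has_inverse_restrict:
  assumes inv: "has_inverse n' p'" and n: "n \<le> n'"
    and lift: "\<And>x. \<exists>y. (\<forall>j<n. y j = x j) \<and>
      (\<forall>j<n'. peval (p' j) y = (if j < n then peval (p j) x else 0))"
    and restrict: "\<And>z j. (\<And>j. n \<le> j \<Longrightarrow> j < n' \<Longrightarrow> peval (p' j) z = 0) \<Longrightarrow> j < n \<Longrightarrow>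
      peval (p' j) z = peval (p j) z"
  shows "has_inverse n p"
proof -
  obtain G' where G': "\<And>j. j < n' \<Longrightarrow> G' j \<in> polys n'"
    "\<And>x i. i < n' \<Longrightarrow> peval (G' i) (\<lambda>j. peval (p' j) x) = x i"
    "\<And>x i. i < n' \<Longrightarrow> peval (p' i) (\<lambda>j. peval (G' j) x) = x i"
    using inv unfolding has_inverse_def by blast
  define trunc :: "(nat \<Rightarrow> complex) \<Rightarrow> nat \<Rightarrow> complex" where
    "trunc y j = (if j < n then y j else 0)" for y j
  define G where "G i = psubst (\<lambda>j. if j < n then pvar j else 0) (G' i)" for i
  have ev: "peval (G i) y = peval (G' i) (trunc y)" for i y
  proof -
    have "(\<lambda>j. peval (if j < n then pvar j else 0) y) = trunc y" by (auto simp: trunc_def)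
    then show ?thesis by (simp add: G_def peval_psubst)
  qed
  have "G j \<in> polys n" if "j < n" for j
    unfolding G_def by (rule polys_psubst[OF G'(1)]) (use that n in \<open>auto intro: polys_pvar\<close>)
  moreover have "peval (G i) (\<lambda>j. peval (p j) x) = x i" if i: "i < n" for i x
  proof -
    obtain y where y: "\<And>j. j < n \<Longrightarrow> y j = x j"
      "\<And>j. j < n' \<Longrightarrow> peval (p' j) y = (if j < n then peval (p j) x else 0)" using lift by blast
    have "peval (G i) (\<lambda>j. peval (p j) x) = peval (G' i) (\<lambda>j. peval (p' j) y)"
      unfolding ev by (rule peval_cong[OF G'(1)]) (use i n y in \<open>auto simp: trunc_def\<close>)
    then show ?thesis using G'(2) y i n by simp
  qed
  moreover have "peval (p i) (\<lambda>j. peval (G j) x) = x i" if i: "i < n" for i x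
  proof -
    have p': "peval (p' j) (\<lambda>j. peval (G j) x) = trunc x j" if "j < n'" for j
      unfolding ev using G'(3)[OF that] .
    have "peval (p' i) (\<lambda>j. peval (G j) x) = peval (p i) (\<lambda>j. peval (G j) x)"
      by (rule restrict[OF _ i]) (simp add: p' trunc_def)
    then show ?thesis using p' i n by (simp add: trunc_def)
  qed
  ultimately show ?thesis unfolding has_inverse_def by blast
qed

subsection \<open>Polynomials as lists of monomials\<close>

text \<open>Variables are listed with repetition, so that one monomial of a map can be singled out
  and split into two factors by splitting its list.\<close>

fun mon :: "complex \<times> nat list \<Rightarrow> cpoly" where
  "mon (c, is) = const_poly c * prod_list (map pvar is)"

definition poly_of :: "(complex \<times> nat list) list \<Rightarrow> cpoly" where
  "poly_of ms = sum_list (map mon ms)"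

lemma poly_of_simps [simp]:
  "poly_of [] = 0" "poly_of (t # ms) = mon t + poly_of ms" "poly_of (ms @ ms') = poly_of ms + poly_of ms'"
  by (simp_all add: poly_of_def)

definition vars_below :: "nat \<Rightarrow> (complex \<times> nat list) list \<Rightarrow> bool" where
  "vars_below n ms \<longleftrightarrow> (\<forall>t\<in>set ms. set (snd t) \<subseteq> {..<n})"

lemma polys_prod_list: "set is \<subseteq> {..<n} \<Longrightarrow> prod_list (map pvar is) \<in> polys n"
  by (induction "is") (auto intro: polys_pvar)

lemma polys_poly_of: "vars_below n ms \<Longrightarrow> poly_of ms \<in> polys n"
  by (induction ms) (auto simp: vars_below_def intro!: polys_add polys_mult polys_prod_list)

lemma poly_of_exists:
  "p \<in> polys n \<Longrightarrow> \<exists>ms. vars_below n ms \<and> poly_of ms = p"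
proof (induction rule: polys_induct)
  case (const c)
  show ?case by (rule exI[of _ "[(c, [])]"]) (simp add: vars_below_def)
next
  case (var i)
  then show ?case by (intro exI[of _ "[(1, [i])]"]) (simp add: vars_below_def)
next
  case (add p q)
  then obtain ms ms' where "vars_below n ms" "poly_of ms = p" "vars_below n ms'" "poly_of ms' = q" by blast
  then show ?case by (intro exI[of _ "ms @ ms'"]) (auto simp: vars_below_def)
next
  case (mult p q)
  then obtain ms ms' where ms: "vars_below n ms" "poly_of ms = p" "vars_below n ms'" "poly_of ms' = q"
    by blast
  let ?times = "\<lambda>s t. (fst s * fst t, snd s @ snd t)"
  let ?l = "concat (map (\<lambda>s. map (?times s) ms') ms)"
  have "mon (?times s t) = mon s * mon t" for s t
    by (cases s; cases t) (simp add: const_poly_mult mult_ac)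
  then have "poly_of (map (?times s) l) = mon s * poly_of l" for s l
    by (induction l) (simp_all add: distrib_left del: mon.simps)
  then have "poly_of (concat (map (\<lambda>s. map (?times s) l') l)) = poly_of l * poly_of l'" for l l'
    by (induction l) (simp_all add: distrib_right del: mon.simps)
  then have "poly_of ?l = p * q" using ms by simp
  moreover have "vars_below n ?l" using ms unfolding vars_below_def by fastforce
  ultimately show ?case by blast
qed

lemma degree_le_mon: "degree_le (length (snd t)) (mon t)"
proof (cases t)
  case (Pair c "is")
  have "degree_le (length js) (prod_list (map pvar js))" for js
  proof (induction js)
    case (Cons j js)
    have "degree_le (1 + length js) (pvar j * prod_list (map pvar js))"
      by (rule degree_le_mult[OF degree_le_pvar Cons])
    then show ?case by simp
  qed (use degree_le_const[of _ 1] in simp)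
  then show ?thesis using Pair degree_le_const_mult by simp
qed

text \<open>Monomials of degree at most 3 cost nothing. With powers of 2, a monomial of degree d + 2
  outweighs one of degree d + 1 and one of degree d together, which are the pieces left by one
  reduction step.\<close>

definition weight :: "nat \<Rightarrow> nat" where
  "weight d = (if 3 < d then 2 ^ d else 0)"

definition list_weight :: "(complex \<times> nat list) list \<Rightarrow> nat" where
  "list_weight ms = sum_list (map (\<lambda>t. weight (length (snd t))) ms)"

lemma list_weight_simps [simp]:
  "list_weight [] = 0" "list_weight (t # ms) = weight (length (snd t)) + list_weight ms"
  "list_weight (ms @ ms') = list_weight ms + list_weight ms'"
  by (simp_all add: list_weight_def)

text \<open>A monomial \<open>a b\<close> in the component \<open>j\<close> is removed by composing the map with the
  automorphisms \<open>(x, u, v) \<mapsto> (x, u + a, v + b)\<close> and \<open>x\<^sub>j \<mapsto> x\<^sub>j - u v\<close> in two new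
  variables \<open>u\<close> and \<open>v\<close>.\<close>

lemma degree_reduction:
  assumes cubic: "\<And>n F. (\<forall>j<n. vars_below n (F j)) \<Longrightarrow>
      (\<forall>j<n. \<forall>t\<in>set (F j). length (snd t) \<le> 3) \<Longrightarrow>
      keller n (\<lambda>j. poly_of (F j)) \<Longrightarrow> has_inverse n (\<lambda>j. poly_of (F j))"
  shows "(\<forall>j<n. vars_below n (F j)) \<Longrightarrow> keller n (\<lambda>j. poly_of (F j)) \<Longrightarrow>
      has_inverse n (\<lambda>j. poly_of (F j))"
proof (induction "\<Sum>j<n. list_weight (F j)" arbitrary: n F rule: less_induct)
  case less
  show ?case
  proof (cases "\<forall>j<n. \<forall>t\<in>set (F j). length (snd t) \<le> 3")
    case True
    with cubic less.prems show ?thesis by blast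
  next
    case False
    then obtain j0 t where j0: "j0 < n" "t \<in> set (F j0)" "3 < length (snd t)" by (auto simp: not_le)
    obtain l1 l2 where l12: "F j0 = l1 @ t # l2" using split_list[OF j0(2)] by blast
    obtain c i1 i2 b where t: "t = (c, i1 # i2 # b)"
    proof -
      obtain c js where cj: "t = (c, js)" by (cases t)
      then obtain i1 i2 b where "js = i1 # i2 # b" using j0(3)
        by (cases js; cases "tl js") auto
      with cj that show thesis by blast
    qed
    have lb: "2 \<le> length b" using j0(3) t by simp
    define A where "A = mon (c, [i1, i2])"
    define B where "B = mon (1, b)"
    define R where "R = poly_of (l1 @ l2)"
    \<comment> \<open>With u and v the variables \<open>n\<close> and \<open>Suc n\<close>,
      component \<open>j0\<close> becomes R + A B - (u + A)(v + B), in which the product A B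
      cancels.\<close>
    define F' where "F' = F(j0 := l1 @ l2 @ [(-1, [n, Suc n]), (-1, n # b), (-c, [Suc n, i1, i2])],
      n := [(1, [n]), (c, [i1, i2])], Suc n := [(1, [Suc n]), (1, b)])"
    have vt: "i1 < n" "i2 < n" "set b \<subseteq> {..<n}" and v12: "vars_below n (l1 @ l2)"
      using less.prems(1)[rule_format, OF j0(1)] by (auto simp: vars_below_def l12 t)
    have polys: "A \<in> polys n" "B \<in> polys n" "R \<in> polys n"
      using vt v12 unfolding A_def B_def R_def
      by (auto intro!: polys_mult polys_prod_list polys_poly_of polys_pvar simp del: poly_of_simps)
    have p0: "poly_of (F j0) = R + A * B"
      by (simp add: l12 t R_def A_def B_def algebra_simps)
    have p'0: "poly_of (F' j0) = R - pvar n * pvar (Suc n) - pvar n * B - pvar (Suc n) * A"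
      using j0(1) by (simp add: F'_def R_def A_def B_def const_poly_uminus algebra_simps)
    have p'n: "poly_of (F' n) = pvar n + A" "poly_of (F' (Suc n)) = pvar (Suc n) + B"
      by (simp_all add: F'_def A_def B_def)
    have p'j: "poly_of (F' j) = poly_of (F j)" if "j < n" "j \<noteq> j0" for j
      using that by (simp add: F'_def)
    have Fp: "poly_of (F j) \<in> polys n" if "j < n" for j
      using that less.prems(1) polys_poly_of by blast
    have "(\<Sum>j<Suc (Suc n). list_weight (F' j)) < (\<Sum>j<n. list_weight (F j))"
    proof -
      have "(\<Sum>j<Suc (Suc n). list_weight (F' j)) =
          (\<Sum>j<n. list_weight (F' j)) + weight (length b)"
        by (simp add: F'_def weight_def)
      also have "(\<Sum>j<n. list_weight (F' j)) = list_weight (F' j0) + (\<Sum>j\<in>{..<n} - {j0}. list_weight (F' j))"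
        using j0(1) by (simp add: sum.remove)
      also have "(\<Sum>j\<in>{..<n} - {j0}. list_weight (F' j)) = (\<Sum>j\<in>{..<n} - {j0}. list_weight (F j))"
        by (intro sum.cong refl) (auto simp: F'_def)
      also have "list_weight (F' j0) = list_weight l1 + list_weight l2 + weight (Suc (length b))"
        using j0(1) by (simp add: F'_def weight_def)
      \<comment> \<open>Of the new monomials only u B and B can exceed degree 3.\<close>
      also have "weight (Suc (length b)) + weight (length b) < weight (length (snd t))"
        using lb by (auto simp: weight_def t)
      then have "list_weight l1 + list_weight l2 + weight (Suc (length b)) +
          (\<Sum>j\<in>{..<n} - {j0}. list_weight (F j)) + weight (length b) <
          list_weight (F j0) + (\<Sum>j\<in>{..<n} - {j0}. list_weight (F j))"
        by (simp add: l12)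
      also have "\<dots> = (\<Sum>j<n. list_weight (F j))" using j0(1) by (simp add: sum.remove)
      finally show ?thesis .
    qed
    moreover have "\<forall>j<Suc (Suc n). vars_below (Suc (Suc n)) (F' j)"
    proof (intro allI impI)
      fix j assume "j < Suc (Suc n)"
      moreover have "vars_below (Suc (Suc n)) (F j)" if "j < n"
        using less.prems(1) that by (fastforce simp: vars_below_def)
      moreover have "set b \<subseteq> {..<Suc (Suc n)}" using vt(3) by auto
      moreover have "vars_below (Suc (Suc n)) (l1 @ l2)" using v12 by (fastforce simp: vars_below_def)
      ultimately show "vars_below (Suc (Suc n)) (F' j)"
        using vt j0(1) by (auto simp: F'_def vars_below_def less_Suc_eq)
    qed
    moreover have "keller (Suc (Suc n)) (\<lambda>j. poly_of (F' j))"
      unfolding keller_def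
    proof (intro allI impI)
      fix x w :: "nat \<Rightarrow> complex" and i
      assume d: "\<forall>j<Suc (Suc n). dir_deriv (Suc (Suc n)) (poly_of (F' j)) x w = 0" and i: "i < Suc (Suc n)"
      let ?d = "\<lambda>p. dir_deriv n p x w"
      have more: "dir_deriv (Suc (Suc n)) p x w = ?d p" if "p \<in> polys n" for p
        by (rule dir_deriv_more[OF that]) simp
      \<comment> \<open>The two new components force du = - dA and dv = - dB; with these, the
        differential of component \<open>j0\<close> collapses to that of R + A B.\<close>
      have wn: "w n = - ?d A" "w (Suc n) = - ?d B"
        using d[rule_format, of n] d[rule_format, of "Suc n"]
        by (simp_all add: p'n dir_deriv_simps more polys eq_neg_iff_add_eq_0)
      have "?d (poly_of (F j)) = 0" if j: "j < n" for j
      proof (cases "j = j0")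
        case True
        have "dir_deriv (Suc (Suc n)) (poly_of (F' j0)) x w = 0" using d j True by simp
        then show ?thesis
          unfolding True p0 p'0 by (simp add: dir_deriv_simps more polys wn algebra_simps)
      next
        case False
        then show ?thesis using d[rule_format, of j] j by (simp add: p'j more Fp)
      qed
      then have w0: "\<And>i. i < n \<Longrightarrow> w i = 0" using less.prems(2) unfolding keller_def by blast
      then have "?d A = 0" "?d B = 0" by (auto intro: dir_deriv_zero)
      then show "w i = 0" using w0 wn i by (auto simp: less_Suc_eq)
    qed
    ultimately have inv: "has_inverse (Suc (Suc n)) (\<lambda>j. poly_of (F' j))" by (rule less.hyps)
    show ?thesis
    proof (rule has_inverse_restrict[OF inv])
      fix x
      \<comment> \<open>At u = - A and v = - B the new components vanish, and - u v - u B - v A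
        equals A B.\<close>
      let ?y = "x(n := - peval A x, Suc n := - peval B x)"
      have same: "peval p ?y = peval p x" if "p \<in> polys n" for p
        by (rule peval_cong[OF that]) auto
      have "peval (poly_of (F' j)) ?y = (if j < n then peval (poly_of (F j)) x else 0)"
        if j: "j < Suc (Suc n)" for j
      proof -
        consider "j = j0" | "j < n" "j \<noteq> j0" | "j = n" | "j = Suc n" using j by linarith
        then show ?thesis
          by cases (use j0(1) in \<open>auto simp: p0 p'0 p'n p'j same polys Fp\<close>)
      qed
      then show "\<exists>y. (\<forall>j<n. y j = x j) \<and> (\<forall>j<Suc (Suc n). peval (poly_of (F' j)) y =
          (if j < n then peval (poly_of (F j)) x else 0))"
        by (intro exI[of _ ?y]) auto
    next
      fix z j assume z: "\<And>j. n \<le> j \<Longrightarrow> j < Suc (Suc n) \<Longrightarrow> peval (poly_of (F' j)) z = 0" and j: "j < n"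
      have uv: "z n = - peval A z" "z (Suc n) = - peval B z"
        using z[of n] z[of "Suc n"] by (simp_all add: p'n eq_neg_iff_add_eq_0)
      show "peval (poly_of (F' j)) z = peval (poly_of (F j)) z"
        by (cases "j = j0") (simp_all add: p0 p'0 p'j j uv algebra_simps)
    qed simp
  qed
qed

subsection \<open>Matrices without nonzero eigenvalues\<close>

text \<open>Matrices and vectors are plain functions here, so that powers are iterates
  \<open>^^\<close> without dimension side conditions; only indices below \<open>m\<close> carry
  meaning.\<close>

definition mat_app :: "nat \<Rightarrow> (nat \<Rightarrow> nat \<Rightarrow> complex) \<Rightarrow> (nat \<Rightarrow> complex) \<Rightarrow> nat \<Rightarrow> complex" where
  "mat_app m M v i = (\<Sum>j<m. M i j * v j)"

lemma mat_app_cong: "(\<And>j. j < m \<Longrightarrow> v j = v' j) \<Longrightarrow> mat_app m M v = mat_app m M v'"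
  by (auto simp: mat_app_def fun_eq_iff)

lemma mat_app_pow_lin:
  "(mat_app m M ^^ t) (\<lambda>j. a * v j + b * w j) i = a * (mat_app m M ^^ t) v i + b * (mat_app m M ^^ t) w i"
  by (induction t arbitrary: i)
    (simp_all add: mat_app_def sum.distrib sum_distrib_left algebra_simps)

lemma exists_nontrivial_relation:
  fixes f :: "nat \<Rightarrow> nat \<Rightarrow> complex"
  shows "\<exists>c. (\<exists>t\<le>m. c t \<noteq> 0) \<and> (\<forall>i<m. (\<Sum>t\<le>m. c t * f t i) = 0)"
proof -
  \<comment> \<open>The m + 1 vectors are the columns; an added zero row makes the matrix square and
    singular, so a kernel vector supplies the relation.\<close>
  define A where "A = mat (Suc m) (Suc m) (\<lambda>(i, t). if i < m then f t i else 0)"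
  have A: "A \<in> carrier_mat (Suc m) (Suc m)" by (simp add: A_def)
  have "det A = (\<Sum>j<Suc m. A $$ (m, j) * cofactor A m j)"
    using laplace_expansion_row[OF A, of m] by simp
  also have "\<dots> = 0" by (intro sum.neutral) (auto simp: A_def)
  finally obtain v where v: "v \<in> carrier_vec (Suc m)" "v \<noteq> 0\<^sub>v (Suc m)" "A *\<^sub>v v = 0\<^sub>v (Suc m)"
    using det_0_iff_vec_prod_zero_field[OF A] by blast
  have "\<exists>t\<le>m. v $ t \<noteq> 0"
  proof (rule ccontr)
    assume "\<not> ?thesis"
    then have "v = 0\<^sub>v (Suc m)" using v(1) by (intro eq_vecI) (auto simp: less_Suc_eq_le)
    with v(2) show False by simp
  qed
  moreover have "(\<Sum>t\<le>m. v $ t * f t i) = 0" if i: "i < m" for i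
  proof -
    have "0 = (A *\<^sub>v v) $ i" using i v(3) by simp
    also have "\<dots> = (\<Sum>t = 0..<Suc m. A $$ (i, t) * v $ t)"
      using i v(1) A by (auto simp: scalar_prod_def intro!: sum.cong simp del: sum.op_ivl_Suc)
    also have "\<dots> = (\<Sum>t\<le>m. v $ t * f t i)"
      using i by (intro sum.cong) (auto simp: A_def)
    finally show ?thesis by simp
  qed
  ultimately show ?thesis by (intro exI[of _ "vec_index v"]) blast
qed

text \<open>Linear factors are peeled off the annihilating polynomial. For a root z, the quotient
  annihilates (M - z) v, so by induction M^d v is annihilated by M - z. If z is not 0 this vector
  must vanish; if z is 0 this already says M^(d+1) v = 0.\<close>

lemma nilpotent_if_annihilated:
  assumes eig: "\<And>z v. z \<noteq> 0 \<Longrightarrow> (\<And>i. i < m \<Longrightarrow> mat_app m M v i = z * v i) \<Longrightarrow> (\<And>i. i < m \<Longrightarrow> v i = 0)"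
    and "p \<noteq> 0" "\<And>i. i < m \<Longrightarrow> (\<Sum>t\<le>degree p. coeff p t * (mat_app m M ^^ t) v i) = 0"
  shows "i < m \<Longrightarrow> (mat_app m M ^^ degree p) v i = 0"
  using assms(2,3)
proof (induction "degree p" arbitrary: p v i)
  case 0
  then have "coeff p 0 * v i = 0" by (metis (no_types, lifting) atMost_0 sum.empty sum.insert finite.emptyI empty_iff add_0_right funpow_0)
  moreover have "coeff p 0 \<noteq> 0" using 0 leading_coeff_0_iff[of p] by metis
  ultimately show ?case using 0 by simp
next
  case (Suc d)
  let ?T = "mat_app m M"
  have "\<not> constant (poly p)" using Suc.hyps(2) by (simp add: constant_degree)
  then obtain z where "poly p z = 0" using fundamental_theorem_of_algebra by blast
  then obtain q where q: "p = [:- z, 1:] * q" by (auto simp: poly_eq_0_iff_dvd)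
  have q0: "q \<noteq> 0" using q Suc.prems(2) by auto
  then have "degree p = Suc (degree q)" unfolding q by (subst degree_mult_eq) auto
  then have d: "d = degree q" using Suc.hyps(2) by simp
  define u where "u j = 1 * ?T v j + (- z) * v j" for j
  have Tu: "(?T ^^ t) u i = (?T ^^ Suc t) v i - z * (?T ^^ t) v i" for t i
    unfolding u_def mat_app_pow_lin by (simp add: funpow_swap1)
  have "(\<Sum>t\<le>degree q. coeff q t * (?T ^^ t) u i) = 0" if i: "i < m" for i
  proof -
    have p: "p = pCons 0 q - smult z q" unfolding q by simp
    have "0 = (\<Sum>t\<le>Suc d. coeff p t * (?T ^^ t) v i)" using Suc.prems(3)[OF i] Suc.hyps(2) by simp
    also have "\<dots> = (\<Sum>t\<le>Suc d. coeff (pCons 0 q) t * (?T ^^ t) v i) - (\<Sum>t\<le>Suc d. z * coeff q t * (?T ^^ t) v i)"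
      unfolding p by (simp add: left_diff_distrib sum_subtractf)
    also have "(\<Sum>t\<le>Suc d. coeff (pCons 0 q) t * (?T ^^ t) v i) = (\<Sum>t\<le>d. coeff q t * (?T ^^ Suc t) v i)"
      by (subst sum.atMost_Suc_shift) simp
    also have "(\<Sum>t\<le>Suc d. z * coeff q t * (?T ^^ t) v i) = (\<Sum>t\<le>d. z * coeff q t * (?T ^^ t) v i)"
      using coeff_eq_0[of q "Suc d"] d by simp
    finally show ?thesis by (simp add: d Tu sum_subtractf[symmetric] algebra_simps del: funpow.simps)
  qed
  then have IH: "\<And>i. i < m \<Longrightarrow> (?T ^^ d) u i = 0" using Suc.hyps(1)[OF d _ q0] d by blast
  then have eq: "?T ((?T ^^ d) v) i = z * (?T ^^ d) v i" if "i < m" for i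
    using that Tu[of d i] by simp
  show ?case
  proof (cases "z = 0")
    case True
    then show ?thesis using eq[OF Suc.prems(1)] by (simp flip: Suc.hyps(2))
  next
    case False
    have "(?T ^^ d) v j = 0" if "j < m" for j using eig[OF False eq that] by blast
    then show ?thesis using eq[OF Suc.prems(1)] Suc.prems(1) by (simp flip: Suc.hyps(2))
  qed
qed

text \<open>The vectors v, M v, ..., M^m v are dependent, which gives each v its own annihilating
  polynomial of degree at most m; no characteristic polynomial is involved.\<close>

lemma nilpotent_if_no_eigenvalue:
  assumes eig: "\<And>z v. z \<noteq> 0 \<Longrightarrow> (\<And>i. i < m \<Longrightarrow> mat_app m M v i = z * v i) \<Longrightarrow> (\<And>i. i < m \<Longrightarrow> v i = 0)"
    and t: "m \<le> t" and i: "i < m"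
  shows "(mat_app m M ^^ t) v i = 0"
proof -
  let ?T = "mat_app m M"
  obtain c where c: "\<exists>t\<le>m. c t \<noteq> 0" "\<And>i. i < m \<Longrightarrow> (\<Sum>t\<le>m. c t * (?T ^^ t) v i) = 0"
    using exists_nontrivial_relation[of m "\<lambda>t. (?T ^^ t) v"] by blast
  define p where "p = (\<Sum>t\<le>m. monom (c t) t)"
  have coeff: "coeff p t = (if t \<le> m then c t else 0)" for t
    by (simp add: p_def coeff_sum)
  have "p \<noteq> 0" using c(1) coeff by (metis coeff_0)
  have deg: "degree p \<le> m" by (rule degree_le) (simp add: coeff)
  have "(\<Sum>t\<le>degree p. coeff p t * (?T ^^ t) v i) = 0" if "i < m" for i
  proof -
    have "(\<Sum>t\<le>degree p. coeff p t * (?T ^^ t) v i) = (\<Sum>t\<le>m. coeff p t * (?T ^^ t) v i)"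
      by (rule sum.mono_neutral_left) (use deg in \<open>auto simp: coeff_eq_0\<close>)
    then show ?thesis using c(2)[OF that] by (simp add: coeff)
  qed
  note ann = this
  have z: "(?T ^^ degree p) v i = 0" if "i < m" for i
  proof (rule nilpotent_if_annihilated[of m M p, OF _ \<open>p \<noteq> 0\<close> ann that])
    show "v i = 0" if "z \<noteq> 0" "\<And>i. i < m \<Longrightarrow> ?T v i = z * v i" "i < m" for z v i
      using eig that by blast
  qed
  have "\<forall>i<m. (?T ^^ (degree p + k)) v i = 0" for k
  proof (induction k)
    case 0
    show ?case using z by simp
  next
    case (Suc k)
    then show ?case by (simp add: mat_app_def[of _ _ "(?T ^^ (degree p + k)) v"])
  qed
  from this[of "t - degree p"] show ?thesis using deg t i by simp
qed

text \<open>The transpose is the adjoint for the pairing sum of c_i d_i, so powers can be moved to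
  the other argument and tested against unit vectors.\<close>

lemma nilpotent_transpose:
  assumes nil: "\<And>v i. i < m \<Longrightarrow> (mat_app m M ^^ t) v i = 0" and k: "k < m"
  shows "(mat_app m (\<lambda>i j. M j i) ^^ t) v k = 0"
proof -
  have adj: "(\<Sum>i<m. c i * mat_app m M d i) = (\<Sum>i<m. mat_app m (\<lambda>i j. M j i) c i * d i)" for c d
  proof -
    have "(\<Sum>i<m. c i * mat_app m M d i) = (\<Sum>i<m. \<Sum>j<m. c i * M i j * d j)"
      by (simp add: mat_app_def sum_distrib_left mult.assoc)
    also have "\<dots> = (\<Sum>j<m. \<Sum>i<m. c i * M i j * d j)" by (rule sum.swap)
    finally show ?thesis unfolding mat_app_def sum_distrib_right by (simp only: mult_ac)
  qed
  have pow: "(\<Sum>i<m. c i * (mat_app m M ^^ t) d i) = (\<Sum>i<m. (mat_app m (\<lambda>i j. M j i) ^^ t) c i * d i)" for t c d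
  proof (induction t arbitrary: c)
    case (Suc t)
    have "(\<Sum>i<m. c i * (mat_app m M ^^ Suc t) d i) =
        (\<Sum>i<m. c i * mat_app m M ((mat_app m M ^^ t) d) i)" by simp
    also have "\<dots> = (\<Sum>i<m. mat_app m (\<lambda>i j. M j i) c i * (mat_app m M ^^ t) d i)" by (rule adj)
    also have "\<dots> = (\<Sum>i<m. (mat_app m (\<lambda>i j. M j i) ^^ t) (mat_app m (\<lambda>i j. M j i) c) i * d i)"
      by (rule Suc.IH)
    finally show ?case by (simp add: funpow_swap1)
  qed simp
  have "(\<Sum>i<m. (mat_app m (\<lambda>i j. M j i) ^^ t) v i * (if i = k then 1 else 0)) = 0"
    unfolding pow[symmetric] by (simp add: nil)
  then show ?thesis using k by (simp add: if_distrib[of "\<lambda>z. _ * z"] cong: if_cong)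
qed

lemma injective_imp_inverse_matrix:
  fixes A :: "nat \<Rightarrow> nat \<Rightarrow> complex"
  assumes inj: "\<And>w i. (\<And>i. i < n \<Longrightarrow> mat_app n A w i = 0) \<Longrightarrow> i < n \<Longrightarrow> w i = 0"
  shows "\<exists>B. (\<forall>w. \<forall>i<n. mat_app n A (mat_app n B w) i = w i) \<and>
    (\<forall>w. \<forall>i<n. mat_app n B (mat_app n A w) i = w i)"
proof -
  have conv: "(mat n n (\<lambda>(i, j). C i j) *\<^sub>v vec n w) $ i = mat_app n C w i" if "i < n" for C w i
    using that by (auto simp: mat_app_def scalar_prod_def lessThan_atLeast0 intro!: sum.cong)
  define M where "M = mat n n (\<lambda>(i, j). A i j)"
  have M: "M \<in> carrier_mat n n" by (simp add: M_def)
  have "det M \<noteq> 0"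
  proof
    assume "det M = 0"
    then obtain v where v: "v \<in> carrier_vec n" "v \<noteq> 0\<^sub>v n" "M *\<^sub>v v = 0\<^sub>v n"
      using det_0_iff_vec_prod_zero_field[OF M] by blast
    have vv: "v = vec n (vec_index v)" using v(1) by (intro eq_vecI) auto
    have "mat_app n A (vec_index v) i = 0" if "i < n" for i
    proof -
      have "mat_app n A (vec_index v) i = (M *\<^sub>v vec n (vec_index v)) $ i"
        unfolding M_def by (rule conv[symmetric, OF that])
      also have "\<dots> = 0" unfolding vv[symmetric] v(3) using that by simp
      finally show ?thesis .
    qed
    then have "v = 0\<^sub>v n" using inj v(1) by (intro eq_vecI) auto
    with v(2) show False by simp
  qed
  from det_non_zero_imp_unit[OF M this, of "()"]
  obtain C where C: "C \<in> carrier_mat n n" "C * M = 1\<^sub>m n" "M * C = 1\<^sub>m n"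
    by (auto simp: Units_def ring_mat_def)
  define B where "B i j = C $$ (i, j)" for i j
  have CB: "C = mat n n (\<lambda>(i, j). B i j)" using C(1) by (intro eq_matI) (auto simp: B_def)
  have vec_app: "mat n n (\<lambda>(i, j). D i j) *\<^sub>v vec n w = vec n (mat_app n D w)" for D w
    using conv[of _ D w] by (intro eq_vecI) auto
  have "vec n (mat_app n A (mat_app n B w)) = vec n w" for w
  proof -
    have "vec n (mat_app n A (mat_app n B w)) = M *\<^sub>v (C *\<^sub>v vec n w)"
      unfolding M_def CB vec_app ..
    also have "\<dots> = (M * C) *\<^sub>v vec n w" using M C(1) by simp
    finally show ?thesis using C(3) by simp
  qed
  moreover have "vec n (mat_app n B (mat_app n A w)) = vec n w" for w
  proof -
    have "vec n (mat_app n B (mat_app n A w)) = C *\<^sub>v (M *\<^sub>v vec n w)"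
      unfolding M_def CB vec_app ..
    also have "\<dots> = (C * M) *\<^sub>v vec n w" using M C(1) by simp
    finally show ?thesis using C(2) by simp
  qed
  ultimately show ?thesis by (metis index_vec)
qed

subsection \<open>Reduction to gradient maps\<close>

text \<open>In the chain rule the inner derivatives are constants, so each derivative of the
  substituted polynomial is again of the same kind with a smaller bound.\<close>

lemma degree_le_psubst_linear:
  assumes lin: "\<And>i k. \<exists>c. partial_deriv i (g k) = const_poly c"
  shows "degree_le d p \<Longrightarrow> degree_le d (psubst g p)"
proof (induction d arbitrary: p)
  case 0
  obtain m where "p \<in> polys m" using polys_exists by blast
  then show ?case using 0 by (simp add: partial_deriv_psubst)
next
  case (Suc d)
  obtain m where m: "p \<in> polys m" using polys_exists by blast
  have "degree_le d (psubst g (partial_deriv k p) * partial_deriv i (g k))" for i k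
  proof -
    obtain c where c: "partial_deriv i (g k) = const_poly c" using lin by blast
    have "degree_le d (psubst g (partial_deriv k p))" using Suc by simp
    from degree_le_const_mult[OF this, of c] show ?thesis by (simp add: c mult.commute)
  qed
  then show ?case by (auto simp: partial_deriv_psubst[OF m] intro: degree_le_sum)
qed

text \<open>For \<open>z = a + \<i> b\<close> and \<open>w = a - \<i> b\<close>, the gradient map of
  \<open>P(a, b) = (1/2) \<Sum>\<^sub>j w\<^sub>j H\<^sub>j(z)\<close> acts as \<open>z \<mapsto> z - H(z)\<close> in the coordinates \<open>z\<close>.\<close>

locale symmetrization =
  fixes m :: nat and H :: "nat \<Rightarrow> cpoly"
  assumes H_polys: "j < m \<Longrightarrow> H j \<in> polys m"
begin

abbreviation "N \<equiv> m + m"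

definition Z :: "nat \<Rightarrow> cpoly" where "Z k = pvar k + const_poly \<i> * pvar (m + k)"
definition W :: "nat \<Rightarrow> cpoly" where "W k = pvar k - const_poly \<i> * pvar (m + k)"
definition P :: cpoly where "P = const_poly (1 / 2) * (\<Sum>j<m. W j * psubst Z (H j))"

definition zc :: "(nat \<Rightarrow> complex) \<Rightarrow> nat \<Rightarrow> complex" where "zc x k = x k + \<i> * x (m + k)"
definition wc :: "(nat \<Rightarrow> complex) \<Rightarrow> nat \<Rightarrow> complex" where "wc x k = x k - \<i> * x (m + k)"

lemma peval_Z: "peval (Z k) x = zc x k" and peval_W: "peval (W k) x = wc x k"
  by (simp_all add: Z_def W_def zc_def wc_def)

lemma peval_psubst_Z: "peval (psubst Z p) x = peval p (zc x)"
proof -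
  have "(\<lambda>k. peval (Z k) x) = zc x" by (simp add: peval_Z fun_eq_iff)
  then show ?thesis by (simp add: peval_psubst)
qed

lemma Z_polys: "k < m \<Longrightarrow> Z k \<in> polys N" and W_polys: "k < m \<Longrightarrow> W k \<in> polys N"
  unfolding Z_def W_def
  by (intro polys_add polys_diff polys_mult polys_const polys_pvar; simp)+

lemma P_polys: "P \<in> polys N"
  unfolding P_def
  by (intro polys_mult polys_const polys_sum W_polys polys_psubst[OF H_polys] Z_polys) auto

lemma degree_le_P:
  assumes deg: "\<And>j. j < m \<Longrightarrow> degree_le 3 (H j)"
  shows "degree_le 4 P"
proof -
  have linZ: "\<exists>c. partial_deriv i (Z k) = const_poly c" for i k
  proof -
    have "partial_deriv i (Z k) =
        const_poly ((if i = k then 1 else 0) + (if i = m + k then \<i> else 0))"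
      by (simp add: Z_def partial_deriv_add partial_deriv_const_mult partial_deriv_pvar const_poly_add)
    then show ?thesis by blast
  qed
  have "degree_le 1 (W j)" for j
  proof -
    have "W j = pvar j + const_poly (- \<i>) * pvar (m + j)" by (simp add: W_def const_poly_uminus)
    then show ?thesis
      using degree_le_add[OF degree_le_pvar degree_le_const_mult[OF degree_le_pvar]] by simp
  qed
  from degree_le_mult[OF this degree_le_psubst_linear[OF linZ deg]]
  have "degree_le 4 (W j * psubst Z (H j))" if "j < m" for j
    using that by (simp del: degree_le.simps)
  then show ?thesis
    unfolding P_def by (intro degree_le_const_mult degree_le_sum) simp
qed

text \<open>The part of the gradient that comes from differentiating \<open>H\<close>; it vanishes
  on w = 0, the subspace on which the original map is recovered.\<close>

abbreviation "V k \<equiv> (\<Sum>j<m. W j * psubst Z (partial_deriv k (H j)))"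

lemma partial_deriv_psubst_Z:
  assumes "p \<in> polys m" "k < m"
  shows "partial_deriv k (psubst Z p) = psubst Z (partial_deriv k p)"
    and "partial_deriv (m + k) (psubst Z p) = const_poly \<i> * psubst Z (partial_deriv k p)"
proof -
  have 1: "partial_deriv k (Z l) = (if l = k then 1 else 0)"
    and 2: "partial_deriv (m + k) (Z l) = (if l = k then const_poly \<i> else 0)" if "l < m" for l
    using that assms(2)
    by (auto simp: Z_def partial_deriv_add partial_deriv_const_mult partial_deriv_pvar)
  have "partial_deriv k (psubst Z p) = (\<Sum>l<m. if l = k then psubst Z (partial_deriv l p) else 0)"
    unfolding partial_deriv_psubst[OF assms(1)] by (intro sum.cong refl) (simp add: 1)
  then show "partial_deriv k (psubst Z p) = psubst Z (partial_deriv k p)" using assms(2) by simp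
  have "partial_deriv (m + k) (psubst Z p) =
      (\<Sum>l<m. if l = k then const_poly \<i> * psubst Z (partial_deriv l p) else 0)"
    unfolding partial_deriv_psubst[OF assms(1)] by (intro sum.cong refl) (simp add: 2 mult.commute)
  then show "partial_deriv (m + k) (psubst Z p) = const_poly \<i> * psubst Z (partial_deriv k p)"
    using assms(2) by simp
qed

lemma partial_deriv_P:
  assumes k: "k < m"
  shows "partial_deriv k P = const_poly (1 / 2) * (psubst Z (H k) + V k)"
    and "partial_deriv (m + k) P =
      const_poly (1 / 2) * (const_poly \<i> * V k - const_poly \<i> * psubst Z (H k))"
proof -
  have 1: "partial_deriv k (W l) = (if l = k then 1 else 0)"
    and 2: "partial_deriv (m + k) (W l) = - (if l = k then const_poly \<i> else 0)" if "l < m" for l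
    using that k by (auto simp: W_def partial_deriv_diff partial_deriv_const_mult partial_deriv_pvar)
  have "partial_deriv k (\<Sum>j<m. W j * psubst Z (H j)) =
      (\<Sum>j<m. (if j = k then psubst Z (H j) else 0) + W j * psubst Z (partial_deriv k (H j)))"
    unfolding partial_deriv_sum partial_deriv_mult
    by (intro sum.cong refl) (simp add: 1 k partial_deriv_psubst_Z H_polys)
  then show "partial_deriv k P = const_poly (1 / 2) * (psubst Z (H k) + V k)"
    using k by (simp add: P_def partial_deriv_const_mult sum.distrib)
  have "partial_deriv (m + k) (\<Sum>j<m. W j * psubst Z (H j)) =
      (\<Sum>j<m. const_poly \<i> * (W j * psubst Z (partial_deriv k (H j))) -
        (if j = k then const_poly \<i> * psubst Z (H j) else 0))"
    unfolding partial_deriv_sum partial_deriv_mult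
    by (intro sum.cong refl) (simp add: 2 k partial_deriv_psubst_Z H_polys)
  then have "partial_deriv (m + k) (\<Sum>j<m. W j * psubst Z (H j)) =
      const_poly \<i> * V k - const_poly \<i> * psubst Z (H k)"
    using k by (simp add: sum_subtractf sum_distrib_left)
  then show "partial_deriv (m + k) P =
      const_poly (1 / 2) * (const_poly \<i> * V k - const_poly \<i> * psubst Z (H k))"
    unfolding P_def partial_deriv_const_mult by simp
qed

definition hess_app :: "(nat \<Rightarrow> complex) \<Rightarrow> (nat \<Rightarrow> complex) \<Rightarrow> nat \<Rightarrow> complex" where
  "hess_app x w a = dir_deriv N (partial_deriv a P) x w"

definition J :: "(nat \<Rightarrow> complex) \<Rightarrow> nat \<Rightarrow> nat \<Rightarrow> complex" where
  "J x i j = peval (partial_deriv j (H i)) (zc x)"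

lemma dir_deriv_psubst_Z:
  assumes "p \<in> polys m"
  shows "dir_deriv N (psubst Z p) x w = dir_deriv m p (zc x) (zc w)"
  unfolding dir_deriv_psubst[OF assms]
  by (rule dir_deriv_cong[OF assms]) (auto simp: peval_Z Z_def zc_def dir_deriv_simps)

lemma dir_deriv_V:
  assumes k: "k < m"
  shows "dir_deriv N (V k) x w = mat_app m (\<lambda>i j. J x j i) (wc w) k +
    (\<Sum>j<m. wc x j * dir_deriv m (partial_deriv k (H j)) (zc x) (zc w))"
proof -
  have "dir_deriv N (W j) x w = wc w j" if "j < m" for j
    using that by (simp add: W_def wc_def dir_deriv_simps)
  then have "dir_deriv N (V k) x w = (\<Sum>j<m. J x j k * wc w j +
      wc x j * dir_deriv m (partial_deriv k (H j)) (zc x) (zc w))"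
    unfolding dir_deriv_sum dir_deriv_mult
    by (intro sum.cong refl)
      (simp add: dir_deriv_psubst_Z polys_partial_deriv H_polys peval_W peval_psubst_Z J_def)
  then show ?thesis by (simp add: sum.distrib mat_app_def)
qed

text \<open>In the coordinates z, w the Hessian is block triangular: the Jacobian of
  \<open>H\<close> acts on z, its transpose acts on w, and the second derivatives of
  \<open>H\<close> only feed z into w.\<close>

lemma hess_app_coords:
  assumes k: "k < m"
  shows "zc (hess_app x w) k = mat_app m (J x) (zc w) k"
    and "wc (hess_app x w) k = mat_app m (\<lambda>i j. J x j i) (wc w) k +
      (\<Sum>j<m. wc x j * dir_deriv m (partial_deriv k (H j)) (zc x) (zc w))"
proof -
  have H: "dir_deriv N (psubst Z (H k)) x w = mat_app m (J x) (zc w) k"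
    unfolding dir_deriv_psubst_Z[OF H_polys[OF k]]
    by (simp add: dir_deriv_def mat_app_def J_def mult.commute)
  have *: "hess_app x w k = (1 / 2) * (mat_app m (J x) (zc w) k + dir_deriv N (V k) x w)"
    "hess_app x w (m + k) = (1 / 2) * (\<i> * dir_deriv N (V k) x w - \<i> * mat_app m (J x) (zc w) k)"
    by (simp_all add: hess_app_def partial_deriv_P[OF k] H dir_deriv_mult dir_deriv_add
        dir_deriv_diff dir_deriv_const del: sum_distrib_left)
  show "zc (hess_app x w) k = mat_app m (J x) (zc w) k"
    unfolding zc_def[of "hess_app x w"] * by (simp add: field_simps)
  show "wc (hess_app x w) k = mat_app m (\<lambda>i j. J x j i) (wc w) k +
      (\<Sum>j<m. wc x j * dir_deriv m (partial_deriv k (H j)) (zc x) (zc w))"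
    unfolding dir_deriv_V[OF k, symmetric] wc_def[of "hess_app x w"] * by (simp add: field_simps)
qed

text \<open>The first m iterations kill the z part, and with it the coupling; another m iterations
  of the transposed Jacobian kill the w part. Hence the bound \<open>N\<close>, twice m.\<close>

lemma hess_app_nilpotent:
  assumes nil: "\<And>v i t. i < m \<Longrightarrow> m \<le> t \<Longrightarrow> (mat_app m (J x) ^^ t) v i = 0"
    and a: "a < N" and t: "N \<le> t"
  shows "(hess_app x ^^ t) w a = 0"
proof -
  have z: "\<forall>k<m. zc ((hess_app x ^^ t) w) k = (mat_app m (J x) ^^ t) (zc w) k" for t
  proof (induction t)
    case (Suc t)
    then have "mat_app m (J x) (zc ((hess_app x ^^ t) w)) = mat_app m (J x) ((mat_app m (J x) ^^ t) (zc w))"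
      by (intro mat_app_cong) simp
    then show ?case by (simp add: hess_app_coords)
  qed simp
  then have z0: "zc ((hess_app x ^^ t) w) k = 0" if "k < m" "m \<le> t" for k t
    using nil that by simp
  let ?T = "mat_app m (\<lambda>i j. J x j i)"
  have w: "\<forall>k<m. wc ((hess_app x ^^ (m + s)) w) k = (?T ^^ s) (wc ((hess_app x ^^ m) w)) k" for s
  proof (induction s)
    case (Suc s)
    then have eq: "?T (wc ((hess_app x ^^ (m + s)) w)) = ?T ((?T ^^ s) (wc ((hess_app x ^^ m) w)))"
      by (intro mat_app_cong) simp
    have "dir_deriv m p y (zc ((hess_app x ^^ (m + s)) w)) = 0" for p y
      by (rule dir_deriv_zero) (simp add: z0)
    then show ?case by (simp add: hess_app_coords eq)
  qed simp
  have w0: "wc ((hess_app x ^^ t) w) k = 0" if k: "k < m" for k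
  proof -
    obtain s where s: "t = m + s" "m \<le> s" using t by (metis le_add_diff_inverse add_leD1 add_le_cancel_left)
    show ?thesis
      using w[of s] k nilpotent_transpose[where m = m and M = "J x" and t = s and k = k] nil s by simp
  qed
  have coords: "v k = 0 \<and> v (m + k) = 0" if "zc v k = 0" "wc v k = 0" for v k
    using that by (auto simp: zc_def wc_def)
  have both: "(hess_app x ^^ t) w k = 0 \<and> (hess_app x ^^ t) w (m + k) = 0" if "k < m" for k
    by (rule coords) (use z0 w0 that t in auto)
  show ?thesis
  proof (cases "a < m")
    case False
    then show ?thesis using both[of "a - m"] a by simp
  qed (use both in blast)
qed

text \<open>The gradient map preserves the subspace w = 0 and acts there as y - H(y), so its inverse
  is restricted to that subspace and read off in the z coordinates.\<close>

lemma has_inverse_of_gradient: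
  assumes inv: "\<exists>G. (\<forall>i<N. G i \<in> polys N) \<and>
     (\<forall>x. \<forall>i<N. peval (G i) (\<lambda>j. x j - peval (partial_deriv j P) x) = x i) \<and>
     (\<forall>x. \<forall>i<N. peval (G i) x - peval (partial_deriv i P) (\<lambda>j. peval (G j) x) = x i)"
  shows "has_inverse m (\<lambda>j. pvar j - H j)"
proof -
  obtain G where G: "\<And>i. i < N \<Longrightarrow> G i \<in> polys N"
    "\<And>x i. i < N \<Longrightarrow> peval (G i) (\<lambda>j. x j - peval (partial_deriv j P) x) = x i"
    "\<And>x i. i < N \<Longrightarrow> peval (G i) x - peval (partial_deriv i P) (\<lambda>j. peval (G j) x) = x i"
    using inv by blast
  \<comment> \<open>The solution of a + \<i> b = y and a - \<i> b = 0, that is, the point with z = y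
    and w = 0.\<close>
  define E :: "(nat \<Rightarrow> complex) \<Rightarrow> nat \<Rightarrow> complex" where
    "E y a = (if a < m then 1 / 2 * y a else - \<i> / 2 * y (a - m))" for y a
  define e :: "nat \<Rightarrow> cpoly" where
    "e a = (if a < m then const_poly (1 / 2) * pvar a else const_poly (- \<i> / 2) * pvar (a - m))" for a
  define G' where "G' j = psubst e (G j + const_poly \<i> * G (m + j))" for j
  have zE: "zc (E y) k = y k" and wE: "wc (E y) k = 0" if "k < m" for y k
    using that by (simp_all add: zc_def wc_def E_def field_simps)
  have eE: "(\<lambda>a. peval (e a) y) = E y" for y by (auto simp: e_def E_def)
  have ev: "peval (G' j) y = zc (\<lambda>a. peval (G a) (E y)) j" for j y
    by (simp add: G'_def peval_psubst eE zc_def)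
  have G'_polys: "G' j \<in> polys m" if "j < m" for j
    unfolding G'_def
  proof (rule polys_psubst)
    show "G j + const_poly \<i> * G (m + j) \<in> polys N"
      using that by (intro polys_add polys_mult polys_const G) auto
    show "e a \<in> polys m" if "a < N" for a
      using that by (auto simp: e_def intro!: polys_mult polys_pvar)
  qed
  have coord: "zc (\<lambda>a. x a - peval (partial_deriv a P) x) k = zc x k - peval (H k) (zc x)"
    if "k < m" for x k
    using that by (simp add: zc_def[of "\<lambda>a. x a - peval (partial_deriv a P) x"] partial_deriv_P
        peval_psubst_Z) (simp add: zc_def field_simps)
  have grad_E: "E x a - peval (partial_deriv a P) (E x) = E (\<lambda>j. x j - peval (H j) x) a"
    if a: "a < N" for x a
  proof -
    have Hz: "peval (H k) (zc (E x)) = peval (H k) x" if "k < m" for k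
      by (rule peval_cong[OF H_polys[OF that]]) (simp add: zE)
    have V0: "peval (V k) (E x) = 0" for k by (simp add: peval_W wE)
    show ?thesis
    proof (cases "a < m")
      case True
      then show ?thesis
        using V0[of a] by (simp add: partial_deriv_P peval_psubst_Z Hz E_def field_simps)
    next
      case False
      then obtain k where k: "a = m + k" "k < m" using a by (metis le_add_diff_inverse not_less nat_add_left_cancel_less)
      then show ?thesis
        unfolding k(1) partial_deriv_P(2)[OF k(2)]
        using V0[of k] k(2) by (simp add: peval_psubst_Z Hz E_def field_simps)
    qed
  qed
  have "peval (G' i) (\<lambda>j. peval (pvar j - H j) x) = x i" if i: "i < m" for i x
  proof -
    have "peval (G a) (E (\<lambda>j. peval (pvar j - H j) x)) = E x a" if a: "a < N" for a
    proof -
      have "peval (G a) (E (\<lambda>j. peval (pvar j - H j) x)) =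
          peval (G a) (\<lambda>j. E x j - peval (partial_deriv j P) (E x))"
        by (rule peval_cong[OF G(1)[OF a]]) (simp add: grad_E)
      then show ?thesis using G(2)[OF a] by simp
    qed
    then have "zc (\<lambda>a. peval (G a) (E (\<lambda>j. peval (pvar j - H j) x))) i = zc (E x) i"
      using i by (simp add: zc_def)
    then show ?thesis unfolding ev using zE[OF i] by simp
  qed
  moreover have "peval (pvar i - H i) (\<lambda>j. peval (G' j) x) = x i" if i: "i < m" for i x
  proof -
    let ?y = "\<lambda>a. peval (G a) (E x)"
    have "peval (pvar i - H i) (\<lambda>j. peval (G' j) x) = zc ?y i - peval (H i) (zc ?y)"
      by (simp add: ev)
    also have "\<dots> = zc (\<lambda>a. ?y a - peval (partial_deriv a P) ?y) i" by (rule coord[OF i, symmetric])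
    also have "\<dots> = zc (E x) i" using i G(3) by (simp add: zc_def)
    finally show ?thesis using zE[OF i] by simp
  qed
  ultimately show ?thesis using G'_polys unfolding has_inverse_def by blast
qed

end

lemma funpow_hess_op_peval:
  "peval ((potential.hess_op N P ^^ t) c a) x =
    ((\<lambda>w a. dir_deriv N (partial_deriv a P) x w) ^^ t) (\<lambda>j. peval (c j) x) a"
proof (induction t arbitrary: a)
  case (Suc t)
  then show ?case
    by (simp add: potential.hess_op_def dir_deriv_def partial_deriv_commute[of a] mult.commute)
qed simp

lemma has_inverse_nilpotent:
  assumes hyp: "\<forall>\<^sub>F r in sequentially. \<exists>M::nat. 0 < M \<and>
      (\<forall>m. M + 1 \<le> m \<and> m \<le> 2 * M \<longrightarrow> mbar r 4 (nu m) = mbar r 4 0)"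
    and polys: "\<And>j. j < m \<Longrightarrow> H j \<in> polys m" and deg: "\<And>j. j < m \<Longrightarrow> degree_le 3 (H j)"
    and eig: "\<And>x z v. z \<noteq> 0 \<Longrightarrow> (\<And>i. i < m \<Longrightarrow> dir_deriv m (H i) x v = z * v i) \<Longrightarrow>
      (\<And>i. i < m \<Longrightarrow> v i = 0)"
  shows "has_inverse m (\<lambda>j. pvar j - H j)"
proof -
  interpret symmetrization m H using polys by unfold_locales
  obtain R where R: "\<And>r. R \<le> r \<Longrightarrow> \<exists>M::nat. 0 < M \<and>
      (\<forall>m. M + 1 \<le> m \<and> m \<le> 2 * M \<longrightarrow> mbar r 4 (nu m) = mbar r 4 0)"
    using hyp unfolding eventually_sequentially by blast
  \<comment> \<open>Large enough for the hypothesis, for a chain with an interior vertex, and for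
    \<open>r - 2\<close> to reach the nilpotency exponent \<open>N\<close>.\<close>
  define r where "r = max R (N + 3)"
  have r: "3 \<le> r" "N \<le> r - 2" by (auto simp: r_def)
  obtain M where M: "0 < M" "\<And>m. M + 1 \<le> m \<Longrightarrow> m \<le> 2 * M \<Longrightarrow> mbar r 4 (nu m) = mbar r 4 0"
    using R[of r] by (auto simp: r_def)
  have nilJ: "(mat_app m (J x) ^^ t) v i = 0" if "i < m" "m \<le> t" for x v i t
  proof (rule nilpotent_if_no_eigenvalue[OF _ that(2,1)])
    fix z u i
    assume z: "z \<noteq> 0" and e: "\<And>i. i < m \<Longrightarrow> mat_app m (J x) u i = z * u i" and i: "i < m"
    have "dir_deriv m (H i) (zc x) u = z * u i" if "i < m" for i
      using e[OF that] by (simp add: dir_deriv_def mat_app_def J_def mult.commute)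
    then show "u i = 0" using eig[OF z] i by blast
  qed
  have "(potential.hess_op N P ^^ (r - 2)) c i = 0" if i: "i < N" for c i
  proof (rule peval_zero_imp_zero)
    fix x
    have "(\<lambda>w a. dir_deriv N (partial_deriv a P) x w) = hess_app x"
      by (simp add: hess_app_def fun_eq_iff)
    then show "peval ((potential.hess_op N P ^^ (r - 2)) c i) x = 0"
      unfolding funpow_hess_op_peval using hess_app_nilpotent[OF nilJ i r(2)] by simp
  qed
  from gradient_map_inverse_of_vanishing[OF P_polys degree_le_P[OF deg] r(1) this M]
  show ?thesis by (rule has_inverse_of_gradient)
qed

subsection \<open>Cubic maps\<close>

definition homogeneous :: "nat \<Rightarrow> (complex \<times> nat list) list \<Rightarrow> (complex \<times> nat list) list" where
  "homogeneous d ms = filter (\<lambda>t. length (snd t) = d) ms"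

lemma vars_below_homogeneous: "vars_below n ms \<Longrightarrow> vars_below n (homogeneous d ms)"
  by (auto simp: vars_below_def homogeneous_def)

lemma poly_of_homogeneous_sum:
  assumes "\<forall>t\<in>set ms. length (snd t) \<le> 3"
  shows "poly_of ms = poly_of (homogeneous 0 ms) + poly_of (homogeneous 1 ms) +
    poly_of (homogeneous 2 ms) + poly_of (homogeneous 3 ms)"
  using assms
proof (induction ms)
  case (Cons t ms)
  then have "length (snd t) \<le> 3" by simp
  then have "length (snd t) = 0 \<or> length (snd t) = 1 \<or> length (snd t) = 2 \<or> length (snd t) = 3"
    by linarith
  then show ?case using Cons by (elim disjE) (auto simp: homogeneous_def simp del: mon.simps)
qed (simp add: homogeneous_def)

lemma degree_le_homogeneous: "degree_le d (poly_of (homogeneous d ms))"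
proof (induction ms)
  case (Cons t ms)
  then show ?case
    using degree_le_mon[of t] by (auto simp: homogeneous_def simp del: mon.simps intro: degree_le_add)
qed (simp add: homogeneous_def)

lemma peval_homogeneous:
  "peval (poly_of (homogeneous d ms)) (\<lambda>i. s * x i) = s ^ d * peval (poly_of (homogeneous d ms)) x"
proof -
  have pl: "peval (prod_list (map pvar is)) (\<lambda>i. s * x i) = s ^ length is * peval (prod_list (map pvar is)) x" for "is"
    by (induction "is") simp_all
  have "peval (mon t) (\<lambda>i. s * x i) = s ^ length (snd t) * peval (mon t) x" for t
    by (cases t) (simp add: pl)
  then show ?thesis
    by (induction ms) (simp_all add: homogeneous_def distrib_left del: mon.simps)
qed

text \<open>The factor \<open>s\<close> on the left replaces the exponent d - 1 on the right, which
  would truncate at d = 0.\<close>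

lemma dir_deriv_homogeneous:
  "s * dir_deriv n (poly_of (homogeneous d ms)) (\<lambda>i. s * x i) w =
    s ^ d * dir_deriv n (poly_of (homogeneous d ms)) x w"
proof -
  have ev: "peval (prod_list (map pvar is)) (\<lambda>i. s * x i) = s ^ length is * peval (prod_list (map pvar is)) x" for "is"
    by (induction "is") simp_all
  have pl: "s * dir_deriv n (prod_list (map pvar is)) (\<lambda>i. s * x i) w =
      s ^ length is * dir_deriv n (prod_list (map pvar is)) x w" for "is"
  proof (induction "is")
    case Nil
    show ?case using dir_deriv_const[of n 1] by simp
  next
    case (Cons i js)
    have "s * dir_deriv n (prod_list (map pvar (i # js))) (\<lambda>i. s * x i) w =
        s * dir_deriv n (pvar i) x w * (s ^ length js * peval (prod_list (map pvar js)) x) +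
        s * x i * (s * dir_deriv n (prod_list (map pvar js)) (\<lambda>i. s * x i) w)"
      by (simp add: dir_deriv_mult dir_deriv_pvar ev algebra_simps)
    then show ?case unfolding Cons.IH by (simp add: dir_deriv_mult algebra_simps)
  qed
  have "s * dir_deriv n (mon t) (\<lambda>i. s * x i) w = s ^ length (snd t) * dir_deriv n (mon t) x w" for t
    by (cases t) (simp add: pl dir_deriv_mult dir_deriv_const mult.left_commute)
  then show ?thesis
    by (induction ms) (simp_all add: homogeneous_def distrib_left dir_deriv_add dir_deriv_0 del: mon.simps)
qed

lemma dir_deriv_linear:
  assumes "vars_below n ms"
  shows "dir_deriv n (poly_of (homogeneous 1 ms)) x w = peval (poly_of (homogeneous 1 ms)) w"
  using assms
proof (induction ms)
  case (Cons t ms)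
  then have IH: "dir_deriv n (poly_of (homogeneous 1 ms)) x w = peval (poly_of (homogeneous 1 ms)) w"
    by (simp add: vars_below_def)
  show ?case
  proof (cases "length (snd t) = 1")
    case True
    then obtain c i where t: "t = (c, [i])" by (cases t) (auto simp: length_Suc_conv)
    then have "i < n" using Cons.prems by (auto simp: vars_below_def)
    then show ?thesis using IH t by (simp add: homogeneous_def dir_deriv_simps)
  next
    case False
    then show ?thesis using IH by (simp add: homogeneous_def)
  qed
qed (simp add: homogeneous_def dir_deriv_0)

lemma mat_app_add: "mat_app n B (\<lambda>k. f k + g k) i = mat_app n B f i + mat_app n B g i"
  by (simp add: mat_app_def sum.distrib algebra_simps)

lemma mat_app_zero: "(\<And>k. k < n \<Longrightarrow> f k = 0) \<Longrightarrow> mat_app n B f i = 0"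
  by (simp add: mat_app_def)

text \<open>An affine change in the target makes the linear part the identity. Then n new variables
  take over the cubic part, which makes the nonlinear part nilpotent at every point.\<close>

lemma has_inverse_cubic:
  assumes hyp: "\<forall>\<^sub>F r in sequentially. \<exists>M::nat. 0 < M \<and>
      (\<forall>m. M + 1 \<le> m \<and> m \<le> 2 * M \<longrightarrow> mbar r 4 (nu m) = mbar r 4 0)"
    and vars: "\<forall>j<n. vars_below n (F j)" and len: "\<forall>j<n. \<forall>t\<in>set (F j). length (snd t) \<le> 3"
    and kel: "keller n (\<lambda>j. poly_of (F j))"
  shows "has_inverse n (\<lambda>j. poly_of (F j))"
proof -
  define p where "p j = poly_of (F j)" for j
  define h where "h d j = poly_of (homogeneous d (F j))" for d j
  have p: "p j = h 0 j + h 1 j + h 2 j + h 3 j" if "j < n" for j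
    unfolding p_def h_def using poly_of_homogeneous_sum len that by blast
  have h_polys: "h d j \<in> polys n" if "j < n" for d j
    unfolding h_def using that vars vars_below_homogeneous polys_poly_of by blast
  have sc: "s * dir_deriv n (h d j) (\<lambda>i. s * x i) w = s ^ d * dir_deriv n (h d j) x w" for s d j x w
    unfolding h_def by (rule dir_deriv_homogeneous)
  \<comment> \<open>At s = 0 and d = 0 the scaling identity reads 0 = 0 ^ 0 times the derivative,
    and 0 ^ 0 is 1.\<close>
  have h0: "dir_deriv n (h 0 j) x w = 0" for j x w using sc[of 0 0 j x w] by simp
  define c where "c j = peval (h 0 j) (\<lambda>_. 0)" for j
  have c: "peval (h 0 j) x = c j" for j x
    using peval_homogeneous[of 0 "F j" 0 x] by (simp add: h_def c_def)
  define A where "A j k = peval (partial_deriv k (h 1 j)) (\<lambda>_. 0)" for j k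
  have h1: "dir_deriv n (h 1 j) x w = peval (h 1 j) w" if "j < n" for j x w
    using dir_deriv_linear[of n "F j"] vars that by (simp add: h_def)
  have A: "peval (h 1 j) w = mat_app n A w j" if "j < n" for j w
    unfolding h1[OF that, of "\<lambda>_. 0", symmetric] by (simp add: dir_deriv_def mat_app_def A_def mult.commute)
  \<comment> \<open>At the origin, scaling by 2 gives 2 D = 2^d D, which forces D = 0 for d = 2 and
    d = 3.\<close>
  have h23: "dir_deriv n (h d j) (\<lambda>_. 0) w = 0" if "d = 2 \<or> d = 3" for d j w
    using sc[of 2 d j "\<lambda>_. 0" w] that by auto
  have dp: "dir_deriv n (p j) x w = mat_app n A w j + dir_deriv n (h 2 j) x w + dir_deriv n (h 3 j) x w"
    if "j < n" for j x w
    using that by (simp add: p dir_deriv_add h0 h1[simplified] A[simplified])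
  have "\<exists>B. (\<forall>w. \<forall>i<n. mat_app n A (mat_app n B w) i = w i) \<and>
    (\<forall>w. \<forall>i<n. mat_app n B (mat_app n A w) i = w i)"
  proof (rule injective_imp_inverse_matrix)
    fix w i assume "\<And>i. i < n \<Longrightarrow> mat_app n A w i = 0" and i: "i < n"
    then have "dir_deriv n (p j) (\<lambda>_. 0) w = 0" if "j < n" for j using that by (simp add: dp h23)
    then show "w i = 0" using kel i unfolding keller_def p_def by blast
  qed
  then obtain B where AB: "\<And>w i. i < n \<Longrightarrow> mat_app n A (mat_app n B w) i = w i"
    and BA: "\<And>w i. i < n \<Longrightarrow> mat_app n B (mat_app n A w) i = w i" by blast
  define H where "H d j = (\<Sum>k<n. const_poly (B j k) * h d k)" for d j
  have H_polys: "H d j \<in> polys n" for d j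
    unfolding H_def by (intro polys_sum polys_mult polys_const h_polys) simp
  have peval_H: "peval (H d j) x = mat_app n B (\<lambda>k. peval (h d k) x) j" for d j x
    by (simp add: H_def mat_app_def)
  have dH: "dir_deriv n (H d j) x w = mat_app n B (\<lambda>k. dir_deriv n (h d k) x w) j" for d j x w
    by (simp add: H_def mat_app_def dir_deriv_simps)
  have degH: "degree_le d (H d j)" for d j
    unfolding H_def h_def by (intro degree_le_sum degree_le_const_mult degree_le_homogeneous)
  have scH: "s * dir_deriv n (H d j) (\<lambda>i. s * x i) w = s ^ d * dir_deriv n (H d j) x w" for s d j x w
    unfolding dH mat_app_def sum_distrib_left mult.left_commute[of s] sc
    by (simp only: mult.left_commute)
  \<comment> \<open>\<open>f\<close> is y \<mapsto> B (y - c) applied after \<open>p\<close>; its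
    linear part is the identity.\<close>
  define f where "f j = pvar j + H 2 j + H 3 j" for j
  have df: "dir_deriv n (f j) x w = mat_app n B (\<lambda>k. dir_deriv n (p k) x w) j" if "j < n" for j x w
  proof -
    have "mat_app n B (\<lambda>k. dir_deriv n (p k) x w) =
        mat_app n B (\<lambda>k. mat_app n A w k + dir_deriv n (h 2 k) x w + dir_deriv n (h 3 k) x w)"
      by (rule mat_app_cong) (rule dp)
    then show ?thesis
      using that by (simp add: f_def dir_deriv_add dir_deriv_pvar dH mat_app_add BA)
  qed
  have ef: "peval (f j) x = mat_app n B (\<lambda>k. peval (p k) x - c k) j" if "j < n" for j x
  proof -
    have "mat_app n B (\<lambda>k. peval (p k) x - c k) =
        mat_app n B (\<lambda>k. mat_app n A x k + peval (h 2 k) x + peval (h 3 k) x)"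
      by (rule mat_app_cong) (simp add: p c A[simplified])
    then show ?thesis using that by (simp add: f_def peval_H mat_app_add BA)
  qed
  have kf: "w i = 0" if d0: "\<And>j. j < n \<Longrightarrow> dir_deriv n (f j) x w = 0" and i: "i < n" for x w i
  proof -
    have "dir_deriv n (p j) x w = 0" if j: "j < n" for j
    proof -
      have "dir_deriv n (p j) x w = mat_app n A (mat_app n B (\<lambda>k. dir_deriv n (p k) x w)) j"
        by (rule AB[OF j, symmetric])
      also have "\<dots> = 0" by (rule mat_app_zero) (use d0 df in simp)
      finally show ?thesis .
    qed
    then show ?thesis using kel i unfolding keller_def p_def by blast
  qed
  \<comment> \<open>The enlarged map sends (x, y) to (x - y + H2(x), y + H3(x)). On the locus y = -
    H3(x), where the second half vanishes, its first half is f(x).\<close>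
  define K where "K j = (if j < n then pvar (n + j) - H 2 j else - H 3 (j - n))" for j
  have "has_inverse (n + n) (\<lambda>j. pvar j - K j)"
  proof (rule has_inverse_nilpotent[OF hyp])
    fix j assume j: "j < n + n"
    have "H d j \<in> polys (n + n)" for d j using polys_mono[OF H_polys] by simp
    then show "K j \<in> polys (n + n)"
      using j by (auto simp: K_def intro!: polys_diff polys_uminus polys_pvar)
    have "degree_le 3 (pvar (n + j) + const_poly (- 1) * H 2 j)"
      using degree_le_mono[OF degree_le_pvar, of 3] degree_le_mono[OF degH[of 2], of 3]
      by (intro degree_le_add degree_le_const_mult) auto
    moreover have "degree_le 3 (const_poly (- 1) * H 3 (j - n))"
      by (intro degree_le_const_mult degH)
    ultimately show "degree_le 3 (K j)" by (simp add: K_def const_poly_uminus del: degree_le.simps)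
  next
    fix x z v i
    assume z: "z \<noteq> 0" and e: "\<And>i. i < n + n \<Longrightarrow> dir_deriv (n + n) (K i) x v = z * v i"
      and i: "i < n + n"
    have more: "dir_deriv (n + n) (H d j) x v = dir_deriv n (H d j) x v" for d j
      by (rule dir_deriv_more[OF H_polys]) simp
    have e1: "v (n + j) - dir_deriv n (H 2 j) x v = z * v j"
      and e2: "- dir_deriv n (H 3 j) x v = z * v (n + j)" if "j < n" for j
      using e[of j] e[of "n + j"] that by (simp_all add: K_def dir_deriv_simps more)
    \<comment> \<open>Eliminating the second half of an eigenvector with eigenvalue z gives z^2 v +
      z dH2(x) v + dH3(x) v = 0. After division by z^2, homogeneity turns this into df(x/z) v = 0,
      so the Keller property at x/z gives v = 0.\<close>
    define s where "s = 1 / z"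
    have s: "s \<noteq> 0" "s * z = 1" using z by (simp_all add: s_def)
    have "dir_deriv n (f j) (\<lambda>i. s * x i) v = 0" if j: "j < n" for j
    proof -
      have d2: "dir_deriv n (H 2 j) (\<lambda>i. s * x i) v = s * dir_deriv n (H 2 j) x v"
        using scH[of s 2 j x v] s(1) by (simp add: power2_eq_square)
      have d3: "dir_deriv n (H 3 j) (\<lambda>i. s * x i) v = s * (s * dir_deriv n (H 3 j) x v)"
        using scH[of s 3 j x v] s(1) by (simp add: power3_eq_cube)
      have "dir_deriv n (f j) (\<lambda>i. s * x i) v =
          v j + s * dir_deriv n (H 2 j) x v + s * (s * dir_deriv n (H 3 j) x v)"
        using j by (simp add: f_def dir_deriv_simps d2 d3)
      also have "dir_deriv n (H 2 j) x v = v (n + j) - z * v j" using e1[OF j] by (simp add: algebra_simps)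
      also have "dir_deriv n (H 3 j) x v = - (z * v (n + j))" using e2[OF j] by (simp add: minus_equation_iff)
      also have "v j + s * (v (n + j) - z * v j) + s * (s * - (z * v (n + j))) =
          v j + s * v (n + j) - (s * z) * v j - s * (s * z) * v (n + j)" by (simp add: algebra_simps)
      also have "\<dots> = 0" by (simp add: s(2))
      finally show ?thesis .
    qed
    then have v0: "v j = 0" if "j < n" for j using kf that by blast
    have "v (n + j) = 0" if "j < n" for j
    proof -
      have "dir_deriv n (H 3 j) x v = 0" by (rule dir_deriv_zero) (simp add: v0)
      then show ?thesis using e2[OF that] z by simp
    qed
    then show "v i = 0" using v0 i by (metis le_add_diff_inverse nat_add_left_cancel_less not_less)
  qed
  then have "has_inverse n f"
  proof (rule has_inverse_restrict)
    fix x
    let ?y = "\<lambda>j. if j < n then x j else - peval (H 3 (j - n)) x"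
    have "peval (H d j) ?y = peval (H d j) x" for d j by (rule peval_cong[OF H_polys]) simp
    then show "\<exists>y. (\<forall>j<n. y j = x j) \<and>
        (\<forall>j<n + n. peval (pvar j - K j) y = (if j < n then peval (f j) x else 0))"
      by (intro exI[of _ ?y]) (auto simp: K_def f_def)
  next
    fix z j assume z: "\<And>j. n \<le> j \<Longrightarrow> j < n + n \<Longrightarrow> peval (pvar j - K j) z = 0" and j: "j < n"
    have "z (n + j) = - peval (H 3 j) z" using z[of "n + j"] j by (simp add: K_def eq_neg_iff_add_eq_0)
    then show "peval (pvar j - K j) z = peval (f j) z" using j by (simp add: K_def f_def)
  qed simp
  then obtain G' where G': "\<And>j. j < n \<Longrightarrow> G' j \<in> polys n"
    "\<And>x i. i < n \<Longrightarrow> peval (G' i) (\<lambda>j. peval (f j) x) = x i"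
    "\<And>x i. i < n \<Longrightarrow> peval (f i) (\<lambda>j. peval (G' j) x) = x i"
    unfolding has_inverse_def by blast
  \<comment> \<open>The affine map that normalised \<open>p\<close>: as \<open>f\<close> is
    \<open>L\<close> after \<open>p\<close>, the inverse of \<open>p\<close> is the inverse of
    \<open>f\<close> after \<open>L\<close>.\<close>
  define L where "L y = mat_app n B (\<lambda>k. y k - c k)" for y
  define l where "l i = (\<Sum>k<n. const_poly (B i k) * (pvar k - const_poly (c k)))" for i
  define G where "G i = psubst l (G' i)" for i
  have lL: "(\<lambda>i. peval (l i) y) = L y" for y by (simp add: l_def L_def mat_app_def fun_eq_iff)
  have ev: "peval (G i) y = peval (G' i) (L y)" for i y by (simp add: G_def peval_psubst lL)
  have "G j \<in> polys n" if "j < n" for j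
    unfolding G_def
  proof (rule polys_psubst[OF G'(1)[OF that]])
    show "l i \<in> polys n" for i
      unfolding l_def by (intro polys_sum polys_mult polys_diff polys_const polys_pvar) simp
  qed
  moreover have "peval (G i) (\<lambda>j. peval (p j) x) = x i" if i: "i < n" for i x
  proof -
    have "peval (G i) (\<lambda>j. peval (p j) x) = peval (G' i) (\<lambda>j. peval (f j) x)"
      unfolding ev by (rule peval_cong[OF G'(1)[OF i]]) (simp add: ef L_def)
    then show ?thesis using G'(2)[OF i] by simp
  qed
  moreover have "peval (p i) (\<lambda>j. peval (G j) y) = y i" if i: "i < n" for i y
  proof -
    let ?x = "\<lambda>j. peval (G j) y"
    have "mat_app n B (\<lambda>k. peval (p k) ?x - c k) j = mat_app n B (\<lambda>k. y k - c k) j" if j: "j < n" for j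
      using G'(3)[OF j, of "L y"] ef[OF j, of ?x] unfolding ev L_def by simp
    then have "mat_app n A (mat_app n B (\<lambda>k. peval (p k) ?x - c k)) = mat_app n A (mat_app n B (\<lambda>k. y k - c k))"
      by (rule mat_app_cong)
    then show ?thesis using AB[OF i, of "\<lambda>k. peval (p k) ?x - c k"] AB[OF i, of "\<lambda>k. y k - c k"] by simp
  qed
  ultimately show ?thesis unfolding has_inverse_def p_def[symmetric] by blast
qed

subsection \<open>The Jacobian condition\<close>

lemma comm_ring_hom_peval: "comm_ring_hom (\<lambda>p. peval p x)"
  by unfold_locales simp_all

lemma keller_if_jacobian:
  assumes F: "\<forall>j<n. F j \<in> polys n" and c: "c \<noteq> 0" "det (jacobian n F) = const_poly c"
  shows "keller n F"
  unfolding keller_def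
proof (intro allI impI)
  fix x w i
  assume d: "\<forall>j<n. dir_deriv n (F j) x w = 0" and i: "i < n"
  interpret ev: comm_ring_hom "\<lambda>p. peval p x" by (rule comm_ring_hom_peval)
  \<comment> \<open>In \<open>jacobian\<close> the row is the variable of differentiation, so the
    matrix acting on directions is its transpose, evaluated at \<open>x\<close>.\<close>
  define M where "M = mat n n (\<lambda>(j, i). peval (partial_deriv i (F j)) x)"
  have M: "M \<in> carrier_mat n n" by (simp add: M_def)
  have "transpose_mat M = map_mat (\<lambda>p. peval p x) (jacobian n F)"
    by (intro eq_matI) (auto simp: M_def jacobian_def)
  then have "det M = peval (det (jacobian n F)) x"
    using det_transpose[OF M] by (simp add: ev.hom_det)
  then have "det M \<noteq> 0" using c by simp
  moreover have "M *\<^sub>v vec n w = 0\<^sub>v n"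
  proof (rule eq_vecI)
    fix j assume "j < dim_vec (0\<^sub>v n)"
    then have j: "j < n" by simp
    have "(M *\<^sub>v vec n w) $ j = dir_deriv n (F j) x w"
      using j by (auto simp: M_def scalar_prod_def dir_deriv_def lessThan_atLeast0 intro!: sum.cong)
    then show "(M *\<^sub>v vec n w) $ j = 0\<^sub>v n $ j" using d j by simp
  qed (simp add: M_def)
  ultimately have "vec n w = 0\<^sub>v n" using det_0_iff_vec_prod_zero_field[OF M] vec_carrier by blast
  then show "w i = 0" using i by (metis index_vec index_zero_vec(1))
qed

lemma poly_automorphism_if_has_inverse:
  assumes F: "\<forall>j<n. F j \<in> polys n" and inv: "has_inverse n F"
  shows "poly_automorphism n F"
proof -
  obtain G where G: "\<And>j. j < n \<Longrightarrow> G j \<in> polys n"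
    "\<And>x i. i < n \<Longrightarrow> peval (G i) (\<lambda>j. peval (F j) x) = x i"
    "\<And>x i. i < n \<Longrightarrow> peval (F i) (\<lambda>j. peval (G j) x) = x i"
    using inv unfolding has_inverse_def by blast
  have comp: "poly_map n p (poly_map n q x) = x"
    if p: "\<And>j. j < n \<Longrightarrow> p j \<in> polys n" and x: "x \<in> carrier_vec n"
      and pq: "\<And>x i. i < n \<Longrightarrow> peval (p i) (\<lambda>j. peval (q j) x) = x i" for p q x
  proof (rule eq_vecI)
    fix i assume "i < dim_vec x"
    then have i: "i < n" using x by simp
    have "poly_map n p (poly_map n q x) $ i = peval (p i) (\<lambda>j. peval (q j) (vec_index x))"
      using i unfolding poly_map_def by (auto intro: peval_cong[OF p])
    then show "poly_map n p (poly_map n q x) $ i = x $ i" using pq[OF i] by simp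
  qed (use x in \<open>simp add: poly_map_def\<close>)
  show ?thesis
    unfolding poly_automorphism_def
    by (intro exI[of _ G] conjI allI impI ballI comp) (use F G in auto)
qed

lemma has_inverse_cong:
  assumes inv: "has_inverse n p" and eq: "\<And>j. j < n \<Longrightarrow> p j = q j"
  shows "has_inverse n q"
proof -
  obtain G where G: "\<And>j. j < n \<Longrightarrow> G j \<in> polys n"
    "\<And>x i. i < n \<Longrightarrow> peval (G i) (\<lambda>j. peval (p j) x) = x i"
    "\<And>x i. i < n \<Longrightarrow> peval (p i) (\<lambda>j. peval (G j) x) = x i"
    using inv unfolding has_inverse_def by blast
  have "peval (G i) (\<lambda>j. peval (q j) x) = peval (G i) (\<lambda>j. peval (p j) x)" if "i < n" for i x
    by (rule peval_cong[OF G(1)[OF that]]) (simp add: eq)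
  then show ?thesis
    unfolding has_inverse_def using G eq by (intro exI[of _ G]) simp
qed

theorem theorem3p18:
  assumes "\<forall>\<^sub>F r in sequentially. \<exists>M::nat. 0 < M \<and>
             (\<forall>m. M + 1 \<le> m \<and> m \<le> 2 * M \<longrightarrow> mbar r 4 (nu m) = mbar r 4 0)"
  shows "\<forall>(n::nat) (F :: nat \<Rightarrow> cpoly).
           1 \<le> n \<longrightarrow> (\<forall>j<n. F j \<in> polys n) \<longrightarrow>
           (\<exists>c. c \<noteq> 0 \<and> det (jacobian n F) = const_poly c) \<longrightarrow>
           poly_automorphism n F"
proof (intro allI impI)
  fix n and F :: "nat \<Rightarrow> cpoly"
  assume F: "\<forall>j<n. F j \<in> polys n" and jac: "\<exists>c. c \<noteq> 0 \<and> det (jacobian n F) = const_poly c"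
  have "\<forall>j. \<exists>ms. j < n \<longrightarrow> vars_below n ms \<and> poly_of ms = F j"
    using F poly_of_exists by blast
  then obtain L where L: "\<And>j. j < n \<Longrightarrow> vars_below n (L j) \<and> poly_of (L j) = F j"
    by metis
  have "keller n F" using keller_if_jacobian F jac by blast
  then have "keller n (\<lambda>j. poly_of (L j))" using L by (simp add: keller_def)
  then have "has_inverse n (\<lambda>j. poly_of (L j))"
    using degree_reduction[OF has_inverse_cubic[OF assms]] L by blast
  then have "has_inverse n F" by (rule has_inverse_cong) (simp add: L)
  then show "poly_automorphism n F" by (rule poly_automorphism_if_has_inverse[OF F])
qed

end
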